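(* Let $\mathcal{Z}=(z_n)_{n\ge 1}\subset\mathbb{D}$ be a sequence of points of the unit disk. For $n\ge 1$ let $\mathcal{M}_n=\mathcal{M}(\mathcal{Z}_n,\mathcal{D})$ be the closed subspace of the Dirichlet space $\mathcal{D}$ consisting of all $f\in\mathcal{D}$ vanishing on $\mathcal{Z}_n=(z_1,\dots,z_n)$, let $\phi_n$ be an extremal function associated with $\mathcal{M}_n$, and let $\mu_n$ be the measure on $\mathbb{T}$ given by $d\mu_n(\zeta)=|\phi_n(\zeta)|^2\,dm(\zeta)$; put $\mu_0=m$. Let $k^{\mu}_z$ denote the reproducing kernel of $\mathcal{D}(\mu)$ at $z$. Then $\mathcal{Z}$ is a zero set for $\mathcal{D}$ if and only if $$\sum_{n\ge 1}\frac{1}{k^{\mu_{n-1}}_{z_n}(z_n)}<\infty .$$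
   Context: $\mathbb{D}$ is the open unit disk, $\mathbb{T}=\partial\mathbb{D}$, $m$ is the normalized arc length measure on $\mathbb{T}$, and $H^2$ is the Hardy space of analytic functions on $\mathbb{D}$ with square summable Taylor coefficients, $\|f\|_{H^2}^2=\sum|\hat f(n)|^2$. For $f\in H^2$ and $\zeta\in\mathbb{T}$, $f(\zeta)$ denotes the non-tangential (radial) limit, which exists for $m$-a.e. $\zeta$. For a finite positive measure $\mu$ on $\mathbb{T}$, absolutely continuous with respect to $m$, $\mathcal{D}(\mu)$ is the space of $f\in H^2$ with $$\mathcal{D}_\mu(f)=\frac1{2\pi}\int_{\mathbb{T}}\int_{\mathbb{T}}\frac{|f(\zeta)-f(\xi)|^2}{|\zeta-\xi|^2}\,|d\zeta|\,d\mu(\xi)<\infty,$$ with norm $\|f\|_{\mathcal{D}(\mu)}^2=\|f\|_{H^2}^2+\mathcal{D}_\mu(f)$ and the corresponding inner product. The classical Dirichlet space is $\mathcal{D}=\mathcal{D}(m)$. The reproducing kernel $k^\mu_z\in\mathcal{D}(\mu)$ is defined by $f(z)=\langle f,k^\mu_z\rangle_{\mathcal{D}(\mu)}$ for $f\in\mathcal{D}(\mu)$, $z\in\mathbb{D}$. If $\mathcal{M}$ is a non-zero closed subspace of $\mathcal{D}(\mu)$ with $z\mathcal{M}\subset\mathcal{M}$, then $\dim(\mathcal{M}\ominus z\mathcal{M})=1$; an extremal function associated with $\mathcal{M}$ is a function $\phi\in\mathcal{M}\ominus z\mathcal{M}$ with $\|\phi\|_{\mathcal{D}(\mu)}=1$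 (unique up to a unimodular constant; it satisfies $|\phi|\le 1$ on $\mathbb{D}$). Points of a sequence may be repeated, and vanishing on a finite or infinite sequence is understood with multiplicity: $f$ has at each point a zero of order at least the number of times the point occurs in the sequence. $\mathcal{Z}$ is a zero set for $\mathcal{D}$ if there is $f\in\mathcal{D}$, $f\not\equiv 0$, vanishing on $\mathcal{Z}$. *)

theory Defs
  imports "HOL-Complex_Analysis.Complex_Analysis"
begin

abbreviation unit_disk :: "complex set" where
  "unit_disk \<equiv> ball 0 1"

abbreviation unit_circle :: "complex set" where
  "unit_circle \<equiv> sphere 0 1"

text \<open>Functions on the disk are represented by total functions \<open>complex \<Rightarrow> complex\<close>; every notion
  below depends only on their values on \<open>unit_disk\<close>.\<close>

definition arc_length :: "complex measure" where
  "arc_length = distr (restrict_space lborel {0..<2 * pi}) (restrict_space borel unit_circle) cis"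

definition norm_arc_length :: "complex measure" where
  "norm_arc_length = scale_measure (ennreal (1 / (2 * pi))) arc_length"

definition taylor_coeff :: "(complex \<Rightarrow> complex) \<Rightarrow> nat \<Rightarrow> complex" where
  "taylor_coeff f n = (deriv ^^ n) f 0 / fact n"

definition hardy2 :: "(complex \<Rightarrow> complex) set" where
  "hardy2 = {f. f holomorphic_on unit_disk \<and> summable (\<lambda>n. (norm (taylor_coeff f n))\<^sup>2)}"

text \<open>The radial limit at \<open>\<zeta>\<close>. For \<open>f \<in> hardy2\<close> it exists almost everywhere on the circle; where
  it does not exist, the value is an irrelevant constant.\<close>

definition boundary_value :: "(complex \<Rightarrow> complex) \<Rightarrow> complex \<Rightarrow> complex" where
  "boundary_value f \<zeta> = Lim (at_left (1::real)) (\<lambda>r. f (of_real r * \<zeta>))"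

text \<open>The measures \<open>\<mu>\<close> below are meant to be finite measures on the circle, absolutely continuous
  with respect to \<open>norm_arc_length\<close>. The quotients are \<open>0\<close> on the null set \<open>\<zeta> = \<xi>\<close>.\<close>

definition dirichlet_integral :: "complex measure \<Rightarrow> (complex \<Rightarrow> complex) \<Rightarrow> ennreal" where
  "dirichlet_integral \<mu> f =
     ennreal (1 / (2 * pi)) *
       (\<integral>\<^sup>+\<xi>. (\<integral>\<^sup>+\<zeta>. ennreal ((norm (boundary_value f \<zeta> - boundary_value f \<xi>))\<^sup>2
                              / (norm (\<zeta> - \<xi>))\<^sup>2) \<partial>arc_length) \<partial>\<mu>)"

definition dirichlet_space :: "complex measure \<Rightarrow> (complex \<Rightarrow> complex) set" where
  "dirichlet_space \<mu> = {f \<in> hardy2. dirichlet_integral \<mu> f < \<infinity>}"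

definition dirichlet_norm :: "complex measure \<Rightarrow> (complex \<Rightarrow> complex) \<Rightarrow> real" where
  "dirichlet_norm \<mu> f =
     sqrt ((\<Sum>n. (norm (taylor_coeff f n))\<^sup>2) + enn2real (dirichlet_integral \<mu> f))"

definition dirichlet_inner ::
    "complex measure \<Rightarrow> (complex \<Rightarrow> complex) \<Rightarrow> (complex \<Rightarrow> complex) \<Rightarrow> complex" where
  "dirichlet_inner \<mu> f g =
     (\<Sum>n. taylor_coeff f n * cnj (taylor_coeff g n)) +
     of_real (1 / (2 * pi)) *
       (\<integral>\<xi>. (\<integral>\<zeta>. (boundary_value f \<zeta> - boundary_value f \<xi>)
                    * cnj (boundary_value g \<zeta> - boundary_value g \<xi>)
                    / of_real ((norm (\<zeta> - \<xi>))\<^sup>2) \<partial>arc_length) \<partial>\<mu>)"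

text \<open>As an element of the function space the kernel is unique on \<open>unit_disk\<close> only; it is always
  evaluated there.\<close>

definition reproducing_kernel :: "complex measure \<Rightarrow> complex \<Rightarrow> complex \<Rightarrow> complex" where
  "reproducing_kernel \<mu> w =
     (SOME k. k \<in> dirichlet_space \<mu> \<and> (\<forall>f\<in>dirichlet_space \<mu>. f w = dirichlet_inner \<mu> f k))"

text \<open>\<open>\<phi>\<close> is a unit vector of \<open>M \<ominus> z M\<close>, for \<open>M\<close> a non-zero closed \<open>z\<close>-invariant subspace of
  \<open>dirichlet_space \<mu>\<close>.\<close>

definition extremal_function ::
    "complex measure \<Rightarrow> (complex \<Rightarrow> complex) set \<Rightarrow> (complex \<Rightarrow> complex) \<Rightarrow> bool" where
  "extremal_function \<mu> M \<phi> \<longleftrightarrow>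
     \<phi> \<in> M \<and> (\<forall>f\<in>M. dirichlet_inner \<mu> \<phi> (\<lambda>z. z * f z) = 0) \<and> dirichlet_norm \<mu> \<phi> = 1"

definition zero_of_order_ge :: "(complex \<Rightarrow> complex) \<Rightarrow> complex \<Rightarrow> nat \<Rightarrow> bool" where
  "zero_of_order_ge f w k \<longleftrightarrow> (\<forall>j<k. (deriv ^^ j) f w = 0)"

text \<open>Vanishing with multiplicity on the family \<open>z i\<close>, \<open>i \<in> I\<close>. Quantifying over the finite \<open>J\<close>
  makes a point that occurs infinitely often a zero of infinite order.\<close>

definition vanishes_on :: "nat set \<Rightarrow> (nat \<Rightarrow> complex) \<Rightarrow> (complex \<Rightarrow> complex) \<Rightarrow> bool" where
  "vanishes_on I z f \<longleftrightarrow>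
     (\<forall>w. \<forall>J\<subseteq>{i \<in> I. z i = w}. finite J \<longrightarrow> zero_of_order_ge f w (card J))"

definition vanishing_subspace ::
    "complex measure \<Rightarrow> nat set \<Rightarrow> (nat \<Rightarrow> complex) \<Rightarrow> (complex \<Rightarrow> complex) set" where
  "vanishing_subspace \<mu> I z = {f \<in> dirichlet_space \<mu>. vanishes_on I z f}"

definition is_zero_set :: "complex measure \<Rightarrow> nat set \<Rightarrow> (nat \<Rightarrow> complex) \<Rightarrow> bool" where
  "is_zero_set \<mu> I z \<longleftrightarrow> (\<exists>f \<in> vanishing_subspace \<mu> I z. \<exists>w\<in>unit_disk. f w \<noteq> 0)"

end

theory Submission
  imports Defs
begin

text \<open>
  Let \<open>\<phi>\<^sub>n\<close> be the extremal function of \<open>M\<^sub>n\<close>. Orthogonality to polynomial multiples gives a linear recurrence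
  for its weighted Taylor coefficients, so \<open>\<phi>\<^sub>n\<close> is holomorphic across the circle, and it has no zeros in
  the closed disk besides \<open>z\<^sub>1, \<dots>, z\<^sub>n\<close>. Hence \<open>\<D>(\<mu>\<^sub>n) = \<D>\<close> as sets, \<open>M\<^sub>n = \<phi>\<^sub>n \<D>\<close>, and \<open>\<phi>\<^sub>n \<bottom> z\<^sup>k \<phi>\<^sub>n\<close> makes
  multiplication by \<open>\<phi>\<^sub>n\<close> an isometry from \<open>\<D>(\<mu>\<^sub>n)\<close> onto \<open>M\<^sub>n\<close>. The quotient \<open>\<psi>\<^sub>n = \<phi>\<^sub>n\<^sub>+\<^sub>1 / \<phi>\<^sub>n\<close> is the extremal function
  of \<open>{f. f z\<^sub>n\<^sub>+\<^sub>1 = 0}\<close> in \<open>\<D>(\<mu>\<^sub>n)\<close>, from which the kernel at \<open>z\<^sub>n\<^sub>+\<^sub>1\<close> is computed: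
  its value there has reciprocal \<open>1 - |\<psi>\<^sub>n(0)|\<^sup>2\<close>. So the series converges iff the products
  \<open>\<Prod> |\<psi>\<^sub>j(0)|\<^sup>2\<close> of its tails stay away from \<open>0\<close>, that is, iff the lowest Taylor coefficient of \<open>\<phi>\<^sub>n\<close> at \<open>0\<close>
  does not tend to \<open>0\<close>; a locally uniform limit of the \<open>\<phi>\<^sub>n\<close> is then a non-zero function vanishing on the sequence.

  Since \<open>dirichlet_integral\<close> is defined by radial limits, Fatou's theorem for the Hardy space and Douglas'
  formula are needed to relate it to Taylor coefficients.
\<close>

text \<open>The recurrence has constant coefficients, because \<phi>_n is orthogonal to every
  x^(j+1) times the polynomial with zeros z_1, ..., z_n. Its characteristic roots conj(z_i) lie
  inside the disk, which forces geometric decay. Continuation across the circle is what makes the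
  spaces comparable: |\<phi>_n| is bounded below there and 1/\<phi>_n is Lipschitz, so that division
  by \<phi>_n stays within the Dirichlet space and all weighted computations move into the one
  unweighted space.

  The point 0 enters because the constant 1 is the kernel at 0 for every weight. Moreover the
  weighted norm dominates the Hardy norm, so f = \<phi>_n u implies |u(0)| <= ||f||. For a non-zero
  f vanishing on the whole sequence, this keeps the lowest coefficient of \<phi>_n away from 0.
  Lowest coefficients replace values at 0 since 0 may itself occur in the sequence; a step that adds
  it has \<psi>_n(0) = 0, so the products must start beyond all such steps.\<close>

abbreviation (input) normalized_arc (\<open>\<m>\<close>) where "\<m> \<equiv> norm_arc_length"


subsection \<open>The Dirichlet space in terms of Taylor coefficients\<close>

lemma has_fps_taylor:
  assumes "f holomorphic_on unit_disk"
  shows "f has_fps_expansion Abs_fps (taylor_coeff f)"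
proof -
  have "f has_fps_expansion fps_expansion f 0"
    by (rule has_fps_expansion_fps_expansion[of unit_disk]) (use assms in auto)
  moreover have "fps_expansion f 0 = Abs_fps (taylor_coeff f)"
    by (simp add: fps_expansion_def taylor_coeff_def[abs_def])
  ultimately show ?thesis by simp
qed

lemma taylor_coeff_eqI: "f has_fps_expansion F \<Longrightarrow> taylor_coeff f n = fps_nth F n"
  by (simp add: taylor_coeff_def fps_nth_fps_expansion)

lemma taylor_sums:
  assumes "f holomorphic_on unit_disk" "norm z < 1"
  shows "(\<lambda>n. taylor_coeff f n * z ^ n) sums f z"
  using holomorphic_power_series[OF assms(1), of z] assms(2) by (simp add: taylor_coeff_def)

lemma power_series_holomorphic_ball:
  fixes a :: "nat \<Rightarrow> complex"
  assumes "\<And>z. norm z < r \<Longrightarrow> (\<lambda>n. a n * z ^ n) sums f z"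
  shows "f holomorphic_on ball 0 r"
  by (rule power_series_holomorphic[where a = a]) (use assms in auto)

lemma taylor_coeff_unique:
  assumes "r > 0" "\<And>z. norm z < r \<Longrightarrow> (\<lambda>n. a n * z ^ n) sums f z"
  shows "taylor_coeff f n = a n"
proof -
  have "f has_fps_expansion Abs_fps a"
  proof (rule has_fps_expansionI)
    show "eventually (\<lambda>u. (\<lambda>n. fps_nth (Abs_fps a) n * u ^ n) sums f u) (nhds 0)"
      by (rule eventually_nhds_in_open[of "ball 0 r", THEN eventually_mono]) (use assms in auto)
  qed
  then show ?thesis by (simp add: taylor_coeff_eqI)
qed

lemma taylor_coeff_cong:
  assumes "\<And>z. norm z < 1 \<Longrightarrow> f z = g z"
  shows "taylor_coeff f n = taylor_coeff g n"
proof -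
  have "eventually (\<lambda>x. f x = g x) (nhds 0)"
    by (rule eventually_nhds_in_open[of unit_disk, THEN eventually_mono]) (use assms in auto)
  then show ?thesis unfolding taylor_coeff_def by (metis higher_deriv_cong_ev)
qed

lemma holomorphic_unit_disk_cong:
  assumes "\<And>z. norm z < 1 \<Longrightarrow> f z = g z"
  shows "f holomorphic_on unit_disk \<longleftrightarrow> g holomorphic_on unit_disk"
  by (rule holomorphic_cong) (use assms in auto)

lemma taylor_coeff_0: "taylor_coeff f 0 = f 0" by (simp add: taylor_coeff_def)

context
  fixes f g assumes f: "f holomorphic_on unit_disk" and g: "g holomorphic_on unit_disk"
begin

lemma taylor_coeff_add: "taylor_coeff (\<lambda>z. f z + g z) n = taylor_coeff f n + taylor_coeff g n"
  using taylor_coeff_eqI[OF has_fps_expansion_add[OF has_fps_taylor[OF f] has_fps_taylor[OF g]]] by simp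

lemma taylor_coeff_diff: "taylor_coeff (\<lambda>z. f z - g z) n = taylor_coeff f n - taylor_coeff g n"
  using taylor_coeff_eqI[OF has_fps_expansion_diff[OF has_fps_taylor[OF f] has_fps_taylor[OF g]]] by simp

lemma taylor_coeff_mult:
  "taylor_coeff (\<lambda>z. f z * g z) n = (\<Sum>i\<le>n. taylor_coeff f i * taylor_coeff g (n - i))"
  using taylor_coeff_eqI[OF has_fps_expansion_mult[OF has_fps_taylor[OF f] has_fps_taylor[OF g]]]
  by (simp add: fps_mult_nth atMost_atLeast0)

end

lemma taylor_coeff_cmult:
  "f holomorphic_on unit_disk \<Longrightarrow> taylor_coeff (\<lambda>z. c * f z) n = c * taylor_coeff f n"
  using taylor_coeff_eqI[OF has_fps_expansion_cmult_left[OF has_fps_taylor]] by simp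

lemma taylor_coeff_shift_Suc:
  "f holomorphic_on unit_disk \<Longrightarrow> taylor_coeff (\<lambda>z. z * f z) (Suc n) = taylor_coeff f n"
  using taylor_coeff_eqI[OF has_fps_expansion_mult[OF has_fps_expansion_fps_X has_fps_taylor]] by simp

lemma taylor_coeff_shift_0: "taylor_coeff (\<lambda>z. z * f z) 0 = 0"
  by (simp add: taylor_coeff_0)

lemma taylor_coeff_power: "taylor_coeff (\<lambda>z. z ^ j) n = (if n = j then 1 else 0)"
  using taylor_coeff_eqI[OF has_fps_expansion_fps_X_power, of j n] by (simp add: fps_X_power_nth)

lemma taylor_coeff_one: "taylor_coeff (\<lambda>z. 1) n = (if n = 0 then 1 else 0)"
  using taylor_coeff_power[of 0 n] by simp

lemma taylor_coeff_sum:
  assumes "finite A" "\<And>i. i \<in> A \<Longrightarrow> f i holomorphic_on unit_disk"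
  shows "taylor_coeff (\<lambda>z. \<Sum>i\<in>A. f i z) n = (\<Sum>i\<in>A. taylor_coeff (f i) n)"
  using assms
proof (induction A rule: finite_induct)
  case empty
  have "(\<lambda>z::complex. 0::complex) has_fps_expansion 0" by simp
  from taylor_coeff_eqI[OF this] show ?case by simp
next
  case (insert i A)
  then show ?case by (simp add: taylor_coeff_add holomorphic_on_sum)
qed

section \<open>Weighted square-summable sequences\<close>

lemma power2_norm_add_le: "(norm (a + b :: complex))\<^sup>2 \<le> 2 * (norm a)\<^sup>2 + 2 * (norm b)\<^sup>2"
proof -
  have "(norm (a + b))\<^sup>2 \<le> (norm a + norm b)\<^sup>2"
    by (intro power_mono norm_triangle_ineq) auto
  also have "\<dots> \<le> 2 * (norm a)\<^sup>2 + 2 * (norm b)\<^sup>2"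
    using sum_squares_ge_zero[of "norm a - norm b" 0] by (simp add: power2_eq_square algebra_simps)
  finally show ?thesis .
qed

lemma power2_norm_diff_le: "(norm (a - b :: complex))\<^sup>2 \<le> 2 * (norm a)\<^sup>2 + 2 * (norm b)\<^sup>2"
  using power2_norm_add_le[of a "-b"] by simp

lemma norm_mult_cnj_le: "norm (a * cnj b) \<le> ((norm a)\<^sup>2 + (norm b)\<^sup>2) / 2"
  using sum_squares_bound[of "norm a" "norm b"] by (simp add: norm_mult)

context
  fixes w :: "nat \<Rightarrow> real" and a b :: "nat \<Rightarrow> complex"
  assumes w: "\<And>n. w n \<ge> 0"
    and a: "summable (\<lambda>n. w n * (norm (a n))\<^sup>2)" and b: "summable (\<lambda>n. w n * (norm (b n))\<^sup>2)"
begin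

lemma norm_weighted_mult_cnj_le:
  "norm (of_real (w n) * (a n * cnj (b n))) \<le> (w n * (norm (a n))\<^sup>2 + w n * (norm (b n))\<^sup>2) / 2"
proof -
  have "norm (of_real (w n) * (a n * cnj (b n))) = w n * norm (a n * cnj (b n))"
    using w by (simp add: norm_mult)
  also have "\<dots> \<le> w n * (((norm (a n))\<^sup>2 + (norm (b n))\<^sup>2) / 2)"
    by (intro mult_left_mono norm_mult_cnj_le w)
  finally show ?thesis by (simp add: algebra_simps)
qed

lemma summable_norm_weighted_mult_cnj: "summable (\<lambda>n. norm (of_real (w n) * (a n * cnj (b n))))"
  by (rule summable_comparison_test'[OF summable_divide[OF summable_add[OF a b], of 2], of 0])
     (use norm_weighted_mult_cnj_le in auto)

lemma summable_weighted_mult_cnj: "summable (\<lambda>n. of_real (w n) * (a n * cnj (b n)))"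
  using summable_norm_weighted_mult_cnj by (rule summable_norm_cancel)

text \<open>The termwise bound 2|ab| <= |a|^2 + |b|^2 takes the place of Cauchy-Schwarz. What it
  loses is regained in \<open>sesquilinear_eq_zero\<close> by rescaling the two arguments against
  each other.\<close>

lemma norm_suminf_weighted_mult_cnj_le:
  "norm (\<Sum>n. of_real (w n) * (a n * cnj (b n)))
     \<le> ((\<Sum>n. w n * (norm (a n))\<^sup>2) + (\<Sum>n. w n * (norm (b n))\<^sup>2)) / 2"
proof -
  have "norm (\<Sum>n. of_real (w n) * (a n * cnj (b n)))
     \<le> (\<Sum>n. norm (of_real (w n) * (a n * cnj (b n))))"
    by (rule summable_norm[OF summable_norm_weighted_mult_cnj])
  also have "\<dots> \<le> (\<Sum>n. (w n * (norm (a n))\<^sup>2 + w n * (norm (b n))\<^sup>2) / 2)"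
    by (intro suminf_le norm_weighted_mult_cnj_le summable_norm_weighted_mult_cnj summable_divide summable_add a b)
  also have "\<dots> = ((\<Sum>n. w n * (norm (a n))\<^sup>2) + (\<Sum>n. w n * (norm (b n))\<^sup>2)) / 2"
    using suminf_add[OF a b] by (simp add: suminf_divide[OF summable_add[OF a b]])
  finally show ?thesis .
qed

lemma summable_weighted_add: "summable (\<lambda>n. w n * (norm (a n + b n))\<^sup>2)"
proof (rule summable_comparison_test')
  show "summable (\<lambda>n. 2 * (w n * (norm (a n))\<^sup>2) + 2 * (w n * (norm (b n))\<^sup>2))"
    by (intro summable_add summable_mult a b)
  show "norm (w n * (norm (a n + b n))\<^sup>2) \<le> 2 * (w n * (norm (a n))\<^sup>2) + 2 * (w n * (norm (b n))\<^sup>2)" for n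
    using mult_left_mono[OF power2_norm_add_le[of "a n" "b n"] w[of n]] w[of n]
    by (simp add: algebra_simps)
qed

end

definition hardy_norm2 :: "(complex \<Rightarrow> complex) \<Rightarrow> real" where
  "hardy_norm2 f = (\<Sum>n. (norm (taylor_coeff f n))\<^sup>2)"

text \<open>By Douglas' formula these are \<open>dirichlet_space \<m>\<close>, its squared norm and its inner product.\<close>

definition dir_space :: "(complex \<Rightarrow> complex) set" where
  "dir_space = {f. f holomorphic_on unit_disk \<and> summable (\<lambda>n. real (n + 1) * (norm (taylor_coeff f n))\<^sup>2)}"

definition dir_norm2 :: "(complex \<Rightarrow> complex) \<Rightarrow> real" where
  "dir_norm2 f = (\<Sum>n. real (n + 1) * (norm (taylor_coeff f n))\<^sup>2)"

definition dir_inner :: "(complex \<Rightarrow> complex) \<Rightarrow> (complex \<Rightarrow> complex) \<Rightarrow> complex" where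
  "dir_inner f g = (\<Sum>n. of_real (real (n + 1)) * (taylor_coeff f n * cnj (taylor_coeff g n)))"

lemma hardy2_holo: "f \<in> hardy2 \<Longrightarrow> f holomorphic_on unit_disk"
  and hardy2_summable: "f \<in> hardy2 \<Longrightarrow> summable (\<lambda>n. (norm (taylor_coeff f n))\<^sup>2)"
  by (auto simp: hardy2_def)

lemma dir_space_holo: "f \<in> dir_space \<Longrightarrow> f holomorphic_on unit_disk"
  and dir_space_summable: "f \<in> dir_space \<Longrightarrow> summable (\<lambda>n. real (n + 1) * (norm (taylor_coeff f n))\<^sup>2)"
  by (auto simp: dir_space_def)

lemma dir_space_imp_hardy2: "f \<in> dir_space \<Longrightarrow> f \<in> hardy2"
  by (auto simp: hardy2_def dir_space_def intro: summable_comparison_test' simp: algebra_simps)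

lemma hardy_norm2_le_dir_norm2: "f \<in> dir_space \<Longrightarrow> hardy_norm2 f \<le> dir_norm2 f"
  unfolding hardy_norm2_def dir_norm2_def
  by (intro suminf_le hardy2_summable dir_space_imp_hardy2 dir_space_summable) (auto simp: algebra_simps)

lemma dir_space_iff: "f \<in> dir_space \<longleftrightarrow> f \<in> hardy2 \<and> summable (\<lambda>n. real n * (norm (taylor_coeff f n))\<^sup>2)"
proof
  assume f: "f \<in> dir_space"
  have "summable (\<lambda>n. real n * (norm (taylor_coeff f n))\<^sup>2)"
    by (rule summable_comparison_test'[OF dir_space_summable[OF f]]) (auto simp: algebra_simps)
  with f show "f \<in> hardy2 \<and> summable (\<lambda>n. real n * (norm (taylor_coeff f n))\<^sup>2)"
    using dir_space_imp_hardy2 by blast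
next
  assume f: "f \<in> hardy2 \<and> summable (\<lambda>n. real n * (norm (taylor_coeff f n))\<^sup>2)"
  then have "summable (\<lambda>n. real n * (norm (taylor_coeff f n))\<^sup>2 + (norm (taylor_coeff f n))\<^sup>2)"
    by (intro summable_add) (auto simp: hardy2_def)
  with f show "f \<in> dir_space" by (simp add: dir_space_def hardy2_def algebra_simps)
qed

lemma dir_norm2_eq: "f \<in> dir_space \<Longrightarrow> dir_norm2 f = hardy_norm2 f + (\<Sum>n. real n * (norm (taylor_coeff f n))\<^sup>2)"
  unfolding hardy_norm2_def dir_norm2_def
  using dir_space_iff[of f] by (subst suminf_add) (auto simp: hardy2_def algebra_simps)

lemma dir_space_cong: "(\<And>z. norm z < 1 \<Longrightarrow> f z = g z) \<Longrightarrow> f \<in> dir_space \<longleftrightarrow> g \<in> dir_space"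
  unfolding dir_space_def using holomorphic_unit_disk_cong[of f g] taylor_coeff_cong[of f g] by auto

lemma dir_norm2_cong: "(\<And>z. norm z < 1 \<Longrightarrow> f z = g z) \<Longrightarrow> dir_norm2 f = dir_norm2 g"
  unfolding dir_norm2_def using taylor_coeff_cong[of f g] by auto

lemma dir_inner_cong:
  "(\<And>z. norm z < 1 \<Longrightarrow> f z = f' z) \<Longrightarrow> (\<And>z. norm z < 1 \<Longrightarrow> g z = g' z) \<Longrightarrow> dir_inner f g = dir_inner f' g'"
  unfolding dir_inner_def using taylor_coeff_cong[of f f'] taylor_coeff_cong[of g g'] by auto

lemma hardy_norm2_nonneg: "f \<in> hardy2 \<Longrightarrow> hardy_norm2 f \<ge> 0"
  unfolding hardy_norm2_def by (intro suminf_nonneg hardy2_summable) auto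

lemma dir_norm2_nonneg: "f \<in> dir_space \<Longrightarrow> dir_norm2 f \<ge> 0"
  unfolding dir_norm2_def by (intro suminf_nonneg dir_space_summable) auto

lemma hardy2_add: "f \<in> hardy2 \<Longrightarrow> g \<in> hardy2 \<Longrightarrow> (\<lambda>z. f z + g z) \<in> hardy2"
  using summable_weighted_add[of "\<lambda>_. 1" "taylor_coeff f" "taylor_coeff g"]
  by (auto simp: hardy2_def taylor_coeff_add intro!: holomorphic_intros)

lemma hardy2_cmult: "f \<in> hardy2 \<Longrightarrow> (\<lambda>z. c * f z) \<in> hardy2"
  by (auto simp: hardy2_def taylor_coeff_cmult norm_mult power_mult_distrib intro!: holomorphic_intros summable_mult)

lemma hardy2_diff: "f \<in> hardy2 \<Longrightarrow> g \<in> hardy2 \<Longrightarrow> (\<lambda>z. f z - g z) \<in> hardy2"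
  using hardy2_add[of f "\<lambda>z. (-1) * g z"] hardy2_cmult[of g "-1"] by simp

lemma dir_space_add: "f \<in> dir_space \<Longrightarrow> g \<in> dir_space \<Longrightarrow> (\<lambda>z. f z + g z) \<in> dir_space"
  using summable_weighted_add[of "\<lambda>n. real (n + 1)" "taylor_coeff f" "taylor_coeff g"]
  by (auto simp: dir_space_def taylor_coeff_add intro!: holomorphic_intros)

lemma dir_space_cmult: "f \<in> dir_space \<Longrightarrow> (\<lambda>z. c * f z) \<in> dir_space"
  unfolding dir_space_def
  using summable_mult[of "\<lambda>n. real (n + 1) * (norm (taylor_coeff f n))\<^sup>2" "(norm c)\<^sup>2"]
  by (auto simp: taylor_coeff_cmult norm_mult power_mult_distrib algebra_simps intro!: holomorphic_intros)

lemma dir_space_diff: "f \<in> dir_space \<Longrightarrow> g \<in> dir_space \<Longrightarrow> (\<lambda>z. f z - g z) \<in> dir_space"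
  using dir_space_add[of f "\<lambda>z. (-1) * g z"] dir_space_cmult[of g "-1"] by simp

lemma dir_norm2_cmult: "f \<in> dir_space \<Longrightarrow> dir_norm2 (\<lambda>z. c * f z) = (norm c)\<^sup>2 * dir_norm2 f"
  unfolding dir_norm2_def
  using suminf_mult[OF dir_space_summable, of f "(norm c)\<^sup>2"]
  by (simp add: taylor_coeff_cmult dir_space_holo norm_mult power_mult_distrib mult.left_commute)

lemma dir_space_finite:
  assumes "f holomorphic_on unit_disk" "\<And>n. n > N \<Longrightarrow> taylor_coeff f n = 0"
  shows "f \<in> dir_space"
  unfolding dir_space_def
  using assms(1) by (auto intro!: summable_finite[of "{..N}"]) (metis assms(2) not_le)

lemma dir_space_power: "(\<lambda>z. z ^ j) \<in> dir_space"
  by (rule dir_space_finite[of _ j]) (auto simp: taylor_coeff_power intro!: holomorphic_intros)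

lemma dir_space_shift: "f \<in> dir_space \<Longrightarrow> (\<lambda>z. z * f z) \<in> dir_space"
proof -
  assume f: "f \<in> dir_space"
  have "summable (\<lambda>n. real (Suc n + 1) * (norm (taylor_coeff (\<lambda>z. z * f z) (Suc n)))\<^sup>2)"
  proof (rule summable_comparison_test')
    show "summable (\<lambda>n. 2 * (real (n + 1) * (norm (taylor_coeff f n))\<^sup>2))"
      by (intro summable_mult dir_space_summable f)
    show "norm (real (Suc n + 1) * (norm (taylor_coeff (\<lambda>z. z * f z) (Suc n)))\<^sup>2)
       \<le> 2 * (real (n + 1) * (norm (taylor_coeff f n))\<^sup>2)" for n
      by (simp add: taylor_coeff_shift_Suc[OF dir_space_holo[OF f]] mult_right_mono
          flip: mult.assoc)
  qed
  then have "summable (\<lambda>n. real (n + 1) * (norm (taylor_coeff (\<lambda>z. z * f z) n))\<^sup>2)"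
    by (subst (asm) summable_Suc_iff)
  then show ?thesis using f by (auto simp: dir_space_def intro!: holomorphic_intros)
qed

lemma dir_space_power_mult: "f \<in> dir_space \<Longrightarrow> (\<lambda>z. z ^ j * f z) \<in> dir_space"
proof (induction j)
  case (Suc j)
  then show ?case using dir_space_shift[of "\<lambda>z. z ^ j * f z"] by (simp add: mult.assoc)
qed auto

lemma summable_dir_inner:
  "f \<in> dir_space \<Longrightarrow> g \<in> dir_space \<Longrightarrow>
     summable (\<lambda>n. of_real (real (n + 1)) * (taylor_coeff f n * cnj (taylor_coeff g n)))"
  by (rule summable_weighted_mult_cnj) (auto simp: dir_space_def)

lemma summable_hardy_inner:
  "f \<in> hardy2 \<Longrightarrow> g \<in> hardy2 \<Longrightarrow> summable (\<lambda>n. taylor_coeff f n * cnj (taylor_coeff g n))"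
  using summable_weighted_mult_cnj[of "\<lambda>_. 1" "taylor_coeff f" "taylor_coeff g"] by (auto simp: hardy2_def)

lemma dir_inner_add_left:
  "f \<in> dir_space \<Longrightarrow> g \<in> dir_space \<Longrightarrow> h \<in> dir_space \<Longrightarrow> dir_inner (\<lambda>z. f z + g z) h = dir_inner f h + dir_inner g h"
  unfolding dir_inner_def using suminf_add[OF summable_dir_inner summable_dir_inner, of f h g h]
  by (simp add: taylor_coeff_add dir_space_holo algebra_simps)

lemma dir_inner_cmult_left: "f \<in> dir_space \<Longrightarrow> g \<in> dir_space \<Longrightarrow> dir_inner (\<lambda>z. c * f z) g = c * dir_inner f g"
  unfolding dir_inner_def using suminf_mult[OF summable_dir_inner, of f g c]
  by (simp add: taylor_coeff_cmult dir_space_holo mult.assoc mult.left_commute[of _ c])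

lemma dir_inner_cnj: "f \<in> dir_space \<Longrightarrow> g \<in> dir_space \<Longrightarrow> dir_inner g f = cnj (dir_inner f g)"
  unfolding dir_inner_def
  using bounded_linear.suminf[OF bounded_linear_cnj summable_dir_inner[of f g]]
  by (simp add: mult.commute)

lemma dir_inner_cmult_right:
  assumes "f \<in> dir_space" "g \<in> dir_space"
  shows "dir_inner g (\<lambda>z. c * f z) = cnj c * dir_inner g f"
  using dir_inner_cnj[OF dir_space_cmult assms(2), OF assms(1), of c] dir_inner_cnj[OF assms]
  by (simp add: dir_inner_cmult_left assms)

lemma dir_inner_diff_left:
  "f \<in> dir_space \<Longrightarrow> g \<in> dir_space \<Longrightarrow> h \<in> dir_space \<Longrightarrow> dir_inner (\<lambda>z. f z - g z) h = dir_inner f h - dir_inner g h"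
  using dir_inner_add_left[of f "\<lambda>z. (-1) * g z" h] dir_inner_cmult_left[of g h "-1"] dir_space_cmult[of g "-1"] by simp

lemma dir_inner_diff_right:
  assumes "f \<in> dir_space" "g \<in> dir_space" "h \<in> dir_space"
  shows "dir_inner h (\<lambda>z. f z - g z) = dir_inner h f - dir_inner h g"
  using dir_inner_cnj[OF dir_space_diff assms(3), OF assms(1,2)] dir_inner_cnj[OF assms(1,3)] dir_inner_cnj[OF assms(2,3)]
  by (simp add: dir_inner_diff_left assms)

lemma dir_inner_self: "f \<in> dir_space \<Longrightarrow> dir_inner f f = of_real (dir_norm2 f)"
  unfolding dir_inner_def dir_norm2_def
  using suminf_of_real[OF dir_space_summable, of f, where 'a = complex]
  by (simp add: complex_norm_square[symmetric] mult.commute)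

lemma norm_dir_inner_le: "f \<in> dir_space \<Longrightarrow> g \<in> dir_space \<Longrightarrow> norm (dir_inner f g) \<le> (dir_norm2 f + dir_norm2 g) / 2"
  unfolding dir_inner_def dir_norm2_def
  by (rule norm_suminf_weighted_mult_cnj_le) (auto simp: dir_space_def)

text \<open>The shift moves a coefficient from weight n + 1 to weight n + 2, and the excess weight 1
  makes up the Hardy inner product. The isometry rests on this identity.\<close>

lemma dir_inner_shift:
  assumes "f \<in> dir_space" "g \<in> dir_space"
  shows "dir_inner (\<lambda>z. z * f z) (\<lambda>z. z * g z)
           = dir_inner f g + (\<Sum>n. taylor_coeff f n * cnj (taylor_coeff g n))"
proof -
  note S = summable_dir_inner[OF dir_space_shift dir_space_shift, OF assms]
  have "dir_inner (\<lambda>z. z * f z) (\<lambda>z. z * g z)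
     = (\<Sum>n. of_real (real (Suc n + 1)) *
          (taylor_coeff (\<lambda>z. z * f z) (Suc n) * cnj (taylor_coeff (\<lambda>z. z * g z) (Suc n))))"
    unfolding dir_inner_def using suminf_split_head[OF S] by (simp add: taylor_coeff_shift_0)
  also have "\<dots> = (\<Sum>n. of_real (real (n + 1)) * (taylor_coeff f n * cnj (taylor_coeff g n))
                + taylor_coeff f n * cnj (taylor_coeff g n))"
    using assms[THEN dir_space_holo] by (intro suminf_cong) (simp add: taylor_coeff_shift_Suc algebra_simps)
  also have "\<dots> = dir_inner f g + (\<Sum>n. taylor_coeff f n * cnj (taylor_coeff g n))"
    unfolding dir_inner_def using assms[THEN dir_space_imp_hardy2]
    by (intro suminf_add[symmetric] summable_dir_inner summable_hardy_inner assms)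
  finally show ?thesis .
qed

section \<open>Taylor polynomials and their remainders\<close>

definition taylor_poly :: "(complex \<Rightarrow> complex) \<Rightarrow> nat \<Rightarrow> complex \<Rightarrow> complex" where
  "taylor_poly f N z = (\<Sum>n<N. taylor_coeff f n * z ^ n)"

lemma taylor_coeff_taylor_poly: "taylor_coeff (taylor_poly f N) n = (if n < N then taylor_coeff f n else 0)"
proof -
  have "taylor_coeff (taylor_poly f N) n = (\<Sum>i<N. taylor_coeff (\<lambda>z. taylor_coeff f i * z ^ i) n)"
    unfolding taylor_poly_def[abs_def] by (rule taylor_coeff_sum) (auto intro!: holomorphic_intros)
  also have "\<dots> = (\<Sum>i<N. if n = i then taylor_coeff f i else 0)"
  proof (intro sum.cong refl)
    fix i
    have "(\<lambda>z::complex. z ^ i) holomorphic_on unit_disk" by (intro holomorphic_intros)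
    then show "taylor_coeff (\<lambda>z. taylor_coeff f i * z ^ i) n = (if n = i then taylor_coeff f i else 0)"
      using taylor_coeff_cmult[of "\<lambda>z. z ^ i" "taylor_coeff f i" n] by (simp add: taylor_coeff_power)
  qed
  also have "\<dots> = (if n < N then taylor_coeff f n else 0)" by simp
  finally show ?thesis .
qed

lemma taylor_poly_holo: "taylor_poly f N holomorphic_on S"
  unfolding taylor_poly_def[abs_def] by (intro holomorphic_intros)

lemma dir_space_taylor_poly: "taylor_poly f N \<in> dir_space"
  by (rule dir_space_finite[of _ N]) (auto simp: taylor_coeff_taylor_poly taylor_poly_holo)

lemma dir_norm2_remainder_tendsto:
  assumes f: "f \<in> dir_space"
  shows "(\<lambda>N. dir_norm2 (\<lambda>z. f z - taylor_poly f N z)) \<longlonglongrightarrow> 0"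
proof -
  let ?c = "\<lambda>n. real (n + 1) * (norm (taylor_coeff f n))\<^sup>2"
  have "dir_norm2 (\<lambda>z. f z - taylor_poly f N z) = dir_norm2 f - (\<Sum>n<N. ?c n)" for N
  proof -
    have "dir_norm2 (\<lambda>z. f z - taylor_poly f N z) = (\<Sum>n. if n < N then 0 else ?c n)"
      unfolding dir_norm2_def using f[THEN dir_space_holo] taylor_poly_holo
      by (intro suminf_cong) (simp add: taylor_coeff_diff taylor_coeff_taylor_poly)
    also have "\<dots> = (\<Sum>n. ?c n - (if n < N then ?c n else 0))" by (intro suminf_cong) auto
    also have "\<dots> = dir_norm2 f - (\<Sum>n. if n < N then ?c n else 0)"
      unfolding dir_norm2_def by (intro suminf_diff[symmetric] dir_space_summable f summable_finite[of "{..<N}"]) auto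
    also have "(\<Sum>n. if n < N then ?c n else 0) = (\<Sum>n<N. ?c n)"
      by (subst suminf_finite[of "{..<N}"]) auto
    finally show ?thesis .
  qed
  moreover have "(\<lambda>N. dir_norm2 f - (\<Sum>n<N. ?c n)) \<longlonglongrightarrow> dir_norm2 f - dir_norm2 f"
    unfolding dir_norm2_def by (intro tendsto_intros summable_LIMSEQ dir_space_summable f)
  ultimately show ?thesis by simp
qed

lemma hardy_norm2_remainder:
  assumes f: "f \<in> hardy2"
  shows "(\<lambda>z. f z - taylor_poly f N z) \<in> hardy2"
    and "hardy_norm2 (\<lambda>z. f z - taylor_poly f N z) = hardy_norm2 f - (\<Sum>n<N. (norm (taylor_coeff f n))\<^sup>2)"
proof -
  show "(\<lambda>z. f z - taylor_poly f N z) \<in> hardy2"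
    by (intro hardy2_diff f dir_space_imp_hardy2 dir_space_taylor_poly)
  let ?c = "\<lambda>n. (norm (taylor_coeff f n))\<^sup>2"
  have "hardy_norm2 (\<lambda>z. f z - taylor_poly f N z) = (\<Sum>n. if n < N then 0 else ?c n)"
    unfolding hardy_norm2_def using f[THEN hardy2_holo] taylor_poly_holo
    by (intro suminf_cong) (simp add: taylor_coeff_diff taylor_coeff_taylor_poly)
  also have "\<dots> = (\<Sum>n. ?c n - (if n < N then ?c n else 0))" by (intro suminf_cong) auto
  also have "\<dots> = hardy_norm2 f - (\<Sum>n. if n < N then ?c n else 0)"
    unfolding hardy_norm2_def by (intro suminf_diff[symmetric] hardy2_summable f summable_finite[of "{..<N}"]) auto
  also have "(\<Sum>n. if n < N then ?c n else 0) = (\<Sum>n<N. ?c n)"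
    by (subst suminf_finite[of "{..<N}"]) auto
  finally show "hardy_norm2 (\<lambda>z. f z - taylor_poly f N z) = hardy_norm2 f - (\<Sum>n<N. ?c n)" .
qed

lemma hardy_norm2_remainder_tendsto:
  assumes f: "f \<in> hardy2"
  shows "(\<lambda>N. hardy_norm2 (\<lambda>z. f z - taylor_poly f N z)) \<longlonglongrightarrow> 0"
proof -
  have "(\<lambda>N. hardy_norm2 f - (\<Sum>n<N. (norm (taylor_coeff f n))\<^sup>2)) \<longlonglongrightarrow> hardy_norm2 f - hardy_norm2 f"
    unfolding hardy_norm2_def by (intro tendsto_intros summable_LIMSEQ hardy2_summable f)
  then show ?thesis by (simp add: hardy_norm2_remainder[OF f])
qed

subsection \<open>Normalized arc length\<close>

lemma space_arc_length [simp]: "space arc_length = unit_circle"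
  and sets_arc_length [measurable_cong]: "sets arc_length = sets (restrict_space borel unit_circle)"
  by (auto simp: arc_length_def space_restrict_space)

lemma space_norm_arc_length [simp]: "space \<m> = unit_circle"
  and sets_norm_arc_length [measurable_cong]: "sets \<m> = sets (restrict_space borel unit_circle)"
  by (auto simp: norm_arc_length_def space_scale_measure sets_arc_length)

lemma measurable_arc_length_iff: "f \<in> measurable arc_length N \<longleftrightarrow> f \<in> measurable \<m> N"
  by (rule measurable_cong_sets[THEN eqset_imp_iff]) (auto simp: sets_arc_length sets_norm_arc_length)

lemma cis_measurable_circle: "cis \<in> measurable borel (restrict_space borel unit_circle)"
  by (rule measurable_restrict_space2) (auto intro!: borel_measurable_continuous_onI continuous_intros)

lemma cis_measurable_arc: "cis \<in> measurable borel \<m>"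
  using cis_measurable_circle measurable_cong_sets[OF refl sets_norm_arc_length] by blast

lemma continuous_circle_measurable:
  fixes F :: "complex \<Rightarrow> 'a::topological_space"
  assumes "continuous_on unit_circle F"
  shows "F \<in> measurable \<m> borel"
proof -
  have "F \<in> measurable (restrict_space borel unit_circle) borel"
    by (rule borel_measurable_continuous_on_restrict[OF assms])
  then show ?thesis using measurable_cong_sets[OF sets_norm_arc_length refl] by blast
qed

lemma nn_integral_arc_length_lborel:
  assumes [measurable]: "F \<in> borel_measurable \<m>"
  shows "(\<integral>\<^sup>+\<zeta>. F \<zeta> \<partial>arc_length) = (\<integral>\<^sup>+t. F (cis t) * indicator {0..<2 * pi} t \<partial>lborel)"
proof -
  have F: "F \<in> borel_measurable (restrict_space borel unit_circle)"
    using assms measurable_cong_sets[OF sets_norm_arc_length refl] by blast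
  have c: "cis \<in> measurable (restrict_space lborel {0..<2 * pi}) (restrict_space borel unit_circle)"
    using cis_measurable_circle by (intro measurable_restrict_space1) simp
  show ?thesis unfolding arc_length_def
    using F by (subst nn_integral_distr[OF c]) (auto simp: nn_integral_restrict_space)
qed

lemma nn_integral_norm_arc_length:
  assumes "F \<in> borel_measurable \<m>"
  shows "(\<integral>\<^sup>+\<zeta>. F \<zeta> \<partial>\<m>) = ennreal (1 / (2 * pi)) * (\<integral>\<^sup>+\<zeta>. F \<zeta> \<partial>arc_length)"
  unfolding norm_arc_length_def
  by (rule nn_integral_scale_measure) (use assms in \<open>simp add: measurable_arc_length_iff\<close>)

lemma nn_integral_arc_length:
  assumes "F \<in> borel_measurable \<m>"
  shows "(\<integral>\<^sup>+\<zeta>. F \<zeta> \<partial>arc_length) = ennreal (2 * pi) * (\<integral>\<^sup>+\<zeta>. F \<zeta> \<partial>\<m>)"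
  unfolding nn_integral_norm_arc_length[OF assms] mult.assoc[symmetric]
  by (subst ennreal_mult[symmetric]) auto

lemma arc_length_density: "arc_length = density \<m> (\<lambda>_. ennreal (2 * pi))"
proof (rule measure_eqI)
  fix X assume X: "X \<in> sets arc_length"
  then have X': "X \<in> sets \<m>" by (simp add: sets_arc_length sets_norm_arc_length)
  have "emeasure arc_length X = (\<integral>\<^sup>+\<zeta>. indicator X \<zeta> \<partial>arc_length)" using X by simp
  also have "\<dots> = ennreal (2 * pi) * emeasure \<m> X"
    using X' by (subst nn_integral_arc_length) auto
  finally show "emeasure arc_length X = emeasure (density \<m> (\<lambda>_. ennreal (2 * pi))) X"
    using X' by (simp add: emeasure_density_const)
qed (simp add: sets_arc_length sets_norm_arc_length)

lemma integral_arc_length: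
  fixes F :: "complex \<Rightarrow> complex"
  assumes "F \<in> borel_measurable \<m>"
  shows "(\<integral>\<zeta>. F \<zeta> \<partial>arc_length) = of_real (2 * pi) * (\<integral>\<zeta>. F \<zeta> \<partial>\<m>)"
  unfolding arc_length_density using assms
  by (subst integral_density) (auto simp: scaleR_conv_of_real)

lemma AE_arc_length: "(AE \<zeta> in arc_length. P \<zeta>) \<longleftrightarrow> (AE \<zeta> in \<m>. P \<zeta>)"
  unfolding arc_length_density by (subst AE_density) auto

text \<open>The exceptional set is given by angles, where Lebesgue measure and its covering theorem
  are at hand; \<open>cis\<close> carries it to the circle.\<close>

lemma AE_norm_arc_lengthI:
  assumes "X \<in> sets lborel" "emeasure lborel X = 0" "\<And>t. 0 \<le> t \<Longrightarrow> t < 2 * pi \<Longrightarrow> t \<notin> X \<Longrightarrow> P (cis t)"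
    and P: "{\<zeta> \<in> unit_circle. P \<zeta>} \<in> sets \<m>"
  shows "AE \<zeta> in \<m>. P \<zeta>"
proof -
  let ?B = "unit_circle - {\<zeta> \<in> unit_circle. P \<zeta>}"
  have B: "?B \<in> sets \<m>"
    using sets.Diff[OF sets.top P] by simp
  have "emeasure arc_length ?B = (\<integral>\<^sup>+\<zeta>. indicator ?B \<zeta> \<partial>arc_length)"
    using B by (simp add: sets_arc_length sets_norm_arc_length)
  also have "\<dots> = (\<integral>\<^sup>+t. indicator ?B (cis t) * indicator {0..<2 * pi} t \<partial>lborel)"
    by (rule nn_integral_arc_length_lborel) (use B in measurable)
  also have "\<dots> \<le> (\<integral>\<^sup>+t. indicator X t \<partial>lborel)"
    by (intro nn_integral_mono) (use assms(3) in \<open>auto simp: indicator_def\<close>)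
  also have "\<dots> = 0" using assms by simp
  finally have "emeasure arc_length ?B = 0" by simp
  then have "AE \<zeta> in arc_length. P \<zeta>"
    by (intro AE_I[of _ _ ?B]) (use B in \<open>auto simp: sets_arc_length sets_norm_arc_length\<close>)
  then show ?thesis by (simp add: AE_arc_length)
qed

lemma emeasure_norm_arc_length: "emeasure \<m> unit_circle = 1"
proof -
  have "emeasure \<m> (space \<m>) = (\<integral>\<^sup>+\<zeta>. 1 \<partial>\<m>)" by simp
  also have "\<dots> = ennreal (1 / (2 * pi)) * (\<integral>\<^sup>+t. 1 * indicator {0..<2 * pi} t \<partial>lborel)"
    by (subst nn_integral_norm_arc_length, simp, subst nn_integral_arc_length_lborel, simp_all)
  also have "\<dots> = 1" by (simp add: ennreal_mult[symmetric])
  finally show ?thesis by simp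
qed

interpretation arc: finite_measure \<m>
  by standard (simp add: emeasure_norm_arc_length)

lemma mult_measurable_circle:
  assumes "norm c = 1"
  shows "(\<lambda>\<zeta>. c * \<zeta>) \<in> measurable \<m> \<m>"
proof -
  have "(\<lambda>\<zeta>. c * \<zeta>) \<in> measurable \<m> (restrict_space borel unit_circle)"
    by (rule measurable_restrict_space2)
       (use assms in \<open>auto simp: norm_mult intro!: continuous_circle_measurable continuous_intros\<close>)
  then show ?thesis using measurable_cong_sets[OF refl sets_norm_arc_length] by blast
qed

lemma id_measurable_circle: "(\<lambda>\<zeta>. \<zeta>) \<in> borel_measurable \<m>"
  by (intro continuous_circle_measurable continuous_intros)

lemma mult_measurable_circle_pair:
  "(\<lambda>p. fst p * snd p) \<in> measurable (\<m> \<Otimes>\<^sub>M \<m>) \<m>"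
proof -
  have 1: "fst \<in> borel_measurable (\<m> \<Otimes>\<^sub>M \<m>)"
    by (rule measurable_compose[OF measurable_fst id_measurable_circle])
  have 2: "snd \<in> borel_measurable (\<m> \<Otimes>\<^sub>M \<m>)"
    by (rule measurable_compose[OF measurable_snd id_measurable_circle])
  have "(\<lambda>p. fst p * snd p) \<in> measurable (\<m> \<Otimes>\<^sub>M \<m>) (restrict_space borel unit_circle)"
    by (rule measurable_restrict_space2) (use 1 2 in \<open>auto simp: space_pair_measure norm_mult\<close>)
  then show ?thesis using measurable_cong_sets[OF refl sets_norm_arc_length] by blast
qed

text \<open>In the angle the rotation is a translation by \<open>a\<close>. The translated period is
  cut at 2 pi and the part beyond it is moved back by one period.\<close>

lemma nn_integral_rotate:
  assumes F [measurable]: "F \<in> borel_measurable \<m>" and c: "norm c = 1"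
  shows "(\<integral>\<^sup>+\<zeta>. F (c * \<zeta>) \<partial>\<m>) = (\<integral>\<^sup>+\<zeta>. F \<zeta> \<partial>\<m>)"
proof -
  define a where "a = Arg2pi c"
  have a: "0 \<le> a" "a < 2 * pi" "c = cis a"
    using Arg2pi_ge_0[of c] Arg2pi_lt_2pi[of c] Arg2pi_eq[of c] c by (auto simp: a_def cis_conv_exp)
  define G where "G = (\<lambda>t. F (cis t))"
  have [measurable]: "G \<in> borel_measurable borel"
    unfolding G_def by (rule measurable_compose[OF cis_measurable_arc F])
  have per: "G (t + 2 * pi) = G t" for t by (simp add: G_def cis_mult[symmetric])
  have [measurable]: "(\<lambda>\<zeta>. F (c * \<zeta>)) \<in> borel_measurable \<m>"
    by (rule measurable_compose[OF mult_measurable_circle[OF c] F])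
  have shift: "(\<integral>\<^sup>+t. G (t + b) * indicator S (t + b) \<partial>lborel) = (\<integral>\<^sup>+t. G t * indicator S t \<partial>lborel)"
    if [measurable]: "S \<in> sets borel" for b and S :: "real set"
    using nn_integral_real_affine[of "\<lambda>t. G t * indicator S t" 1 b] by (simp add: add.commute)
  have "(\<integral>\<^sup>+\<zeta>. F (c * \<zeta>) \<partial>arc_length) = (\<integral>\<^sup>+t. G (t + a) * indicator {0..<2 * pi} t \<partial>lborel)"
    unfolding G_def by (subst nn_integral_arc_length_lborel, measurable) (simp add: a cis_mult add.commute)
  also have "\<dots> = (\<integral>\<^sup>+t. G (t + a) * indicator {a..<2 * pi + a} (t + a) \<partial>lborel)"
    by (intro nn_integral_cong) (auto simp: indicator_def)
  also have "\<dots> = (\<integral>\<^sup>+t. G t * indicator {a..<2 * pi + a} t \<partial>lborel)" by (rule shift) simp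
  also have "\<dots> = (\<integral>\<^sup>+t. G t * indicator {a..<2 * pi} t + G t * indicator {2 * pi..<2 * pi + a} t \<partial>lborel)"
    using a by (intro nn_integral_cong) (auto simp: indicator_def)
  also have "\<dots> = (\<integral>\<^sup>+t. G t * indicator {a..<2 * pi} t \<partial>lborel)
      + (\<integral>\<^sup>+t. G t * indicator {2 * pi..<2 * pi + a} t \<partial>lborel)"
    by (rule nn_integral_add) measurable
  also have "(\<integral>\<^sup>+t. G t * indicator {2 * pi..<2 * pi + a} t \<partial>lborel)
      = (\<integral>\<^sup>+t. G (t + 2 * pi) * indicator {2 * pi..<2 * pi + a} (t + 2 * pi) \<partial>lborel)"
    by (rule shift[symmetric]) simp
  also have "\<dots> = (\<integral>\<^sup>+t. G t * indicator {0..<a} t \<partial>lborel)"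
    by (intro nn_integral_cong) (auto simp: indicator_def per)
  also have "(\<integral>\<^sup>+t. G t * indicator {a..<2 * pi} t \<partial>lborel) + (\<integral>\<^sup>+t. G t * indicator {0..<a} t \<partial>lborel)
      = (\<integral>\<^sup>+t. G t * indicator {a..<2 * pi} t + G t * indicator {0..<a} t \<partial>lborel)"
    by (rule nn_integral_add[symmetric]) measurable
  also have "\<dots> = (\<integral>\<^sup>+t. G t * indicator {0..<2 * pi} t \<partial>lborel)"
    using a by (intro nn_integral_cong) (auto simp: indicator_def)
  also have "\<dots> = (\<integral>\<^sup>+\<zeta>. F \<zeta> \<partial>arc_length)"
    unfolding G_def by (rule nn_integral_arc_length_lborel[symmetric]) measurable
  finally show ?thesis by (simp add: nn_integral_norm_arc_length)
qed

lemma distr_rotate: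
  assumes c: "norm c = 1"
  shows "distr \<m> \<m> (\<lambda>\<zeta>. c * \<zeta>) = \<m>"
proof (rule measure_eqI)
  note m = mult_measurable_circle[OF c]
  fix X assume "X \<in> sets (distr \<m> \<m> (\<lambda>\<zeta>. c * \<zeta>))"
  then have X: "X \<in> sets \<m>" by simp
  have "emeasure (distr \<m> \<m> (\<lambda>\<zeta>. c * \<zeta>)) X
      = (\<integral>\<^sup>+\<zeta>. indicator X \<zeta> \<partial>distr \<m> \<m> (\<lambda>\<zeta>. c * \<zeta>))"
    using X by simp
  also have "\<dots> = (\<integral>\<^sup>+\<zeta>. indicator X (c * \<zeta>) \<partial>\<m>)"
    by (rule nn_integral_distr[OF m]) (use X in simp)
  also have "\<dots> = (\<integral>\<^sup>+\<zeta>. indicator X \<zeta> \<partial>\<m>)"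
    by (rule nn_integral_rotate[OF _ c]) (use X in simp)
  finally show "emeasure (distr \<m> \<m> (\<lambda>\<zeta>. c * \<zeta>)) X = emeasure \<m> X"
    using X by simp
qed simp

lemma integral_rotate:
  fixes F :: "complex \<Rightarrow> complex"
  assumes "F \<in> borel_measurable \<m>" "norm c = 1"
  shows "(\<integral>\<zeta>. F (c * \<zeta>) \<partial>\<m>) = (\<integral>\<zeta>. F \<zeta> \<partial>\<m>)"
  using integral_distr[OF mult_measurable_circle[OF assms(2)] assms(1)] distr_rotate[OF assms(2)] by simp

lemma continuous_circle_integrable:
  fixes F :: "complex \<Rightarrow> complex"
  assumes "continuous_on unit_circle F"
  shows "integrable \<m> F"
proof -
  obtain B where "\<And>\<zeta>. \<zeta> \<in> unit_circle \<Longrightarrow> norm (F \<zeta>) \<le> B"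
    using compact_imp_bounded[OF compact_continuous_image[OF assms compact_sphere]]
    unfolding bounded_iff by blast
  then show ?thesis
    by (intro arc.integrable_const_bound[of _ B] continuous_circle_measurable assms AE_I2) auto
qed

section \<open>Orthogonality of the monomials and Parseval's identity\<close>

lemma integral_circle_monomial:
  "(\<integral>\<zeta>. \<zeta> ^ j * cnj (\<zeta> ^ k) \<partial>\<m>) = (if j = k then 1 else 0)"
proof (cases "j = k")
  case True
  have "(\<integral>\<zeta>. \<zeta> ^ j * cnj (\<zeta> ^ k) \<partial>\<m>) = (\<integral>\<zeta>. 1 \<partial>\<m>)"
    by (rule Bochner_Integration.integral_cong)
       (auto simp: True complex_norm_square[symmetric] norm_power simp flip: complex_cnj_power)
  then show ?thesis using True by (simp add: measure_def emeasure_norm_arc_length)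
next
  case False
  define I where "I = (\<integral>\<zeta>. \<zeta> ^ j * cnj (\<zeta> ^ k) \<partial>\<m>)"
  \<comment> \<open>For this angle the rotation multiplies the integrand by cis pi = -1, so by
    invariance the integral equals its own negative.\<close>
  define \<theta> where "\<theta> = pi / (real j - real k)"
  have "cis \<theta> ^ j * cnj (cis \<theta> ^ k) = cis (real j * \<theta> + - (real k * \<theta>))"
    by (simp only: complex_cnj_power cis_cnj Complex.DeMoivre cis_mult mult_minus_right)
  also have "real j * \<theta> + - (real k * \<theta>) = (real j - real k) * \<theta>"
    by (simp add: algebra_simps)
  also have "\<dots> = pi" using False by (simp add: \<theta>_def)
  finally have c: "cis \<theta> ^ j * cnj (cis \<theta> ^ k) = -1" by simp
  have "I = (\<integral>\<zeta>. (cis \<theta> * \<zeta>) ^ j * cnj ((cis \<theta> * \<zeta>) ^ k) \<partial>\<m>)"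
    unfolding I_def
    by (rule integral_rotate[symmetric]) (auto intro!: continuous_circle_measurable continuous_intros)
  also have "\<dots> = (\<integral>\<zeta>. (cis \<theta> ^ j * cnj (cis \<theta> ^ k)) * (\<zeta> ^ j * cnj (\<zeta> ^ k)) \<partial>\<m>)"
    by (intro Bochner_Integration.integral_cong) (auto simp: power_mult_distrib)
  also have "\<dots> = - I"
    unfolding c by (simp add: I_def)
  finally show ?thesis using False by (simp add: I_def)
qed

lemma parseval_finite:
  fixes c d :: "nat \<Rightarrow> complex"
  shows "(\<integral>\<zeta>. (\<Sum>n<N. c n * \<zeta> ^ n) * cnj (\<Sum>n<K. d n * \<zeta> ^ n) \<partial>\<m>)
     = (\<Sum>n<min N K. c n * cnj (d n))"
proof -
  have "(\<integral>\<zeta>. (\<Sum>n<N. c n * \<zeta> ^ n) * cnj (\<Sum>n<K. d n * \<zeta> ^ n) \<partial>\<m>)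
      = (\<integral>\<zeta>. (\<Sum>n<N. \<Sum>k<K. (c n * cnj (d k)) * (\<zeta> ^ n * cnj (\<zeta> ^ k))) \<partial>\<m>)"
    by (simp add: sum_product mult_ac)
  also have "\<dots> = (\<Sum>n<N. \<Sum>k<K. (c n * cnj (d k)) * (\<integral>\<zeta>. (\<zeta> ^ n * cnj (\<zeta> ^ k)) \<partial>\<m>))"
    by (subst Bochner_Integration.integral_sum;
        (intro sum.cong refl)?, (subst Bochner_Integration.integral_sum)?;
        (intro sum.cong refl)?, (subst integral_mult_right)?)
       (auto intro!: continuous_circle_integrable continuous_intros)
  also have "\<dots> = (\<Sum>n<N. if n < K then c n * cnj (d n) else 0)"
    unfolding integral_circle_monomial by (auto intro!: sum.cong simp: if_distrib[of "\<lambda>x. _ * x"] cong: if_cong)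
  also have "\<dots> = (\<Sum>n<min N K. c n * cnj (d n))"
    by (rule sum.mono_neutral_cong_right) auto
  finally show ?thesis .
qed

text \<open>Parseval's identity for partial sums passes to the limit by dominated convergence; the
  product of the two absolute sums is a constant majorant.\<close>

lemma parseval_abs_summable:
  fixes c d :: "nat \<Rightarrow> complex"
  assumes c: "summable (\<lambda>n. norm (c n))" and d: "summable (\<lambda>n. norm (d n))"
    and u: "\<And>\<zeta>. norm \<zeta> = 1 \<Longrightarrow> u \<zeta> = (\<Sum>n. c n * \<zeta> ^ n)" and v: "\<And>\<zeta>. norm \<zeta> = 1 \<Longrightarrow> v \<zeta> = (\<Sum>n. d n * \<zeta> ^ n)"
  shows "(\<lambda>n. c n * cnj (d n)) sums (\<integral>\<zeta>. u \<zeta> * cnj (v \<zeta>) \<partial>\<m>)"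
proof -
  let ?S = "\<lambda>c N \<zeta>. \<Sum>n<N. (c n :: complex) * \<zeta> ^ n"
  have lim: "(\<lambda>N. ?S c N \<zeta>) \<longlonglongrightarrow> (\<Sum>n. c n * \<zeta> ^ n)" if "summable (\<lambda>n. norm (c n))" "norm \<zeta> = 1" for c \<zeta>
    by (rule summable_LIMSEQ, rule summable_norm_cancel) (use that in \<open>simp add: norm_mult norm_power\<close>)
  have bd: "norm (?S c N \<zeta>) \<le> (\<Sum>n. norm (c n))" if "summable (\<lambda>n. norm (c n))" "norm \<zeta> = 1" for c N \<zeta>
  proof -
    have "norm (?S c N \<zeta>) \<le> (\<Sum>n<N. norm (c n))"
      by (rule order_trans[OF norm_sum]) (use that in \<open>simp add: norm_mult norm_power\<close>)
    also have "\<dots> \<le> (\<Sum>n. norm (c n))" by (rule sum_le_suminf) (use that in auto)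
    finally show ?thesis .
  qed
  have pt: "(\<lambda>N. ?S c N \<zeta> * cnj (?S d N \<zeta>)) \<longlonglongrightarrow> u \<zeta> * cnj (v \<zeta>)" if "norm \<zeta> = 1" for \<zeta>
    unfolding u[OF that] v[OF that] by (intro tendsto_intros lim c d that)
  have m: "(\<lambda>\<zeta>. ?S c N \<zeta> * cnj (?S d N \<zeta>)) \<in> borel_measurable \<m>" for N
    by (intro continuous_circle_measurable continuous_intros)
  have "(\<lambda>N. \<integral>\<zeta>. ?S c N \<zeta> * cnj (?S d N \<zeta>) \<partial>\<m>) \<longlonglongrightarrow> (\<integral>\<zeta>. u \<zeta> * cnj (v \<zeta>) \<partial>\<m>)"
  proof (rule integral_dominated_convergence[where w = "\<lambda>_. (\<Sum>n. norm (c n)) * (\<Sum>n. norm (d n))"])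
    show "(\<lambda>\<zeta>. u \<zeta> * cnj (v \<zeta>)) \<in> borel_measurable \<m>"
      by (rule borel_measurable_LIMSEQ_metric[OF m]) (use pt in auto)
    show "AE \<zeta> in \<m>. (\<lambda>N. ?S c N \<zeta> * cnj (?S d N \<zeta>)) \<longlonglongrightarrow> u \<zeta> * cnj (v \<zeta>)"
      using pt by (intro AE_I2) auto
    show "AE \<zeta> in \<m>. norm (?S c N \<zeta> * cnj (?S d N \<zeta>)) \<le> (\<Sum>n. norm (c n)) * (\<Sum>n. norm (d n))" for N
      by (intro AE_I2, subst norm_mult, subst complex_mod_cnj, intro mult_mono bd c d suminf_nonneg) auto
  qed (use m in auto)
  then show ?thesis by (simp only: parseval_finite sums_def min.idem)
qed

lemma nn_integral_norm2_circle:
  assumes c: "summable (\<lambda>n. norm (c n))" and u: "\<And>\<zeta>. norm \<zeta> = 1 \<Longrightarrow> u \<zeta> = (\<Sum>n. c n * \<zeta> ^ n)"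
    and cont: "continuous_on unit_circle u"
  shows "(\<integral>\<^sup>+\<zeta>. ennreal ((norm (u \<zeta>))\<^sup>2) \<partial>\<m>) = (\<Sum>n. ennreal ((norm (c n))\<^sup>2))"
proof -
  have int: "integrable \<m> (\<lambda>\<zeta>. u \<zeta> * cnj (u \<zeta>))"
    by (intro continuous_circle_integrable continuous_intros cont)
  have eq: "u \<zeta> * cnj (u \<zeta>) = of_real ((norm (u \<zeta>))\<^sup>2)" for \<zeta> by (simp only: complex_norm_square)
  have int': "integrable \<m> (\<lambda>\<zeta>. (norm (u \<zeta>))\<^sup>2)"
    using int unfolding eq by (simp only: complex_of_real_integrable_eq)
  have "(\<lambda>n. c n * cnj (c n)) sums (\<integral>\<zeta>. u \<zeta> * cnj (u \<zeta>) \<partial>\<m>)"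
    by (rule parseval_abs_summable[OF c c u u])
  then have "(\<lambda>n. complex_of_real ((norm (c n))\<^sup>2)) sums complex_of_real (\<integral>\<zeta>. (norm (u \<zeta>))\<^sup>2 \<partial>\<m>)"
    unfolding eq integral_complex_of_real complex_norm_square[symmetric] by simp
  then have s: "(\<lambda>n. (norm (c n))\<^sup>2) sums (\<integral>\<zeta>. (norm (u \<zeta>))\<^sup>2 \<partial>\<m>)"
    by (simp only: sums_of_real_iff)
  have "(\<integral>\<^sup>+\<zeta>. ennreal ((norm (u \<zeta>))\<^sup>2) \<partial>\<m>) = ennreal (\<integral>\<zeta>. (norm (u \<zeta>))\<^sup>2 \<partial>\<m>)"
    by (rule nn_integral_eq_integral[OF int']) auto
  also have "\<dots> = ennreal (\<Sum>n. (norm (c n))\<^sup>2)" using sums_unique[OF s] by simp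
  also have "\<dots> = (\<Sum>n. ennreal ((norm (c n))\<^sup>2))"
    by (rule suminf_ennreal2[symmetric]) (use s in \<open>auto simp: sums_iff\<close>)
  finally show ?thesis .
qed

section \<open>Integral means over circles inside the disk\<close>

lemma nn_integral_norm2_dilate:
  assumes g: "g holomorphic_on unit_disk" and r: "0 \<le> r" "r < 1"
  shows "(\<integral>\<^sup>+\<zeta>. ennreal ((norm (g (of_real r * \<zeta>)))\<^sup>2) \<partial>\<m>)
     = (\<Sum>n. ennreal ((norm (taylor_coeff g n * of_real r ^ n))\<^sup>2))"
proof (rule nn_integral_norm2_circle)
  \<comment> \<open>Absolute convergence at radius \<open>r\<close> is read off from convergence at
    a slightly larger radius.\<close>
  obtain \<rho> where \<rho>: "r < \<rho>" "\<rho> < 1" using r dense by blast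
  have "summable (\<lambda>n. taylor_coeff g n * of_real \<rho> ^ n)"
    using taylor_sums[OF g, of "of_real \<rho>"] \<rho> r by (auto simp: sums_iff)
  from powser_insidea[OF this, of "of_real r"]
  show "summable (\<lambda>n. norm (taylor_coeff g n * of_real r ^ n))" using \<rho> r by simp
  show "g (of_real r * \<zeta>) = (\<Sum>n. taylor_coeff g n * of_real r ^ n * \<zeta> ^ n)" if "norm \<zeta> = 1" for \<zeta>
    using taylor_sums[OF g, of "of_real r * \<zeta>"] that r
    by (simp add: sums_iff norm_mult power_mult_distrib mult.assoc)
  have "continuous_on unit_disk g" by (rule holomorphic_on_imp_continuous_on[OF g])
  then show "continuous_on unit_circle (\<lambda>\<zeta>. g (of_real r * \<zeta>))"
    by (rule continuous_on_compose2) (use r in \<open>auto simp: norm_mult intro!: continuous_intros\<close>)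
qed

lemma nn_integral_norm2_dilate_le:
  assumes g: "g \<in> hardy2" and r: "0 \<le> r" "r < 1"
  shows "(\<integral>\<^sup>+\<zeta>. ennreal ((norm (g (of_real r * \<zeta>)))\<^sup>2) \<partial>\<m>) \<le> ennreal (hardy_norm2 g)"
proof -
  have "(\<Sum>n. ennreal ((norm (taylor_coeff g n * of_real r ^ n))\<^sup>2)) \<le> (\<Sum>n. ennreal ((norm (taylor_coeff g n))\<^sup>2))"
    using r by (intro suminf_le)
      (auto simp: norm_mult norm_power power_mult_distrib power_le_one mult_left_le intro!: ennreal_leI)
  also have "\<dots> = ennreal (hardy_norm2 g)"
    unfolding hardy_norm2_def by (rule suminf_ennreal2) (auto intro: hardy2_summable g)
  finally show ?thesis using nn_integral_norm2_dilate[OF hardy2_holo[OF g] r] by simp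
qed

text \<open>For finitely many coefficients one can let r tend to 1, and the bound for the means
  passes to every partial sum. Radii beyond \<open>r0\<close> are singled out because a quotient f /
  \<Phi> can be estimated only near the circle, away from the zeros of \<Phi>.\<close>

lemma hardy2_bounded_means:
  assumes g: "g holomorphic_on unit_disk" and r0: "r0 < 1" and K: "0 \<le> K"
    and le: "\<And>r. r0 < r \<Longrightarrow> 0 \<le> r \<Longrightarrow> r < 1 \<Longrightarrow>
      (\<integral>\<^sup>+\<zeta>. ennreal ((norm (g (of_real r * \<zeta>)))\<^sup>2) \<partial>\<m>) \<le> ennreal K"
  shows "g \<in> hardy2" "hardy_norm2 g \<le> K"
proof -
  have part: "(\<Sum>n<N. (norm (taylor_coeff g n))\<^sup>2) \<le> K" for N
  proof (rule tendsto_upperbound)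
    show "((\<lambda>r. \<Sum>n<N. (norm (taylor_coeff g n * of_real r ^ n))\<^sup>2) \<longlongrightarrow>
          (\<Sum>n<N. (norm (taylor_coeff g n))\<^sup>2)) (at_left (1::real))"
    proof -
      have "((\<lambda>r. \<Sum>n<N. (norm (taylor_coeff g n * of_real r ^ n))\<^sup>2) \<longlongrightarrow>
          (\<Sum>n<N. (norm (taylor_coeff g n * of_real 1 ^ n))\<^sup>2)) (at_left (1::real))"
        by (intro tendsto_intros)
      then show ?thesis by simp
    qed
    have "eventually (\<lambda>r. r \<in> {max 0 r0<..<1}) (at_left (1::real))"
      using r0 by (intro eventually_at_leftI[of "max 0 r0"]) auto
    then show "eventually (\<lambda>r. (\<Sum>n<N. (norm (taylor_coeff g n * of_real r ^ n))\<^sup>2) \<le> K) (at_left (1::real))"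
    proof eventually_elim
      case (elim r)
      then have r: "0 \<le> r" "r < 1" by auto
      have "ennreal (\<Sum>n<N. (norm (taylor_coeff g n * of_real r ^ n))\<^sup>2)
          = (\<Sum>n<N. ennreal ((norm (taylor_coeff g n * of_real r ^ n))\<^sup>2))"
        by (rule sum_ennreal[symmetric]) auto
      also have "\<dots> \<le> (\<Sum>n. ennreal ((norm (taylor_coeff g n * of_real r ^ n))\<^sup>2))"
        by (rule sum_le_suminf) auto
      also have "\<dots> \<le> ennreal K"
        unfolding nn_integral_norm2_dilate[OF g r, symmetric] by (rule le) (use elim in auto)
      finally show ?case using K by (simp add: ennreal_le_iff)
    qed
  qed auto
  have "summable (\<lambda>n. (norm (taylor_coeff g n))\<^sup>2)"
  proof (rule bounded_imp_summable)
    show "(\<Sum>n\<le>N. (norm (taylor_coeff g n))\<^sup>2) \<le> K" for N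
      using part[of "Suc N"] by (simp only: lessThan_Suc_atMost)
  qed simp
  then show "g \<in> hardy2" "hardy_norm2 g \<le> K"
    unfolding hardy2_def hardy_norm2_def using g part by (auto intro!: suminf_le_const)
qed

subsection \<open>A maximal inequality on the circle\<close>

text \<open>By concavity the sine lies above its chord over [0, pi/2].\<close>

lemma sin_ge_linear: "0 \<le> y \<Longrightarrow> y \<le> pi / 2 \<Longrightarrow> 2 * y / pi \<le> sin y"
proof -
  assume y: "0 \<le> y" "y \<le> pi / 2"
  have "concave_on {0..pi/2} sin"
  proof (rule f''_le0_imp_concave)
    show "(sin has_real_derivative cos x) (at x)" "(cos has_real_derivative - sin x) (at x)" for x
      by (auto intro!: derivative_eq_intros)
  qed (auto intro!: sin_ge_zero)
  from concave_onD[OF this, of "2 * y / pi" 0 "pi / 2"] y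
  show ?thesis by (auto simp: field_simps)
qed

lemma norm_cis_minus_one_ge: "\<bar>x\<bar> \<le> pi \<Longrightarrow> 2 * \<bar>x\<bar> / pi \<le> norm (cis x - 1)"
proof -
  assume x: "\<bar>x\<bar> \<le> pi"
  have "(norm (cis x - 1))\<^sup>2 = (cos x - 1)\<^sup>2 + (sin x)\<^sup>2" by (simp add: cmod_power2)
  also have "\<dots> = 2 - 2 * cos x" using sin_cos_squared_add[of x] by (simp add: power2_eq_square algebra_simps)
  also have "\<dots> = (2 * sin (\<bar>x\<bar> / 2))\<^sup>2"
    using cos_double_sin[of "\<bar>x\<bar> / 2"] by (simp add: power_mult_distrib)
  finally have "norm (cis x - 1) = \<bar>2 * sin (\<bar>x\<bar> / 2)\<bar>"
    using power2_eq_iff_nonneg[of "norm (cis x - 1)" "\<bar>2 * sin (\<bar>x\<bar> / 2)\<bar>"] by simp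
  with sin_ge_linear[of "\<bar>x\<bar> / 2"] x show ?thesis by simp
qed

text \<open>The distance to \<open>a\<close> is at least \<open>d\<close> and, as \<open>a\<close>
  has distance \<open>d\<close> from 1, at least half the distance to 1. Halving 2|x| / pi leaves
  |x| / pi. The two values of \<open>a\<close> are the poles of the kernel on either side of the
  circle.\<close>

lemma norm_cis_minus_ge:
  assumes "\<bar>x\<bar> \<le> pi" "0 < d" "d \<le> 1" "a = 1 - d \<or> a = 1 + d"
  shows "max d (\<bar>x\<bar> / pi) \<le> norm (cis x - of_real a)"
proof -
  have "\<bar>norm (cis x) - norm (complex_of_real a)\<bar> \<le> norm (cis x - of_real a)"
    by (rule norm_triangle_ineq3)
  then have 1: "d \<le> norm (cis x - of_real a)" using assms by auto
  have "norm (cis x - 1) \<le> norm (cis x - of_real a) + norm (of_real a - 1 :: complex)"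
    using norm_triangle_ineq[of "cis x - of_real a" "of_real a - 1"] by simp
  also have "norm (of_real a - 1 :: complex) = d"
    using assms by (metis abs_minus_cancel abs_of_pos add_diff_cancel_left' diff_diff_eq2 minus_diff_eq norm_of_real of_real_1 of_real_diff)
  finally have "norm (cis x - 1) \<le> 2 * norm (cis x - of_real a)" using 1 by linarith
  with norm_cis_minus_one_ge[OF assms(1)] 1 show ?thesis by simp
qed

text \<open>For the least j with y <= 2^j d the single term j already dominates: if j > 0, then y
  exceeds 2^(j-1) d. Such a j exists and is at most \<open>J\<close>, because level \<open>J\<close>
  reaches 1.\<close>

lemma dyadic_kernel_bound:
  fixes d y :: real
  assumes d: "0 < d" and J: "1 \<le> 2 ^ J * d" and y: "0 \<le> y" "y \<le> 1"
  shows "1 / (max d y)\<^sup>2 \<le> (\<Sum>j\<le>J. if y \<le> 2 ^ j * d then 4 / (4 ^ j * d\<^sup>2) else 0)"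
proof -
  have ex: "y \<le> 2 ^ J * d" using y J by linarith
  define j where "j = (LEAST j. y \<le> 2 ^ j * d)"
  have j: "y \<le> 2 ^ j * d" unfolding j_def by (rule LeastI[of _ J]) fact
  have jJ: "j \<le> J" unfolding j_def by (rule Least_le) fact
  have "1 / (max d y)\<^sup>2 \<le> 4 / (4 ^ j * d\<^sup>2)"
  proof (cases j)
    case 0
    have "1 / (max d y)\<^sup>2 \<le> 1 / d\<^sup>2" using d by (intro divide_left_mono power_mono) auto
    also have "\<dots> \<le> 4 / d\<^sup>2" using d by (intro divide_right_mono) auto
    finally show ?thesis using 0 by simp
  next
    case (Suc i)
    then have "\<not> y \<le> 2 ^ i * d" using not_less_Least[of i "\<lambda>j. y \<le> 2 ^ j * d"] by (simp add: j_def)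
    then have "2 ^ i * d \<le> max d y" by simp
    then have "(2 ^ i * d)\<^sup>2 \<le> (max d y)\<^sup>2" using d by (intro power_mono) auto
    then have "1 / (max d y)\<^sup>2 \<le> 1 / (2 ^ i * d)\<^sup>2" using d by (intro divide_left_mono) auto
    also have "\<dots> = 4 / (4 ^ j * d\<^sup>2)"
      using Suc d by (simp add: power_mult_distrib power_mult[symmetric] mult.commute[of i] power_mult)
    finally show ?thesis .
  qed
  also have "\<dots> \<le> (\<Sum>j\<le>J. if y \<le> 2 ^ j * d then 4 / (4 ^ j * d\<^sup>2) else 0)"
    using member_le_sum[of j "{..J}" "\<lambda>j. if y \<le> 2 ^ j * d then 4 / (4 ^ j * d\<^sup>2) else 0"] j jJ d by simp
  finally show ?thesis .
qed

text \<open>Cauchy's formula at \<open>(1 - d) cis t\<close>, minus the vanishing Cauchy integral at \<open>(1 + d) cis t\<close>: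
  the difference of the two Cauchy kernels decays like the Poisson kernel.\<close>

lemma holomorphic_le_kernel_integral:
  fixes f :: "complex \<Rightarrow> complex"
  assumes f: "f holomorphic_on ball 0 R" "R > 1" and d: "0 < d" "d \<le> 1"
  shows "2 * pi * norm (f (of_real (1 - d) * cis t))
     \<le> integral {0..2 * pi} (\<lambda>s. norm (f (cis (t + s - pi))) * (2 * d / (max d (\<bar>s - pi\<bar> / pi))\<^sup>2))"
proof -
  \<comment> \<open>The rotation by \<open>\<pi>\<close> puts the peak of the kernel into the middle of \<open>{0..2 * pi}\<close>.\<close>
  define F where "F = (\<lambda>u. f (- cis t * u))"
  have F: "F holomorphic_on ball 0 R"
    unfolding F_def by (rule holomorphic_on_compose_gen[unfolded o_def, OF _ f(1)])
      (auto intro!: holomorphic_intros simp: norm_mult)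
  define a b :: complex where "a = - of_real (1 - d)" and "b = - of_real (1 + d)"
  have na: "norm a = 1 - d" and nb: "norm b = 1 + d"
    using d unfolding a_def b_def norm_minus_cancel norm_of_real by auto
  have 1: "((\<lambda>u. F u / (u - a)) has_contour_integral (2 * of_real pi * \<i> * F a)) (circlepath 0 1)"
  proof (rule Cauchy_integral_circlepath_simple)
    show "F holomorphic_on cball 0 1" by (rule holomorphic_on_subset[OF F]) (use f in auto)
    show "norm (a - 0) < 1" using na d by simp
  qed
  have 2: "((\<lambda>u. F u / (u - b)) has_contour_integral 0) (circlepath 0 1)"
  proof (rule Cauchy_theorem_convex_simple)
    show "(\<lambda>u. F u / (u - b)) holomorphic_on ball 0 (min R (1 + d))"
      using nb by (intro holomorphic_intros holomorphic_on_subset[OF F]) auto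
  qed (use f d in auto)
  have "((\<lambda>u. F u / (u - a) - F u / (u - b)) has_contour_integral (2 * of_real pi * \<i> * F a - 0)) (circlepath 0 1)"
    by (rule has_contour_integral_diff[OF 1 2])
  then have hi: "((\<lambda>s. (F (cis s) / (cis s - a) - F (cis s) / (cis s - b)) * \<i> * cis s) has_integral (2 * pi * \<i> * F a)) {0..2 * pi}"
    unfolding circlepath_def by (subst (asm) has_contour_integral_part_circlepath_iff) (auto simp: mult_ac)
  define g where "g = (\<lambda>s. norm (f (cis (t + s - pi))) * (2 * d / (max d (\<bar>s - pi\<bar> / pi))\<^sup>2))"
  have cf: "continuous_on (ball 0 R) f" by (rule holomorphic_on_imp_continuous_on[OF f(1)])
  have "continuous_on {0..2 * pi} g"
    unfolding g_def
    by (intro continuous_intros continuous_on_compose2[OF cf]) (use d f in \<open>auto simp: max_def\<close>)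
  then have g: "g integrable_on {0..2 * pi}" by (rule integrable_continuous_real)
  have bd: "norm ((F (cis s) / (cis s - a) - F (cis s) / (cis s - b)) * \<i> * cis s) \<le> g s"
    if s: "s \<in> {0..2 * pi}" for s
  proof -
    have c: "cis s = - cis (s - pi)" by (simp add: cis_def complex_eq_iff)
    let ?M = "max d (\<bar>s - pi\<bar> / pi)"
    have M: "?M > 0" using d by simp
    have ab: "?M \<le> norm (cis s - a)" "?M \<le> norm (cis s - b)"
    proof -
      have "\<bar>s - pi\<bar> \<le> pi" using s by auto
      from norm_cis_minus_ge[OF this d, of "1 - d"] norm_cis_minus_ge[OF this d, of "1 + d"]
      have "?M \<le> norm (- (cis (s - pi) - of_real (1 - d)))" "?M \<le> norm (- (cis (s - pi) - of_real (1 + d)))"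
        unfolding norm_minus_cancel by auto
      moreover have "cis s - a = - (cis (s - pi) - of_real (1 - d))" "cis s - b = - (cis (s - pi) - of_real (1 + d))"
        unfolding c a_def b_def by simp_all
      ultimately show "?M \<le> norm (cis s - a)" "?M \<le> norm (cis s - b)" by simp_all
    qed
    then have nz: "cis s - a \<noteq> 0" "cis s - b \<noteq> 0" using M by auto
    have FF: "F (cis s) = f (cis (t + s - pi))"
      unfolding F_def c by (simp add: cis_mult algebra_simps)
    have "(F (cis s) / (cis s - a) - F (cis s) / (cis s - b)) = F (cis s) * (a - b) / ((cis s - a) * (cis s - b))"
      using nz by (simp add: divide_simps) (simp add: algebra_simps)
    also have "a - b = of_real (2 * d)" by (simp add: a_def b_def)
    finally have "norm ((F (cis s) / (cis s - a) - F (cis s) / (cis s - b)) * \<i> * cis s)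
       = norm (f (cis (t + s - pi))) * (2 * d / (norm (cis s - a) * norm (cis s - b)))"
      using d by (simp add: FF norm_mult norm_divide)
    also have "\<dots> \<le> g s"
      unfolding g_def power2_eq_square using ab M d nz
      by (intro mult_left_mono divide_left_mono mult_mono) auto
    finally show ?thesis .
  qed
  have "norm (2 * pi * \<i> * F a) \<le> integral {0..2 * pi} g"
    using integral_norm_bound_integral[OF has_integral_integrable[OF hi] g bd] integral_unique[OF hi] by simp
  moreover have "F a = f (of_real (1 - d) * cis t)"
  proof -
    have "- cis t * a = of_real (1 - d) * cis t" by (simp add: a_def algebra_simps)
    then show ?thesis unfolding F_def by (rule arg_cong)
  qed
  ultimately show ?thesis by (simp add: g_def norm_mult)
qed

text \<open>The kernel is dominated by multiples of indicators of dyadic intervals around t, so the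
  bound on averages applies level by level. Level j contributes at most 16 pi l / 2^j; the sum is at
  most 32 pi l, and division by 2 pi gives 16 l.\<close>

lemma holomorphic_le_maximal:
  fixes f :: "complex \<Rightarrow> complex"
  assumes f: "f holomorphic_on ball 0 R" "R > 1" and d: "0 < d" "d \<le> 1"
    and H: "\<And>h. 0 < h \<Longrightarrow> h \<le> pi \<Longrightarrow> integral {t - h..t + h} (\<lambda>s. norm (f (cis s))) \<le> 2 * h * l"
  shows "norm (f (of_real (1 - d) * cis t)) \<le> 16 * l"
proof -
  have cf: "continuous_on (ball 0 R) f" by (rule holomorphic_on_imp_continuous_on[OF f(1)])
  have cg: "continuous_on S (\<lambda>s. norm (f (cis s)))" for S
    by (intro continuous_intros continuous_on_compose2[OF cf]) (use f in auto)
  have cg': "continuous_on S (\<lambda>s. norm (f (cis (t + s - pi))))" for S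
    by (intro continuous_intros continuous_on_compose2[OF cf]) (use f in auto)
  have l: "0 \<le> l"
  proof -
    have "0 \<le> integral {t - pi..t + pi} (\<lambda>s. norm (f (cis s)))"
      by (intro integral_nonneg integrable_continuous_real cg) auto
    also have "\<dots> \<le> 2 * pi * l" using H[of pi] by simp
    finally show ?thesis using pi_gt_zero by (simp add: zero_le_mult_iff not_le)
  qed
  obtain J where J: "1 / d \<le> 2 ^ J"
    using real_arch_pow[of 2 "1 / d"] by (auto intro: less_imp_le)
  then have J: "1 \<le> 2 ^ J * d" using d by (simp add: divide_le_eq)
  let ?G = "\<lambda>s. norm (f (cis (t + s - pi)))"
  \<comment> \<open>Half-length of the interval of level j, capped at \<open>pi\<close> because
    \<open>H\<close> controls averages over at most one full period.\<close>
  let ?h = "\<lambda>j::nat. min pi (pi * (2 ^ j * d))"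
  let ?T = "\<lambda>j s. if s \<in> {pi - ?h j..pi + ?h j} then ?G s * (8 / (4 ^ j * d)) else 0"
  have sub: "{pi - ?h j..pi + ?h j} \<inter> {0..2 * pi} = {pi - ?h j..pi + ?h j}" for j using d by auto
  have intT: "?T j integrable_on {0..2 * pi}" for j
    unfolding integrable_restrict_Int sub
    by (intro integrable_continuous_real continuous_intros cg')
  have valT: "integral {0..2 * pi} (?T j) \<le> 16 * pi * l * (1 / 2) ^ j" for j
  proof -
    have hp: "0 < ?h j" "?h j \<le> pi" using d by auto
    have "integral {0..2 * pi} (?T j) = integral {pi - ?h j..pi + ?h j} (\<lambda>s. ?G s * (8 / (4 ^ j * d)))"
      unfolding integral_restrict_Int sub by simp
    also have "\<dots> = integral {pi - ?h j..pi + ?h j} ?G * (8 / (4 ^ j * d))"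
      by (rule integral_mult_left)
    also have "integral {pi - ?h j..pi + ?h j} ?G = integral {t - ?h j..t + ?h j} (\<lambda>s. norm (f (cis s)))"
      using integral_shift_real_ivl[of "t - ?h j" "t - pi" "t + ?h j" "\<lambda>s. norm (f (cis s))"]
      by (simp add: algebra_simps)
    also have "integral {t - ?h j..t + ?h j} (\<lambda>s. norm (f (cis s))) * (8 / (4 ^ j * d)) \<le> (2 * ?h j * l) * (8 / (4 ^ j * d))"
      using d by (intro mult_right_mono H hp) auto
    also have "\<dots> \<le> (2 * (pi * (2 ^ j * d)) * l) * (8 / (4 ^ j * d))"
      using d l by (intro mult_right_mono mult_left_mono) auto
    also have "\<dots> = 16 * pi * l * (1 / 2) ^ j"
    proof -
      have "(4::real) ^ j = 2 ^ j * 2 ^ j" by (simp flip: power_mult_distrib)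
      then show ?thesis using d by (simp add: field_simps)
    qed
    finally show ?thesis .
  qed
  have "2 * pi * norm (f (of_real (1 - d) * cis t))
     \<le> integral {0..2 * pi} (\<lambda>s. ?G s * (2 * d / (max d (\<bar>s - pi\<bar> / pi))\<^sup>2))"
    by (rule holomorphic_le_kernel_integral[OF f d])
  also have "\<dots> \<le> integral {0..2 * pi} (\<lambda>s. \<Sum>j\<le>J. ?T j s)"
  proof (rule integral_le)
    show "(\<lambda>s. ?G s * (2 * d / (max d (\<bar>s - pi\<bar> / pi))\<^sup>2)) integrable_on {0..2 * pi}"
      by (intro integrable_continuous_real continuous_intros cg') (use d in \<open>auto simp: max_def\<close>)
    show "(\<lambda>s. \<Sum>j\<le>J. ?T j s) integrable_on {0..2 * pi}" by (intro integrable_sum intT) auto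
    fix s assume s: "s \<in> {0..2 * pi}"
    let ?y = "\<bar>s - pi\<bar> / pi"
    have y: "0 \<le> ?y" "?y \<le> 1" using s by (auto simp: divide_le_eq)
    have mem: "s \<in> {pi - ?h j..pi + ?h j} \<longleftrightarrow> ?y \<le> 2 ^ j * d" for j
    proof -
      have "s \<in> {pi - ?h j..pi + ?h j} \<longleftrightarrow> \<bar>s - pi\<bar> \<le> ?h j" by (auto simp: abs_le_iff)
      also have "\<dots> \<longleftrightarrow> \<bar>s - pi\<bar> \<le> pi * (2 ^ j * d)" using s by auto
      also have "\<dots> \<longleftrightarrow> ?y \<le> 2 ^ j * d" by (simp add: divide_le_eq mult.commute)
      finally show ?thesis .
    qed
    have "2 * d / (max d ?y)\<^sup>2 = 2 * d * (1 / (max d ?y)\<^sup>2)" by simp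
    also have "\<dots> \<le> 2 * d * (\<Sum>j\<le>J. if ?y \<le> 2 ^ j * d then 4 / (4 ^ j * d\<^sup>2) else 0)"
      using d by (intro mult_left_mono dyadic_kernel_bound J y) auto
    also have "\<dots> = (\<Sum>j\<le>J. if ?y \<le> 2 ^ j * d then 8 / (4 ^ j * d) else 0)"
      unfolding sum_distrib_left using d by (intro sum.cong) (auto simp: power2_eq_square)
    finally have "?G s * (2 * d / (max d ?y)\<^sup>2) \<le> ?G s * (\<Sum>j\<le>J. if ?y \<le> 2 ^ j * d then 8 / (4 ^ j * d) else 0)"
      by (intro mult_left_mono) auto
    also have "\<dots> = (\<Sum>j\<le>J. ?T j s)"
      unfolding sum_distrib_left mem by (intro sum.cong) auto
    finally show "?G s * (2 * d / (max d ?y)\<^sup>2) \<le> (\<Sum>j\<le>J. ?T j s)" .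
  qed
  also have "\<dots> = (\<Sum>j\<le>J. integral {0..2 * pi} (?T j))"
    by (intro integral_sum intT) auto
  also have "\<dots> \<le> (\<Sum>j\<le>J. 16 * pi * l * (1 / 2) ^ j)" by (intro sum_mono valT)
  also have "\<dots> = 16 * pi * l * (\<Sum>j\<le>J. (1 / 2) ^ j)" by (simp add: sum_distrib_left)
  also have "\<dots> \<le> 16 * pi * l * 2"
  proof (intro mult_left_mono)
    have "(\<Sum>j\<le>J. (1 / 2 :: real) ^ j) \<le> (\<Sum>j. (1 / 2) ^ j)"
      by (rule sum_le_suminf) auto
    also have "\<dots> = 2" by (subst suminf_geometric) auto
    finally show "(\<Sum>j\<le>J. (1 / 2 :: real) ^ j) \<le> 2" .
  qed (use l in auto)
  finally show ?thesis by simp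
qed

lemma nn_integral_Icc_eq_integral:
  fixes g :: "real \<Rightarrow> real"
  assumes "continuous_on {a..b} g" "\<And>x. g x \<ge> 0"
  shows "(\<integral>\<^sup>+x. ennreal (g x) * indicator {a..b} x \<partial>lborel) = ennreal (integral {a..b} g)"
proof -
  have s: "set_integrable lborel {a..b} g"
    unfolding set_integrable_def by (rule borel_integrable_compact) (use assms in auto)
  have "(\<integral>\<^sup>+x. ennreal (g x) * indicator {a..b} x \<partial>lborel) = (\<integral>\<^sup>+x. ennreal (indicator {a..b} x *\<^sub>R g x) \<partial>lborel)"
    by (intro nn_integral_cong) (auto simp: indicator_def)
  also have "\<dots> = ennreal (set_lebesgue_integral lborel {a..b} g)"
    unfolding set_lebesgue_integral_def
    by (rule nn_integral_eq_integral) (use s assms in \<open>auto simp: set_integrable_def\<close>)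
  also have "set_lebesgue_integral lborel {a..b} g = integral {a..b} g"
    by (rule set_borel_integral_eq_integral[OF s])
  finally show ?thesis .
qed

text \<open>Vitali's covering argument: disjoint intervals of half-length h, each carrying more than
  2 h l of the integral, whose fivefold enlargements cover \<open>E\<close>. The constant is 10 = 5
  * 2, because the intervals are centred in one period with h <= pi and therefore stay within two
  periods.\<close>

lemma hardy_littlewood_weak_type:
  fixes g :: "real \<Rightarrow> real"
  assumes g: "continuous_on UNIV g" "\<And>x. g x \<ge> 0" and per: "\<And>x. g (x + 2 * pi) = g x" and l: "l > 0"
    and E: "\<And>t. t \<in> E \<Longrightarrow> 0 \<le> t \<and> t < 2 * pi \<and> (\<exists>h. 0 < h \<and> h \<le> pi \<and> 2 * h * l < integral {t - h..t + h} g)"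
  obtains B where "B \<in> sets lborel" "E \<subseteq> B" "emeasure lborel B \<le> ennreal (10 / l) * ennreal (integral {0..2 * pi} g)"
proof -
  obtain h where h: "\<And>t. t \<in> E \<Longrightarrow> 0 < h t \<and> h t \<le> pi \<and> 2 * h t * l < integral {t - h t..t + h t} g"
    using E by metis
  obtain C where C: "countable C" "C \<subseteq> E"
     "pairwise (\<lambda>i j. disjnt (cball i (h i)) (cball j (h j))) C"
     "E \<subseteq> (\<Union>i\<in>C. cball i (5 * h i))"
    by (rule Vitali_covering_lemma_cballs[where K = E and a = "\<lambda>t. t" and r = h and B = pi and S = E])
       (use h in \<open>force intro: less_imp_le\<close>)+
  define \<nu> where "\<nu> = density lborel (\<lambda>x. ennreal (g x))"
  have gm [measurable]: "g \<in> borel_measurable borel" by (rule borel_measurable_continuous_onI[OF g(1)])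
  have \<nu>_Icc: "emeasure \<nu> {a..b} = ennreal (integral {a..b} g)" for a b
    unfolding \<nu>_def using nn_integral_Icc_eq_integral[of a b g] g
    by (subst emeasure_density) (auto intro: continuous_on_subset)
  have sets_\<nu> [simp]: "sets \<nu> = sets borel" by (simp add: \<nu>_def)
  \<comment> \<open>A numbering of the countable family. Each \<open>X n\<close> and
    \<open>Y n\<close> is a single interval or empty, so finite and infinite families are treated
    alike.\<close>
  define e where "e = to_nat_on C"
  have inj: "inj_on e C" unfolding e_def by (rule inj_on_to_nat_on[OF C(1)])
  define X where "X n = (\<Union>i\<in>{i \<in> C. e i = n}. cball i (5 * h i))" for n
  define Y where "Y n = (\<Union>i\<in>{i \<in> C. e i = n}. cball i (h i))" for n
  have cases: "{i \<in> C. e i = n} = {} \<or> (\<exists>i\<in>C. {i \<in> C. e i = n} = {i})" for n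
    using inj unfolding inj_on_def by blast
  have XY: "X n \<in> sets borel \<and> Y n \<in> sets borel \<and> emeasure lborel (X n) \<le> ennreal (5 / l) * emeasure \<nu> (Y n)" for n
    using cases[of n]
  proof (elim disjE bexE)
    assume "{i \<in> C. e i = n} = {}"
    then have "X n = {}" "Y n = {}" unfolding X_def Y_def by auto
    then show ?thesis by simp
  next
    fix i assume i: "i \<in> C" "{i \<in> C. e i = n} = {i}"
    have hi: "0 < h i" "2 * h i * l < integral {i - h i..i + h i} g" using h C(2) i by auto
    have "emeasure lborel (X n) = ennreal (10 * h i)"
      using hi by (simp add: X_def i(2) cball_eq_atLeastAtMost)
    also have "\<dots> \<le> ennreal (5 / l * integral {i - h i..i + h i} g)"
      using hi l by (intro ennreal_leI) (auto simp: field_simps)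
    also have "\<dots> = ennreal (5 / l) * emeasure \<nu> (Y n)"
    proof -
      have "0 \<le> integral {i - h i..i + h i} g"
        using hi l by (meson less_imp_le less_trans mult_pos_pos zero_less_numeral)
      then show ?thesis
        using l by (simp add: Y_def i(2) cball_eq_atLeastAtMost \<nu>_Icc ennreal_mult[symmetric])
    qed
    finally show ?thesis by (simp add: X_def Y_def i(2))
  qed
  have disj: "disjoint_family Y"
    unfolding disjoint_family_on_def
  proof (intro ballI impI)
    fix m n :: nat assume mn: "m \<noteq> n"
    show "Y m \<inter> Y n = {}"
    proof (rule ccontr)
      assume "Y m \<inter> Y n \<noteq> {}"
      then obtain x i j where ij: "i \<in> C" "e i = m" "j \<in> C" "e j = n" "x \<in> cball i (h i)" "x \<in> cball j (h j)"
        unfolding Y_def by blast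
      then have "disjnt (cball i (h i)) (cball j (h j))" using mn by (intro pairwiseD[OF C(3)]) auto
      then show False using ij unfolding disjnt_def by blast
    qed
  qed
  have Ysub: "(\<Union>n. Y n) \<subseteq> {- pi..3 * pi}"
  proof
    fix x assume "x \<in> (\<Union>n. Y n)"
    then obtain i where i: "i \<in> C" "x \<in> cball i (h i)" unfolding Y_def by blast
    then have "0 \<le> i" "i < 2 * pi" "h i \<le> pi" using E h C(2) by (auto dest!: subsetD)
    with i show "x \<in> {- pi..3 * pi}" by (auto simp: cball_eq_atLeastAtMost)
  qed
  have B: "(\<Union>n. X n) \<in> sets lborel" using XY by auto
  have "emeasure lborel (\<Union>n. X n) \<le> (\<Sum>n. emeasure lborel (X n))"
    by (rule emeasure_subadditive_countably) (use XY in auto)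
  also have "\<dots> \<le> (\<Sum>n. ennreal (5 / l) * emeasure \<nu> (Y n))" by (intro suminf_le) (use XY in auto)
  also have "\<dots> = ennreal (5 / l) * emeasure \<nu> (\<Union>n. Y n)"
    using disj XY by (subst ennreal_suminf_cmult, subst suminf_emeasure) auto
  also have "\<dots> \<le> ennreal (5 / l) * emeasure \<nu> {- pi..3 * pi}"
    by (intro mult_left_mono emeasure_mono Ysub) auto
  also have "emeasure \<nu> {- pi..3 * pi} = ennreal (2 * integral {0..2 * pi} g)"
  proof -
    have i: "g integrable_on {a..b}" for a b
      by (intro integrable_continuous_real continuous_on_subset[OF g(1)]) auto
    have s: "integral {a + 2 * pi..b + 2 * pi} g = integral {a..b} g" for a b
      using integral_shift_real_ivl[of "a + 2 * pi" "2 * pi" "b + 2 * pi" g] per by simp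
    have "integral {- pi..3 * pi} g = integral {- pi..pi} g + integral {pi..3 * pi} g"
      by (rule Henstock_Kurzweil_Integration.integral_combine[symmetric]) (use i in auto)
    also have "integral {pi..3 * pi} g = integral {- pi..pi} g" using s[of "-pi" pi] by simp
    also have "integral {- pi..pi} g = integral {- pi..0} g + integral {0..pi} g"
      by (rule Henstock_Kurzweil_Integration.integral_combine[symmetric]) (use i in auto)
    also have "integral {- pi..0} g = integral {pi..2 * pi} g" using s[of "-pi" 0] by simp
    also have "integral {pi..2 * pi} g + integral {0..pi} g = integral {0..2 * pi} g"
      by (subst add.commute, rule Henstock_Kurzweil_Integration.integral_combine) (use i in auto)
    finally show ?thesis by (simp add: \<nu>_Icc)
  qed
  also have "ennreal (5 / l) * ennreal (2 * integral {0..2 * pi} g) = ennreal (10 / l) * ennreal (integral {0..2 * pi} g)"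
  proof -
    have "0 \<le> integral {0..2 * pi} g"
      by (intro integral_nonneg integrable_continuous_real continuous_on_subset[OF g(1)] g) auto
    then show ?thesis using l by (simp flip: ennreal_mult)
  qed
  finally have "emeasure lborel (\<Union>n. X n) \<le> ennreal (10 / l) * ennreal (integral {0..2 * pi} g)" .
  moreover have "E \<subseteq> (\<Union>n. X n)" using C(4) unfolding X_def by blast
  ultimately show thesis using that B by blast
qed

subsection \<open>Radial limits of Hardy space functions\<close>

lemma boundary_value_eqI:
  "((\<lambda>r. f (of_real r * \<zeta>)) \<longlongrightarrow> L) (at_left (1::real)) \<Longrightarrow> boundary_value f \<zeta> = L"
  unfolding boundary_value_def by (rule tendsto_Lim) auto

lemma tendsto_dilate_at_left:
  fixes h :: "complex \<Rightarrow> complex"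
  assumes "continuous_on (cball 0 1) h" "norm \<zeta> = 1"
  shows "((\<lambda>r. h (of_real r * \<zeta>)) \<longlongrightarrow> h \<zeta>) (at_left (1::real))"
proof -
  have "continuous_on {0..1::real} (\<lambda>r. h (of_real r * \<zeta>))"
    by (intro continuous_on_compose2[OF assms(1)] continuous_intros) (use assms in \<open>auto simp: norm_mult\<close>)
  then have "((\<lambda>r. h (of_real r * \<zeta>)) \<longlongrightarrow> h (of_real 1 * \<zeta>)) (at 1 within {0..1})"
    unfolding continuous_on_def by (rule bspec) simp
  moreover have "at_left (1::real) = at 1 within {0..1}"
    by (subst at_within_Icc_at_left) auto
  ultimately show ?thesis by simp
qed

lemma boundary_value_continuous:
  "continuous_on (cball 0 1) h \<Longrightarrow> norm \<zeta> = 1 \<Longrightarrow> boundary_value h \<zeta> = h \<zeta>"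
  by (intro boundary_value_eqI tendsto_dilate_at_left)

text \<open>The tolerances range over countably many values and the comparison is not strict. This
  form is made for measurability: the set of points with a radial limit becomes a countable
  combination of closed sets.\<close>

lemma tendsto_at_left_one_iff_Cauchy:
  fixes u :: "real \<Rightarrow> complex"
  shows "(\<exists>L. (u \<longlongrightarrow> L) (at_left 1)) \<longleftrightarrow>
     (\<forall>n::nat. \<exists>k::nat. \<forall>r s. 1 - 1 / real (k + 1) < r \<longrightarrow> r < 1 \<longrightarrow> 1 - 1 / real (k + 1) < s \<longrightarrow> s < 1 \<longrightarrow>
        dist (u r) (u s) \<le> 1 / real (n + 1))"
proof (intro iffI allI)
  fix n :: nat assume "\<exists>L. (u \<longlongrightarrow> L) (at_left 1)"
  then obtain L where L: "(u \<longlongrightarrow> L) (at_left 1)" by blast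
  have "eventually (\<lambda>r. dist (u r) L < 1 / real (2 * (n + 1))) (at_left 1)"
    by (rule tendstoD[OF L]) simp
  then obtain b where b: "b < 1" "\<And>r. b < r \<Longrightarrow> r < 1 \<Longrightarrow> dist (u r) L < 1 / real (2 * (n + 1))"
    by (auto simp: eventually_at_left_field)
  obtain k :: nat where "1 / real (Suc k) < 1 - b"
    using nat_approx_posE[of "1 - b"] b by auto
  then have k: "b < 1 - 1 / real (k + 1)" by simp
  show "\<exists>k::nat. \<forall>r s. 1 - 1 / real (k + 1) < r \<longrightarrow> r < 1 \<longrightarrow> 1 - 1 / real (k + 1) < s \<longrightarrow> s < 1 \<longrightarrow>
        dist (u r) (u s) \<le> 1 / real (n + 1)"
  proof (intro exI[of _ k] allI impI)
    fix r s assume "1 - 1 / real (k + 1) < r" "r < 1" "1 - 1 / real (k + 1) < s" "s < 1"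
    then have "dist (u r) L < 1 / real (2 * (n + 1))" "dist (u s) L < 1 / real (2 * (n + 1))"
      using less_trans[OF k] by (blast intro: b(2))+
    then have "dist (u r) (u s) < 1 / real (2 * (n + 1)) + 1 / real (2 * (n + 1))"
      using dist_triangle2[of "u r" "u s" L] by linarith
    also have "\<dots> = 1 / real (n + 1)" by (simp add: field_simps)
    finally show "dist (u r) (u s) \<le> 1 / real (n + 1)" by simp
  qed
next
  assume *: "\<forall>n::nat. \<exists>k::nat. \<forall>r s. 1 - 1 / real (k + 1) < r \<longrightarrow> r < 1 \<longrightarrow> 1 - 1 / real (k + 1) < s \<longrightarrow> s < 1 \<longrightarrow>
        dist (u r) (u s) \<le> 1 / real (n + 1)"
  have close: "\<exists>k. \<forall>r s. 1 - 1 / real (k + 1) < r \<longrightarrow> r < 1 \<longrightarrow> 1 - 1 / real (k + 1) < s \<longrightarrow> s < 1 \<longrightarrow>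
        dist (u r) (u s) < e" if "e > 0" for e
  proof -
    obtain n :: nat where n: "1 / real (Suc n) < e" using nat_approx_posE[OF \<open>e > 0\<close>] by blast
    obtain k :: nat where "\<forall>r s. 1 - 1 / real (k + 1) < r \<longrightarrow> r < 1 \<longrightarrow> 1 - 1 / real (k + 1) < s \<longrightarrow> s < 1 \<longrightarrow>
        dist (u r) (u s) \<le> 1 / real (n + 1)"
      using *[rule_format, of n] by blast
    then show ?thesis using n unfolding Suc_eq_plus1 by (blast intro: le_less_trans)
  qed
  \<comment> \<open>The shift by 2 puts \<open>q j\<close> strictly inside the k-th window as soon
    as j >= k.\<close>
  define q where "q = (\<lambda>j::nat. 1 - 1 / real (j + 2))"
  have q: "q j < 1" "j \<ge> k \<Longrightarrow> 1 - 1 / real (k + 1) < q j" for j k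
    by (auto simp: q_def field_simps)
  have "Cauchy (\<lambda>j. u (q j))"
  proof (rule metric_CauchyI)
    fix e :: real assume "e > 0"
    from close[OF this] obtain k where k: "\<And>r s. 1 - 1 / real (k + 1) < r \<Longrightarrow> r < 1 \<Longrightarrow> 1 - 1 / real (k + 1) < s \<Longrightarrow> s < 1 \<Longrightarrow>
        dist (u r) (u s) < e" by blast
    show "\<exists>M. \<forall>m\<ge>M. \<forall>n\<ge>M. dist (u (q m)) (u (q n)) < e"
      by (intro exI[of _ k] allI impI k q)
  qed
  then obtain L where L: "(\<lambda>j. u (q j)) \<longlonglongrightarrow> L" using Cauchy_convergent_iff convergent_def by blast
  have "(u \<longlongrightarrow> L) (at_left 1)"
  proof (rule tendstoI)
    fix e :: real assume e: "e > 0"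
    from close[of "e / 2"] e obtain k where k: "\<And>r s. 1 - 1 / real (k + 1) < r \<Longrightarrow> r < 1 \<Longrightarrow> 1 - 1 / real (k + 1) < s \<Longrightarrow> s < 1 \<Longrightarrow>
        dist (u r) (u s) < e / 2" by auto
    have "eventually (\<lambda>j. dist (u (q j)) L < e / 2) sequentially" by (rule tendstoD[OF L]) (use e in simp)
    then have "eventually (\<lambda>j. dist (u (q j)) L < e / 2 \<and> j \<ge> k) sequentially"
      using eventually_ge_at_top[of k] by eventually_elim auto
    then obtain j where j: "dist (u (q j)) L < e / 2" "j \<ge> k"
      by (auto simp: eventually_sequentially)
    have "dist (u r) L < e" if "1 - 1 / real (k + 1) < r" "r < 1" for r
      using k[OF that q(2)[OF j(2)] q(1)] j(1) dist_triangle[of "u r" L "u (q j)"] by linarith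
    then show "eventually (\<lambda>r. dist (u r) L < e) (at_left 1)"
      by (intro eventually_at_leftI[of "1 - 1 / real (k + 1)"]) auto
  qed
  then show "\<exists>L. (u \<longlongrightarrow> L) (at_left 1)" ..
qed

section \<open>Measurability of the radial limit\<close>

abbreviation has_radial_limit :: "(complex \<Rightarrow> complex) \<Rightarrow> complex \<Rightarrow> bool" where
  "has_radial_limit f \<zeta> \<equiv> ((\<lambda>r. f (of_real r * \<zeta>)) \<longlongrightarrow> boundary_value f \<zeta>) (at_left (1::real))"

lemma has_radial_limit_iff: "has_radial_limit f \<zeta> \<longleftrightarrow> (\<exists>L. ((\<lambda>r. f (of_real r * \<zeta>)) \<longlongrightarrow> L) (at_left (1::real)))"
  using boundary_value_eqI by blast

lemma sets_norm_arc_length_iff: "X \<in> sets \<m> \<longleftrightarrow> X \<subseteq> unit_circle \<and> X \<in> sets borel"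
  unfolding sets_norm_arc_length by (subst sets_restrict_space_iff) auto

lemma continuous_dilate:
  assumes "continuous_on unit_disk f" "0 \<le> r" "r < 1"
  shows "continuous_on unit_circle (\<lambda>\<zeta>. f (of_real r * \<zeta>))"
  by (rule continuous_on_compose2[OF assms(1)]) (use assms in \<open>auto simp: norm_mult intro!: continuous_intros\<close>)

text \<open>For fixed n and k the Cauchy condition is an intersection of closed sets over
  uncountably many radii, hence closed. The quantifiers over n and k are countable.\<close>

lemma has_radial_limit_sets:
  assumes f: "continuous_on unit_disk f"
  shows "{\<zeta> \<in> unit_circle. has_radial_limit f \<zeta>} \<in> sets \<m>"
proof -
  define C where "C n k = (\<Inter>r\<in>{1 - 1 / real (k + 1)<..<1}. \<Inter>s\<in>{1 - 1 / real (k + 1)<..<1}.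
      {\<zeta> \<in> unit_circle. dist (f (of_real r * \<zeta>)) (f (of_real s * \<zeta>)) \<le> 1 / real (n + 1)})" for n k :: nat
  have "closed (C n k)" for n k
    unfolding C_def
  proof (intro closed_INT ballI continuous_on_closed_Collect_le continuous_intros continuous_dilate f)
    have k: "1 / real (k + 1) \<le> 1" by simp
    show "0 \<le> r" if "r \<in> {1 - 1 / real (k + 1)<..<1}" for r
      using that k unfolding greaterThanLessThan_iff by linarith
    then show "0 \<le> s" if "s \<in> {1 - 1 / real (k + 1)<..<1}" for s
      using that .
  qed auto
  then have "(\<Inter>n. \<Union>k. C n k) \<in> sets borel" by (intro sets.countable_INT'' sets.countable_UN'') auto
  moreover have "{\<zeta> \<in> unit_circle. has_radial_limit f \<zeta>} = (\<Inter>n. \<Union>k. C n k)"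
  proof -
    have ne: "{1 - 1 / real (k + 1)<..<1} \<noteq> {}" for k by (simp add: not_le)
    have mem: "\<zeta> \<in> C n k \<longleftrightarrow> \<zeta> \<in> unit_circle \<and> (\<forall>r s. 1 - 1 / real (k + 1) < r \<longrightarrow> r < 1 \<longrightarrow> 1 - 1 / real (k + 1) < s \<longrightarrow> s < 1 \<longrightarrow>
        dist (f (of_real r * \<zeta>)) (f (of_real s * \<zeta>)) \<le> 1 / real (n + 1))" for \<zeta> n k
    proof
      assume z: "\<zeta> \<in> C n k"
      obtain r where "r \<in> {1 - 1 / real (k + 1)<..<1}" using ne[of k] by blast
      then have "\<zeta> \<in> unit_circle" using z unfolding C_def by blast
      then show "\<zeta> \<in> unit_circle \<and> (\<forall>r s. 1 - 1 / real (k + 1) < r \<longrightarrow> r < 1 \<longrightarrow> 1 - 1 / real (k + 1) < s \<longrightarrow> s < 1 \<longrightarrow>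
        dist (f (of_real r * \<zeta>)) (f (of_real s * \<zeta>)) \<le> 1 / real (n + 1))"
        using z unfolding C_def by (auto simp del: of_nat_Suc of_nat_add)
    next
      assume "\<zeta> \<in> unit_circle \<and> (\<forall>r s. 1 - 1 / real (k + 1) < r \<longrightarrow> r < 1 \<longrightarrow> 1 - 1 / real (k + 1) < s \<longrightarrow> s < 1 \<longrightarrow>
        dist (f (of_real r * \<zeta>)) (f (of_real s * \<zeta>)) \<le> 1 / real (n + 1))"
      then show "\<zeta> \<in> C n k" unfolding C_def by (auto simp del: of_nat_Suc of_nat_add)
    qed
    show ?thesis
      unfolding has_radial_limit_iff tendsto_at_left_one_iff_Cauchy by (auto simp: mem simp del: of_nat_Suc of_nat_add)
  qed
  ultimately show ?thesis by (auto simp: sets_norm_arc_length_iff)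
qed

lemma radii_at_left_one: "filterlim (\<lambda>j. 1 - 1 / real (j + 2)) (at_left (1::real)) sequentially"
proof (rule filterlim_at_withinI)
  have "(\<lambda>j. 1 - inverse (real (Suc (j + 1)))) \<longlonglongrightarrow> 1 - 0"
    by (intro tendsto_diff tendsto_const LIMSEQ_ignore_initial_segment[OF LIMSEQ_inverse_real_of_nat])
  then show "(\<lambda>j. 1 - 1 / real (j + 2)) \<longlonglongrightarrow> 1" by (simp add: inverse_eq_divide add.commute)
qed (auto simp: field_simps)

lemma boundary_value_measurable:
  assumes f: "continuous_on unit_disk f"
  shows "boundary_value f \<in> borel_measurable \<m>"
proof -
  define q where "q = (\<lambda>j::nat. 1 - 1 / real (j + 2))"
  have q: "0 \<le> q j" "q j < 1" for j by (auto simp: q_def field_simps)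
  have ql: "filterlim q (at_left 1) sequentially" unfolding q_def by (rule radii_at_left_one)
  \<comment> \<open>the value of \<open>Lim\<close> where there is no limit\<close>
  define c where "c = (THE l::complex. False)"
  let ?P = "has_radial_limit f"
  define u where "u j \<zeta> = (if ?P \<zeta> then f (of_real (q j) * \<zeta>) else c)" for j \<zeta>
  have "u j \<in> borel_measurable \<m>" for j
    unfolding u_def
  proof (rule measurable_If)
    show "{\<zeta> \<in> space \<m>. ?P \<zeta>} \<in> sets \<m>"
      unfolding space_norm_arc_length by (rule has_radial_limit_sets[OF f])
    show "(\<lambda>\<zeta>. f (of_real (q j) * \<zeta>)) \<in> borel_measurable \<m>"
      by (intro continuous_circle_measurable continuous_dilate f q)
  qed simp
  moreover have "(\<lambda>j. u j \<zeta>) \<longlonglongrightarrow> boundary_value f \<zeta>" for \<zeta>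
  proof (cases "?P \<zeta>")
    case True
    then show ?thesis unfolding u_def using filterlim_compose[OF True ql] by simp
  next
    case False
    then have "((\<lambda>r. f (of_real r * \<zeta>)) \<longlongrightarrow> L) (at_left (1::real)) = False" for L
      using has_radial_limit_iff by blast
    then have "boundary_value f \<zeta> = c"
      unfolding boundary_value_def t2_space_class.Lim_def c_def by simp
    then show ?thesis using False by (simp add: u_def)
  qed
  ultimately show ?thesis by (rule borel_measurable_LIMSEQ_metric)
qed

lemma hardy2_continuous: "f \<in> hardy2 \<Longrightarrow> continuous_on unit_disk f"
  by (intro holomorphic_on_imp_continuous_on hardy2_holo)

lemma hardy2_boundary_measurable: "f \<in> hardy2 \<Longrightarrow> boundary_value f \<in> borel_measurable \<m>"
  by (intro boundary_value_measurable hardy2_continuous)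

text \<open>The dilate z -> g (\<rho> z) is holomorphic past the closed disk, so the pointwise
  maximal bound applies to it. From s <= \<eta>/2 + s^2 / (2 \<eta>) its mean modulus is at most
  \<eta>. The constant is 160 / l from the covering argument at level l / 16, times 2 pi
  \<eta>.\<close>

lemma hardy2_weak_type_dilate:
  assumes g: "g \<in> hardy2" and \<eta>: "hardy_norm2 g \<le> \<eta>\<^sup>2" "\<eta> > 0" and l: "l > 0" and \<rho>: "0 < \<rho>" "\<rho> < 1"
  obtains B where "B \<in> sets lborel"
    "{t. 0 \<le> t \<and> t < 2 * pi \<and> (\<exists>r. 0 \<le> r \<and> r < \<rho> \<and> l < norm (g (of_real r * cis t)))} \<subseteq> B"
    "emeasure lborel B \<le> ennreal (320 * pi * \<eta> / l)"
proof -
  define f where "f = (\<lambda>z. g (of_real \<rho> * z))"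
  have R: "1 / \<rho> > 1" using \<rho> by simp
  have f: "f holomorphic_on ball 0 (1 / \<rho>)"
    unfolding f_def by (rule holomorphic_on_compose_gen[unfolded o_def, OF _ hardy2_holo[OF g]])
      (use \<rho> in \<open>auto intro!: holomorphic_intros simp: norm_mult field_simps\<close>)
  have cf: "continuous_on (ball 0 (1 / \<rho>)) f" by (rule holomorphic_on_imp_continuous_on[OF f])
  have cg: "continuous_on S (\<lambda>s. norm (f (cis s)))" for S
    by (intro continuous_intros continuous_on_compose2[OF cf]) (use \<rho> in \<open>auto simp: field_simps\<close>)
  let ?g = "\<lambda>s. norm (f (cis s))"
  let ?E = "{t. 0 \<le> t \<and> t < 2 * pi \<and> (\<exists>h. 0 < h \<and> h \<le> pi \<and> 2 * h * (l / 16) < integral {t - h..t + h} ?g)}"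
  obtain B where B: "B \<in> sets lborel" "?E \<subseteq> B" "emeasure lborel B \<le> ennreal (10 / (l / 16)) * ennreal (integral {0..2 * pi} ?g)"
  proof (rule hardy_littlewood_weak_type[of ?g "l / 16" ?E])
    show "?g (x + 2 * pi) = ?g x" for x by (simp add: cis_mult[symmetric])
  qed (use l cg in auto)
  have fm: "(\<lambda>\<zeta>. f \<zeta>) \<in> borel_measurable \<m>"
    by (intro continuous_circle_measurable continuous_on_subset[OF cf]) (use \<rho> in \<open>auto simp: field_simps\<close>)
  note [measurable] = fm
  have "ennreal (integral {0..2 * pi} ?g) = (\<integral>\<^sup>+x. ennreal (?g x) * indicator {0..2 * pi} x \<partial>lborel)"
    by (rule nn_integral_Icc_eq_integral[symmetric]) (use cg in auto)
  also have "\<dots> = (\<integral>\<^sup>+x. ennreal (?g x) * indicator {0..<2 * pi} x \<partial>lborel)"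
    by (rule nn_integral_cong_AE) (use AE_lborel_singleton[of "2 * pi"] in \<open>eventually_elim, auto simp: indicator_def\<close>)
  also have "\<dots> = (\<integral>\<^sup>+\<zeta>. ennreal (norm (f \<zeta>)) \<partial>arc_length)"
    by (rule nn_integral_arc_length_lborel[symmetric]) measurable
  also have "\<dots> = ennreal (2 * pi) * (\<integral>\<^sup>+\<zeta>. ennreal (norm (f \<zeta>)) \<partial>\<m>)"
    by (rule nn_integral_arc_length) measurable
  also have "(\<integral>\<^sup>+\<zeta>. ennreal (norm (f \<zeta>)) \<partial>\<m>)
      \<le> (\<integral>\<^sup>+\<zeta>. ennreal (\<eta> / 2) + ennreal (1 / (2 * \<eta>)) * ennreal ((norm (f \<zeta>))\<^sup>2) \<partial>\<m>)"
  proof (intro nn_integral_mono)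
    fix \<zeta>
    have "norm (f \<zeta>) \<le> \<eta> / 2 + 1 / (2 * \<eta>) * (norm (f \<zeta>))\<^sup>2"
      using sum_squares_bound[of \<eta> "norm (f \<zeta>)"] \<eta> by (simp add: field_simps power2_eq_square)
    then show "ennreal (norm (f \<zeta>)) \<le> ennreal (\<eta> / 2) + ennreal (1 / (2 * \<eta>)) * ennreal ((norm (f \<zeta>))\<^sup>2)"
      using \<eta> by (simp add: ennreal_mult[symmetric] ennreal_plus[symmetric] del: ennreal_plus)
  qed
  also have "\<dots> = ennreal (\<eta> / 2) + ennreal (1 / (2 * \<eta>)) * (\<integral>\<^sup>+\<zeta>. ennreal ((norm (f \<zeta>))\<^sup>2) \<partial>\<m>)"
    by (subst nn_integral_add) (auto simp: nn_integral_cmult emeasure_norm_arc_length)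
  also have "\<dots> \<le> ennreal (\<eta> / 2) + ennreal (1 / (2 * \<eta>)) * ennreal (\<eta>\<^sup>2)"
  proof (intro add_left_mono mult_left_mono)
    have "(\<integral>\<^sup>+\<zeta>. ennreal ((norm (f \<zeta>))\<^sup>2) \<partial>\<m>) \<le> ennreal (hardy_norm2 g)"
      unfolding f_def by (rule nn_integral_norm2_dilate_le[OF g]) (use \<rho> in auto)
    also have "\<dots> \<le> ennreal (\<eta>\<^sup>2)" by (rule ennreal_leI[OF \<eta>(1)])
    finally show "(\<integral>\<^sup>+\<zeta>. ennreal ((norm (f \<zeta>))\<^sup>2) \<partial>\<m>) \<le> ennreal (\<eta>\<^sup>2)" .
  qed auto
  also have "\<dots> = ennreal \<eta>"
    using \<eta> by (simp add: ennreal_mult[symmetric] ennreal_plus[symmetric] power2_eq_square del: ennreal_plus)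
  finally have I: "ennreal (integral {0..2 * pi} ?g) \<le> ennreal (2 * pi) * ennreal \<eta>"
    by (simp add: mult_left_mono)
  have "emeasure lborel B \<le> ennreal (10 / (l / 16)) * (ennreal (2 * pi) * ennreal \<eta>)"
    by (rule order_trans[OF B(3)]) (intro mult_left_mono I, auto)
  also have "\<dots> = ennreal (320 * pi * \<eta> / l)"
    using \<eta> l by (simp add: ennreal_mult[symmetric])
  finally have eB: "emeasure lborel B \<le> ennreal (320 * pi * \<eta> / l)" .
  have "{t. 0 \<le> t \<and> t < 2 * pi \<and> (\<exists>r. 0 \<le> r \<and> r < \<rho> \<and> l < norm (g (of_real r * cis t)))} \<subseteq> ?E"
  proof (clarify, rule ccontr)
    fix t r assume t: "0 \<le> t" "t < 2 * pi" "0 \<le> r" "r < \<rho>" "l < norm (g (of_real r * cis t))"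
      and "\<not> (\<exists>h. 0 < h \<and> h \<le> pi \<and> 2 * h * (l / 16) < integral {t - h..t + h} ?g)"
    then have H: "integral {t - h..t + h} ?g \<le> 2 * h * (l / 16)" if "0 < h" "h \<le> pi" for h
      using that by (meson not_le)
    \<comment> \<open>The radius r of \<open>g\<close> corresponds to r / \<rho> for the dilate,
      that is, to d = 1 - r / \<rho>.\<close>
    have "norm (f (of_real (1 - (1 - r / \<rho>)) * cis t)) \<le> 16 * (l / 16)"
      by (rule holomorphic_le_maximal[OF f R _ _ H]) (use t \<rho> in \<open>auto simp: field_simps\<close>)
    then have "norm (g (of_real r * cis t)) \<le> l" using \<rho> by (simp add: f_def)
    then show False using t by simp
  qed
  then show thesis using that[OF B(1) _ eB] B(2) by blast
qed

text \<open>The bound for radii below \<rho> does not depend on \<rho>, so continuity of the measure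
  along \<rho> k -> 1 gives it for all radii. The sets are intersections of an interval with open
  sets, hence measurable.\<close>

lemma hardy2_weak_type:
  assumes g: "g \<in> hardy2" and \<eta>: "hardy_norm2 g \<le> \<eta>\<^sup>2" "\<eta> > 0" and l: "l > 0"
  defines "B \<equiv> {t. 0 \<le> t \<and> t < 2 * pi \<and> (\<exists>r. 0 \<le> r \<and> r < 1 \<and> l < norm (g (of_real r * cis t)))}"
  shows "B \<in> sets lborel" "emeasure lborel B \<le> ennreal (320 * pi * \<eta> / l)"
proof -
  define \<rho> where "\<rho> = (\<lambda>k::nat. 1 - 1 / real (k + 2))"
  have \<rho>: "0 < \<rho> k" "\<rho> k < 1" for k by (auto simp: \<rho>_def field_simps)
  define A where "A k = {t. 0 \<le> t \<and> t < 2 * pi \<and> (\<exists>r. 0 \<le> r \<and> r < \<rho> k \<and> l < norm (g (of_real r * cis t)))}" for k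
  have Am: "A k \<in> sets lborel" for k
  proof -
    have "open (\<Union>r\<in>{0..<\<rho> k}. {t. l < norm (g (of_real r * cis t))})"
    proof (intro open_UN ballI open_Collect_less continuous_intros)
      fix r assume r: "r \<in> {0..<\<rho> k}"
      show "continuous_on UNIV (\<lambda>t. g (of_real r * cis t))"
        by (intro continuous_on_compose2[OF hardy2_continuous[OF g]] continuous_intros)
           (use r \<rho>[of k] in \<open>auto simp: norm_mult\<close>)
    qed
    moreover have "A k = {0..<2 * pi} \<inter> (\<Union>r\<in>{0..<\<rho> k}. {t. l < norm (g (of_real r * cis t))})"
      unfolding A_def by auto
    ultimately show ?thesis by simp
  qed
  have inc: "incseq A"
  proof (rule incseq_SucI)
    fix k
    have "\<rho> k \<le> \<rho> (Suc k)" by (simp add: \<rho>_def field_simps)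
    then show "A k \<le> A (Suc k)" unfolding A_def by force
  qed
  have U: "B = (\<Union>k. A k)"
  proof
    show "(\<Union>k. A k) \<subseteq> B" unfolding A_def B_def using \<rho>(2) by (auto intro: less_trans)
    show "B \<subseteq> (\<Union>k. A k)"
    proof
      fix t assume "t \<in> B"
      then obtain r where t: "0 \<le> t" "t < 2 * pi" "0 \<le> r" "r < 1" "l < norm (g (of_real r * cis t))"
        unfolding B_def by blast
      obtain k :: nat where k: "1 / real (Suc k) < 1 - r" using nat_approx_posE[of "1 - r"] t by auto
      have "1 / real (k + 2) \<le> 1 / real (Suc k)" by (intro divide_left_mono) auto
      with k have "r < \<rho> k" unfolding \<rho>_def by linarith
      then show "t \<in> (\<Union>k. A k)" using t unfolding A_def by blast
    qed
  qed
  show "B \<in> sets lborel" unfolding U using Am by blast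
  have le: "emeasure lborel (A k) \<le> ennreal (320 * pi * \<eta> / l)" for k
  proof -
    obtain B' where B': "B' \<in> sets lborel" "A k \<subseteq> B'" "emeasure lborel B' \<le> ennreal (320 * pi * \<eta> / l)"
      unfolding A_def using hardy2_weak_type_dilate[OF g \<eta> l \<rho>[of k]] by blast
    then show ?thesis using emeasure_mono[OF B'(2,1)] by (meson order_trans)
  qed
  have "emeasure lborel B = (SUP k. emeasure lborel (A k))"
    unfolding U using Am by (intro SUP_emeasure_incseq[symmetric] inc) auto
  also have "\<dots> \<le> ennreal (320 * pi * \<eta> / l)" by (intro SUP_least le)
  finally show "emeasure lborel B \<le> ennreal (320 * pi * \<eta> / l)" .
qed

text \<open>Polynomials have radial limits everywhere, and the Taylor remainders have small Hardy
  norm. By the weak type bound the radial maximal function of a remainder is small off a set of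
  small measure, which controls the oscillation of f along a radius.\<close>

theorem fatou_radial_limits:
  assumes f: "f \<in> hardy2"
  shows "AE \<zeta> in \<m>. has_radial_limit f \<zeta>"
proof -
  define h where "h N = (\<lambda>z. f z - taylor_poly f N z)" for N
  have h: "h N \<in> hardy2" for N unfolding h_def by (rule hardy_norm2_remainder[OF f])
  \<comment> \<open>The summand 1 / Suc N keeps the bound positive even if the remainder is
    0.\<close>
  define \<eta> where "\<eta> N = sqrt (hardy_norm2 (h N)) + 1 / real (Suc N)" for N
  have \<eta>: "hardy_norm2 (h N) \<le> (\<eta> N)\<^sup>2" "\<eta> N > 0" for N
  proof -
    have nn: "0 \<le> hardy_norm2 (h N)" by (rule hardy_norm2_nonneg[OF h])
    have "hardy_norm2 (h N) = (sqrt (hardy_norm2 (h N)))\<^sup>2" using nn by simp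
    also have "\<dots> \<le> (\<eta> N)\<^sup>2" unfolding \<eta>_def using nn by (intro power_mono) auto
    finally show "hardy_norm2 (h N) \<le> (\<eta> N)\<^sup>2" .
    show "\<eta> N > 0" unfolding \<eta>_def using nn by (intro add_nonneg_pos) auto
  qed
  have \<eta>0: "\<eta> \<longlonglongrightarrow> 0"
  proof -
    have "(\<lambda>N. sqrt (hardy_norm2 (h N)) + 1 / real (Suc N)) \<longlonglongrightarrow> sqrt 0 + 0"
      using hardy_norm2_remainder_tendsto[OF f] LIMSEQ_inverse_real_of_nat
      unfolding h_def by (intro tendsto_add tendsto_real_sqrt) (auto simp: inverse_eq_divide)
    then show ?thesis by (simp add: \<eta>_def[abs_def])
  qed
  define B where "B N l = {t. 0 \<le> t \<and> t < 2 * pi \<and> (\<exists>r. 0 \<le> r \<and> r < 1 \<and> l < norm (h N (of_real r * cis t)))}" for N and l :: real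
  have B: "B N l \<in> sets lborel" "emeasure lborel (B N l) \<le> ennreal (320 * pi * \<eta> N / l)" if "l > 0" for N l
    unfolding B_def using hardy2_weak_type[OF h \<eta> that] by auto
  \<comment> \<open>A third of 1 / (n + 1): the oscillation splits into two values of a remainder
    and one difference of polynomial values. For the latter the Cauchy criterion is used with index
    3 n + 2, whose tolerance is again this third.\<close>
  define l where "l n = 1 / (3 * real (n + 1))" for n
  have l: "l n > 0" for n by (simp add: l_def)
  define X where "X = (\<Union>n. \<Inter>N. B N (l n))"
  have Xn: "(\<Inter>N. B N (l n)) \<in> null_sets lborel" for n
  proof (rule null_setsI)
    show "(\<Inter>N. B N (l n)) \<in> sets lborel" using B(1)[OF l] by blast
    have "emeasure lborel (\<Inter>N. B N (l n)) \<le> ennreal (320 * pi * \<eta> N / l n)" for N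
      by (rule order_trans[OF emeasure_mono B(2)[OF l]]) (use B(1)[OF l] in auto)
    moreover have "(\<lambda>N. ennreal (320 * pi * \<eta> N / l n)) \<longlonglongrightarrow> ennreal (320 * pi * 0 / l n)"
      by (intro tendsto_intros \<eta>0) (use l[of n] in auto)
    ultimately have "emeasure lborel (\<Inter>N. B N (l n)) \<le> ennreal (320 * pi * 0 / l n)"
      by (intro LIMSEQ_le_const) auto
    then show "emeasure lborel (\<Inter>N. B N (l n)) = 0" by simp
  qed
  have X: "X \<in> null_sets lborel" unfolding X_def by (intro null_sets_UN Xn)
  show ?thesis
  proof (rule AE_norm_arc_lengthI)
    show "X \<in> sets lborel" "emeasure lborel X = 0" using X by auto
    show "{\<zeta> \<in> unit_circle. has_radial_limit f \<zeta>} \<in> sets \<m>"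
      by (rule has_radial_limit_sets[OF hardy2_continuous[OF f]])
    fix t assume t: "0 \<le> t" "t < 2 * pi" "t \<notin> X"
    show "has_radial_limit f (cis t)"
      unfolding has_radial_limit_iff tendsto_at_left_one_iff_Cauchy
    proof
      fix n :: nat
      from t obtain N where N: "t \<notin> B N (l n)" unfolding X_def by blast
      have hb: "norm (h N (of_real r * cis t)) \<le> l n" if "0 \<le> r" "r < 1" for r
        using N t that unfolding B_def by (auto simp: not_less)
      have "((\<lambda>r. taylor_poly f N (of_real r * cis t)) \<longlongrightarrow> taylor_poly f N (cis t)) (at_left (1::real))"
        by (intro tendsto_dilate_at_left holomorphic_on_imp_continuous_on taylor_poly_holo) auto
      then have "\<exists>L. ((\<lambda>r. taylor_poly f N (of_real r * cis t)) \<longlongrightarrow> L) (at_left (1::real))" ..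
      then obtain k :: nat where k: "\<And>r s. 1 - 1 / real (k + 1) < r \<Longrightarrow> r < 1 \<Longrightarrow> 1 - 1 / real (k + 1) < s \<Longrightarrow> s < 1 \<Longrightarrow>
        dist (taylor_poly f N (of_real r * cis t)) (taylor_poly f N (of_real s * cis t)) \<le> 1 / real ((3 * n + 2) + 1)"
        unfolding tendsto_at_left_one_iff_Cauchy by blast
      show "\<exists>k::nat. \<forall>r s. 1 - 1 / real (k + 1) < r \<longrightarrow> r < 1 \<longrightarrow> 1 - 1 / real (k + 1) < s \<longrightarrow> s < 1 \<longrightarrow>
        dist (f (of_real r * cis t)) (f (of_real s * cis t)) \<le> 1 / real (n + 1)"
      proof (intro exI[of _ k] allI impI)
        fix r s assume rs: "1 - 1 / real (k + 1) < r" "r < 1" "1 - 1 / real (k + 1) < s" "s < 1"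
        have "1 / real (k + 1) \<le> 1" by simp
        with rs have pos: "0 \<le> r" "0 \<le> s" by linarith+
        have "f (of_real r * cis t) - f (of_real s * cis t) = (h N (of_real r * cis t) - h N (of_real s * cis t))
             + (taylor_poly f N (of_real r * cis t) - taylor_poly f N (of_real s * cis t))"
          by (simp add: h_def)
        also have "norm \<dots> \<le> (norm (h N (of_real r * cis t)) + norm (h N (of_real s * cis t)))
             + norm (taylor_poly f N (of_real r * cis t) - taylor_poly f N (of_real s * cis t))"
          by (intro norm_triangle_mono norm_triangle_ineq4 order_refl)
        also have "\<dots> \<le> (l n + l n) + 1 / real ((3 * n + 2) + 1)"
          by (intro add_mono hb) (use rs pos k[OF rs] in \<open>auto simp: dist_norm\<close>)
        also have "\<dots> = 1 / real (n + 1)" by (simp add: l_def field_simps)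
        finally show "dist (f (of_real r * cis t)) (f (of_real s * cis t)) \<le> 1 / real (n + 1)"
          by (simp add: dist_norm)
      qed
    qed
  qed
qed

subsection \<open>Boundary values and Douglas' formula\<close>

lemma fst_measurable_circle_pair [measurable]: "fst \<in> borel_measurable (\<m> \<Otimes>\<^sub>M \<m>)"
  by (rule measurable_compose[OF measurable_fst id_measurable_circle])

lemma snd_measurable_circle_pair [measurable]: "snd \<in> borel_measurable (\<m> \<Otimes>\<^sub>M \<m>)"
  by (rule measurable_compose[OF measurable_snd id_measurable_circle])

text \<open>Fatou's lemma along a sequence of radii tending to 1; the means over the inner circles
  never exceed the Hardy norm.\<close>

lemma nn_integral_boundary_value_le:
  assumes f: "f \<in> hardy2"
  shows "(\<integral>\<^sup>+\<zeta>. ennreal ((norm (boundary_value f \<zeta>))\<^sup>2) \<partial>\<m>) \<le> ennreal (hardy_norm2 f)"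
proof -
  define q where "q = (\<lambda>j::nat. 1 - 1 / real (j + 2))"
  have q: "0 \<le> q j" "q j < 1" for j by (auto simp: q_def field_simps)
  have ql: "filterlim q (at_left 1) sequentially" unfolding q_def by (rule radii_at_left_one)
  let ?u = "\<lambda>j \<zeta>. ennreal ((norm (f (of_real (q j) * \<zeta>)))\<^sup>2)"
  have um: "?u j \<in> borel_measurable \<m>" for j
    using continuous_circle_measurable[OF continuous_dilate[OF hardy2_continuous[OF f] q]] by measurable
  have "(\<integral>\<^sup>+\<zeta>. ennreal ((norm (boundary_value f \<zeta>))\<^sup>2) \<partial>\<m>)
      = (\<integral>\<^sup>+\<zeta>. liminf (\<lambda>j. ?u j \<zeta>) \<partial>\<m>)"
  proof (rule nn_integral_cong_AE)
    show "AE \<zeta> in \<m>. ennreal ((norm (boundary_value f \<zeta>))\<^sup>2) = liminf (\<lambda>j. ?u j \<zeta>)"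
      using fatou_radial_limits[OF f]
    proof eventually_elim
      case (elim \<zeta>)
      have "(\<lambda>j. ?u j \<zeta>) \<longlonglongrightarrow> ennreal ((norm (boundary_value f \<zeta>))\<^sup>2)"
        by (intro tendsto_ennrealI tendsto_power tendsto_norm filterlim_compose[OF elim ql])
      then show ?case by (intro lim_imp_Liminf[symmetric]) auto
    qed
  qed
  also have "\<dots> \<le> liminf (\<lambda>j. \<integral>\<^sup>+\<zeta>. ?u j \<zeta> \<partial>\<m>)"
    by (rule nn_integral_liminf[OF um])
  also have "\<dots> \<le> ennreal (hardy_norm2 f)"
    by (rule order_trans[OF Liminf_mono[where g = "\<lambda>_. ennreal (hardy_norm2 f)"]])
       (use nn_integral_norm2_dilate_le[OF f q] in \<open>auto simp: Liminf_const\<close>)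
  finally show ?thesis .
qed

lemma AE_boundary_value_add:
  assumes "f \<in> hardy2" "g \<in> hardy2"
  shows "AE \<zeta> in \<m>. boundary_value (\<lambda>z. f z + g z) \<zeta> = boundary_value f \<zeta> + boundary_value g \<zeta>"
  using fatou_radial_limits[OF assms(1)] fatou_radial_limits[OF assms(2)]
  by eventually_elim (intro boundary_value_eqI tendsto_add)

lemma AE_boundary_value_diff:
  assumes "f \<in> hardy2" "g \<in> hardy2"
  shows "AE \<zeta> in \<m>. boundary_value (\<lambda>z. f z - g z) \<zeta> = boundary_value f \<zeta> - boundary_value g \<zeta>"
  using fatou_radial_limits[OF assms(1)] fatou_radial_limits[OF assms(2)]
  by eventually_elim (intro boundary_value_eqI tendsto_diff)

lemma AE_boundary_value_cmult:
  assumes "f \<in> hardy2"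
  shows "AE \<zeta> in \<m>. boundary_value (\<lambda>z. c * f z) \<zeta> = c * boundary_value f \<zeta>"
  using fatou_radial_limits[OF assms] by eventually_elim (intro boundary_value_eqI tendsto_mult tendsto_const)

lemma boundary_value_taylor_poly: "norm \<zeta> = 1 \<Longrightarrow> boundary_value (taylor_poly f N) \<zeta> = taylor_poly f N \<zeta>"
  by (intro boundary_value_continuous holomorphic_on_imp_continuous_on taylor_poly_holo)

lemma nn_integral_taylor_poly:
  "(\<integral>\<^sup>+\<zeta>. ennreal ((norm (taylor_poly f N \<zeta>))\<^sup>2) \<partial>\<m>) = ennreal (\<Sum>n<N. (norm (taylor_coeff f n))\<^sup>2)"
proof -
  let ?c = "\<lambda>n. if n < N then taylor_coeff f n else 0"
  have "(\<integral>\<^sup>+\<zeta>. ennreal ((norm (taylor_poly f N \<zeta>))\<^sup>2) \<partial>\<m>) = (\<Sum>n. ennreal ((norm (?c n))\<^sup>2))"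
  proof (rule nn_integral_norm2_circle)
    show "summable (\<lambda>n. norm (?c n))" by (rule summable_finite[of "{..<N}"]) auto
    show "taylor_poly f N \<zeta> = (\<Sum>n. ?c n * \<zeta> ^ n)" for \<zeta>
      unfolding taylor_poly_def by (subst suminf_finite[of "{..<N}"]) auto
  qed (intro holomorphic_on_imp_continuous_on taylor_poly_holo)
  also have "\<dots> = (\<Sum>n<N. ennreal ((norm (taylor_coeff f n))\<^sup>2))"
    by (subst suminf_finite[of "{..<N}"]) auto
  also have "\<dots> = ennreal (\<Sum>n<N. (norm (taylor_coeff f n))\<^sup>2)" by (rule sum_ennreal) auto
  finally show ?thesis .
qed

theorem nn_integral_boundary_value:
  assumes f: "f \<in> hardy2"
  shows "(\<integral>\<^sup>+\<zeta>. ennreal ((norm (boundary_value f \<zeta>))\<^sup>2) \<partial>\<m>) = ennreal (hardy_norm2 f)"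
proof (rule antisym[OF nn_integral_boundary_value_le[OF f]])
  let ?P = "\<integral>\<^sup>+\<zeta>. ennreal ((norm (boundary_value f \<zeta>))\<^sup>2) \<partial>\<m>"
  let ?s = "\<lambda>N. \<Sum>n<N. (norm (taylor_coeff f n))\<^sup>2"
  have key: "ennreal (2 * ?s N) \<le> ?P + ennreal (hardy_norm2 f)" for N
  proof -
    \<comment> \<open>\<open>f\<close> and \<open>g\<close> have Taylor coefficients of the same modulus and differ by \<open>2 * taylor_poly f N\<close>;
      the parallelogram law bounds the latter.\<close>
    define g where "g = (\<lambda>z. f z - 2 * taylor_poly f N z)"
    have t: "taylor_poly f N \<in> hardy2" "(\<lambda>z. 2 * taylor_poly f N z) \<in> hardy2"
      by (intro dir_space_imp_hardy2 dir_space_taylor_poly hardy2_cmult)+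
    have g: "g \<in> hardy2" unfolding g_def by (intro hardy2_diff f t)
    have gc: "taylor_coeff g n = (if n < N then - taylor_coeff f n else taylor_coeff f n)" for n
      unfolding g_def using hardy2_holo[OF f] hardy2_holo[OF t(2)] taylor_poly_holo[of f N unit_disk]
      by (simp add: taylor_coeff_diff taylor_coeff_cmult taylor_coeff_taylor_poly)
    have gn: "hardy_norm2 g = hardy_norm2 f"
      unfolding hardy_norm2_def gc by (intro suminf_cong) simp
    have m [measurable]: "boundary_value f \<in> borel_measurable \<m>" "boundary_value g \<in> borel_measurable \<m>"
      by (intro hardy2_boundary_measurable f g)+
    have tm [measurable]: "taylor_poly f N \<in> borel_measurable \<m>"
      by (intro continuous_circle_measurable holomorphic_on_imp_continuous_on taylor_poly_holo)
    have "ennreal (2 * ?s N) = 2 * (\<integral>\<^sup>+\<zeta>. ennreal ((norm (taylor_poly f N \<zeta>))\<^sup>2) \<partial>\<m>)"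
      by (simp add: nn_integral_taylor_poly ennreal_mult' sum_nonneg)
    also have "\<dots> = (\<integral>\<^sup>+\<zeta>. 2 * ennreal ((norm (taylor_poly f N \<zeta>))\<^sup>2) \<partial>\<m>)"
      by (rule nn_integral_cmult[symmetric]) measurable
    also have "\<dots> \<le> (\<integral>\<^sup>+\<zeta>. ennreal ((norm (boundary_value f \<zeta>))\<^sup>2) + ennreal ((norm (boundary_value g \<zeta>))\<^sup>2) \<partial>\<m>)"
    proof (rule nn_integral_mono_AE)
      show "AE \<zeta> in \<m>. 2 * ennreal ((norm (taylor_poly f N \<zeta>))\<^sup>2)
         \<le> ennreal ((norm (boundary_value f \<zeta>))\<^sup>2) + ennreal ((norm (boundary_value g \<zeta>))\<^sup>2)"
        using AE_boundary_value_diff[OF f t(2)] AE_boundary_value_cmult[OF t(1), of 2] AE_space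
      proof eventually_elim
        case (elim \<zeta>)
        then have e: "2 * taylor_poly f N \<zeta> = boundary_value f \<zeta> - boundary_value g \<zeta>"
          by (simp add: g_def boundary_value_taylor_poly)
        have "4 * (norm (taylor_poly f N \<zeta>))\<^sup>2 = (norm (2 * taylor_poly f N \<zeta>))\<^sup>2"
          by (simp add: norm_mult power_mult_distrib)
        also have "\<dots> \<le> 2 * (norm (boundary_value f \<zeta>))\<^sup>2 + 2 * (norm (boundary_value g \<zeta>))\<^sup>2"
          unfolding e by (rule power2_norm_diff_le)
        finally have "2 * (norm (taylor_poly f N \<zeta>))\<^sup>2 \<le> (norm (boundary_value f \<zeta>))\<^sup>2 + (norm (boundary_value g \<zeta>))\<^sup>2"
          by simp
        from ennreal_leI[OF this] show ?case by (simp add: ennreal_mult')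
      qed
    qed
    also have "\<dots> = ?P + (\<integral>\<^sup>+\<zeta>. ennreal ((norm (boundary_value g \<zeta>))\<^sup>2) \<partial>\<m>)"
      by (rule nn_integral_add) measurable
    also have "\<dots> \<le> ?P + ennreal (hardy_norm2 f)"
      using nn_integral_boundary_value_le[OF g] gn by (intro add_left_mono) simp
    finally show ?thesis .
  qed
  have "(\<lambda>N. ennreal (2 * ?s N)) \<longlonglongrightarrow> ennreal (2 * hardy_norm2 f)"
    unfolding hardy_norm2_def by (intro tendsto_intros summable_LIMSEQ hardy2_summable f)
  then have "ennreal (2 * hardy_norm2 f) \<le> ?P + ennreal (hardy_norm2 f)"
    by (rule LIMSEQ_le_const2) (use key in auto)
  moreover have "ennreal (2 * hardy_norm2 f) = ennreal (hardy_norm2 f) + ennreal (hardy_norm2 f)"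
    using hardy_norm2_nonneg[OF f] by (simp flip: ennreal_plus)
  ultimately have "ennreal (hardy_norm2 f) + ennreal (hardy_norm2 f) \<le> ennreal (hardy_norm2 f) + ?P"
    by (simp only: add.commute)
  then show "ennreal (hardy_norm2 f) \<le> ?P"
    using ennreal_add_left_cancel_le[of "ennreal (hardy_norm2 f)" "ennreal (hardy_norm2 f)" ?P] by simp
qed

section \<open>Douglas' formula\<close>

lemma AE_circle_neq_one: "AE \<zeta> in \<m>. \<zeta> \<noteq> 1"
proof (rule AE_norm_arc_lengthI[of "{0}"])
  fix t assume t: "0 \<le> t" "t < 2 * pi" "t \<notin> {0}"
  show "cis t \<noteq> 1"
  proof
    assume "cis t = 1"
    then have "cos t = 1" by (metis cis.sel(1) one_complex.sel(1))
    then obtain n :: int where n: "t = of_int n * 2 * pi" using cos_one_2pi_int by blast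
    have n': "t = of_int n * (2 * pi)" using n by simp
    have "0 < t" "t < 1 * (2 * pi)" using t by auto
    then have "0 < of_int n * (2 * pi)" "of_int n * (2 * pi) < 1 * (2 * pi)" unfolding n' by simp_all
    then have "0 < (of_int n :: real)" "(of_int n :: real) < 1"
      using zero_less_mult_pos2[of "of_int n" "2 * pi"] by auto
    then show False by simp
  qed
next
  have "{\<zeta> \<in> unit_circle. \<zeta> \<noteq> 1} = unit_circle - {1}" by auto
  moreover have "unit_circle - {1} \<in> sets borel" by (intro sets.Diff) auto
  ultimately show "{\<zeta> \<in> unit_circle. \<zeta> \<noteq> 1} \<in> sets \<m>"
    unfolding sets_norm_arc_length_iff by auto
qed auto

text \<open>The integrand is n times the Fejer kernel: the quotient is a geometric sum of n
  monomials, and Parseval's identity counts them.\<close>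

lemma nn_integral_fejer:
  "(\<integral>\<^sup>+\<eta>. ennreal ((norm (\<eta> ^ n - 1))\<^sup>2 / (norm (\<eta> - 1))\<^sup>2) \<partial>\<m>) = ennreal (real n)"
proof -
  let ?c = "\<lambda>j. if j < n then (1::complex) else 0"
  have "(\<integral>\<^sup>+\<eta>. ennreal ((norm (\<eta> ^ n - 1))\<^sup>2 / (norm (\<eta> - 1))\<^sup>2) \<partial>\<m>)
     = (\<integral>\<^sup>+\<eta>. ennreal ((norm (\<Sum>j<n. \<eta> ^ j))\<^sup>2) \<partial>\<m>)"
  proof (rule nn_integral_cong_AE)
    show "AE \<eta> in \<m>. ennreal ((norm (\<eta> ^ n - 1))\<^sup>2 / (norm (\<eta> - 1))\<^sup>2) = ennreal ((norm (\<Sum>j<n. \<eta> ^ j))\<^sup>2)"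
      using AE_circle_neq_one
    proof eventually_elim
      case (elim \<eta>)
      have "\<eta> ^ n - 1 = (\<eta> - 1) * (\<Sum>j<n. \<eta> ^ j)" by (rule power_diff_1_eq)
      then show ?case using elim by (simp add: norm_mult power_mult_distrib)
    qed
  qed
  also have "\<dots> = (\<Sum>j. ennreal ((norm (?c j))\<^sup>2))"
  proof (rule nn_integral_norm2_circle)
    show "summable (\<lambda>j. norm (?c j))" by (rule summable_finite[of "{..<n}"]) auto
    show "(\<Sum>j<n. \<zeta> ^ j) = (\<Sum>j. ?c j * \<zeta> ^ j)" for \<zeta> :: complex
      by (subst suminf_finite[of "{..<n}"]) auto
  qed (intro continuous_intros)
  also have "\<dots> = (\<Sum>j<n. ennreal 1)"
    by (subst suminf_finite[of "{..<n}"]) auto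
  also have "\<dots> = ennreal (real n)" by (simp add: ennreal_of_nat_eq_real_of_nat)
  finally show ?thesis .
qed

lemma boundary_value_rotate: "boundary_value (\<lambda>z. f (c * z)) \<zeta> = boundary_value f (c * \<zeta>)"
  unfolding boundary_value_def by (simp add: mult.left_commute)

lemma hardy2_rotate:
  assumes f: "f \<in> hardy2" and c: "norm c = 1"
  shows "(\<lambda>z. f (c * z)) \<in> hardy2" "taylor_coeff (\<lambda>z. f (c * z)) n = c ^ n * taylor_coeff f n"
proof -
  have tc: "taylor_coeff (\<lambda>z. f (c * z)) n = c ^ n * taylor_coeff f n" for n
  proof (rule taylor_coeff_unique[of 1])
    fix z :: complex assume "norm z < 1"
    then show "(\<lambda>n. c ^ n * taylor_coeff f n * z ^ n) sums f (c * z)"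
      using taylor_sums[OF hardy2_holo[OF f], of "c * z"] c
      by (simp add: norm_mult power_mult_distrib mult_ac)
  qed simp
  then show "taylor_coeff (\<lambda>z. f (c * z)) n = c ^ n * taylor_coeff f n" .
  have "(\<lambda>z. f (c * z)) holomorphic_on unit_disk"
    by (rule holomorphic_on_compose_gen[unfolded o_def, OF _ hardy2_holo[OF f]])
       (use c in \<open>auto intro!: holomorphic_intros simp: norm_mult\<close>)
  then show "(\<lambda>z. f (c * z)) \<in> hardy2"
    using hardy2_summable[OF f] c by (simp add: hardy2_def tc norm_mult norm_power)
qed

text \<open>Rotation multiplies the n-th coefficient by c^n, so this is the norm identity for
  boundary values, applied to f (c z) - f z.\<close>

lemma nn_integral_boundary_rotate_diff:
  assumes f: "f \<in> hardy2" and c: "norm c = 1"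
  shows "(\<integral>\<^sup>+\<xi>. ennreal ((norm (boundary_value f (\<xi> * c) - boundary_value f \<xi>))\<^sup>2) \<partial>\<m>)
     = (\<Sum>n. ennreal ((norm (taylor_coeff f n))\<^sup>2 * (norm (c ^ n - 1))\<^sup>2))"
proof -
  define g where "g = (\<lambda>z. f (c * z) - f z)"
  have g: "g \<in> hardy2" unfolding g_def by (intro hardy2_diff hardy2_rotate f c)
  have gc: "taylor_coeff g n = taylor_coeff f n * (c ^ n - 1)" for n
    unfolding g_def using hardy2_rotate[OF f c] f
    by (subst taylor_coeff_diff) (auto intro: hardy2_holo simp: algebra_simps)
  have "(\<integral>\<^sup>+\<xi>. ennreal ((norm (boundary_value f (\<xi> * c) - boundary_value f \<xi>))\<^sup>2) \<partial>\<m>)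
     = (\<integral>\<^sup>+\<xi>. ennreal ((norm (boundary_value g \<xi>))\<^sup>2) \<partial>\<m>)"
  proof (rule nn_integral_cong_AE)
    show "AE \<xi> in \<m>. ennreal ((norm (boundary_value f (\<xi> * c) - boundary_value f \<xi>))\<^sup>2)
        = ennreal ((norm (boundary_value g \<xi>))\<^sup>2)"
      using AE_boundary_value_diff[OF hardy2_rotate(1)[OF f c] f]
      by eventually_elim (simp add: g_def boundary_value_rotate mult.commute[of _ c])
  qed
  also have "\<dots> = ennreal (hardy_norm2 g)" by (rule nn_integral_boundary_value[OF g])
  also have "\<dots> = (\<Sum>n. ennreal ((norm (taylor_coeff f n))\<^sup>2 * (norm (c ^ n - 1))\<^sup>2))"
    unfolding hardy_norm2_def using hardy2_summable[OF g]
    by (subst suminf_ennreal2[symmetric]) (auto simp: gc norm_mult power_mult_distrib)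
  finally show ?thesis .
qed

definition diff_quot2 :: "(complex \<Rightarrow> complex) \<Rightarrow> complex \<Rightarrow> complex \<Rightarrow> ennreal" where
  "diff_quot2 f \<xi> \<zeta> = ennreal ((norm (boundary_value f \<zeta> - boundary_value f \<xi>))\<^sup>2 / (norm (\<zeta> - \<xi>))\<^sup>2)"

lemma diff_quot2_measurable_pair:
  assumes f: "f \<in> hardy2"
  shows "(\<lambda>p. diff_quot2 f (fst p) (snd p)) \<in> borel_measurable (\<m> \<Otimes>\<^sub>M \<m>)"
proof -
  have [measurable]: "boundary_value f \<in> borel_measurable \<m>" by (rule hardy2_boundary_measurable[OF f])
  show ?thesis unfolding diff_quot2_def by measurable
qed

lemma diff_quot2_measurable:
  assumes f: "f \<in> hardy2" and \<xi>: "\<xi> \<in> unit_circle"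
  shows "diff_quot2 f \<xi> \<in> borel_measurable \<m>"
proof -
  have "(\<lambda>\<zeta>. diff_quot2 f (fst (\<xi>, \<zeta>)) (snd (\<xi>, \<zeta>))) \<in> borel_measurable \<m>"
    by (rule measurable_compose[OF _ diff_quot2_measurable_pair[OF f]]) (use \<xi> in \<open>auto intro: measurable_Pair1'\<close>)
  then show ?thesis by simp
qed

lemma inner_diff_quot2_measurable:
  assumes f: "f \<in> hardy2"
  shows "(\<lambda>\<xi>. \<integral>\<^sup>+\<zeta>. diff_quot2 f \<xi> \<zeta> \<partial>\<m>) \<in> borel_measurable \<m>"
  by (rule arc.borel_measurable_nn_integral)
     (use diff_quot2_measurable_pair[OF f] in \<open>simp add: case_prod_beta'\<close>)

text \<open>Substituting \<zeta> = \<xi> \<eta> makes the denominator depend on \<eta> alone. By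
  Tonelli the integral over \<xi> can be taken first and gives the sum of |a_n|^2 |\<eta>^n - 1|^2
  over n; the Fejer integral then supplies the factor n.\<close>

theorem douglas_formula:
  assumes f: "f \<in> hardy2"
  shows "(\<integral>\<^sup>+\<xi>. \<integral>\<^sup>+\<zeta>. diff_quot2 f \<xi> \<zeta> \<partial>\<m> \<partial>\<m>)
     = (\<Sum>n. ennreal (real n * (norm (taylor_coeff f n))\<^sup>2))"
proof -
  interpret P: pair_sigma_finite \<m> \<m> ..
  have [measurable]: "boundary_value f \<in> borel_measurable \<m>" by (rule hardy2_boundary_measurable[OF f])
  have rot: "(\<integral>\<^sup>+\<zeta>. diff_quot2 f \<xi> \<zeta> \<partial>\<m>) = (\<integral>\<^sup>+\<eta>. diff_quot2 f \<xi> (\<xi> * \<eta>) \<partial>\<m>)"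
    if "\<xi> \<in> unit_circle" for \<xi>
    by (rule nn_integral_rotate[symmetric, OF diff_quot2_measurable[OF f that]]) (use that in simp)
  have q: "diff_quot2 f \<xi> (\<xi> * \<eta>)
      = ennreal ((norm (boundary_value f (\<xi> * \<eta>) - boundary_value f \<xi>))\<^sup>2) * ennreal (1 / (norm (\<eta> - 1))\<^sup>2)"
    if "\<xi> \<in> unit_circle" for \<xi> \<eta>
  proof -
    have "norm (\<xi> * \<eta> - \<xi>) = norm (\<xi> * (\<eta> - 1))" by (simp add: algebra_simps)
    also have "\<dots> = norm (\<eta> - 1)" using that by (simp add: norm_mult)
    finally show ?thesis unfolding diff_quot2_def by (simp add: ennreal_mult[symmetric])
  qed
  have m2 [measurable]: "(\<lambda>p. boundary_value f (fst p * snd p)) \<in> borel_measurable (\<m> \<Otimes>\<^sub>M \<m>)"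
    by (rule measurable_compose[OF mult_measurable_circle_pair]) measurable
  have [measurable]: "(\<lambda>\<eta>. \<eta>) \<in> borel_measurable \<m>" by (rule id_measurable_circle)
  have "(\<integral>\<^sup>+\<xi>. \<integral>\<^sup>+\<zeta>. diff_quot2 f \<xi> \<zeta> \<partial>\<m> \<partial>\<m>)
      = (\<integral>\<^sup>+\<xi>. \<integral>\<^sup>+\<eta>. ennreal ((norm (boundary_value f (\<xi> * \<eta>) - boundary_value f \<xi>))\<^sup>2) * ennreal (1 / (norm (\<eta> - 1))\<^sup>2)
           \<partial>\<m> \<partial>\<m>)"
  proof (rule nn_integral_cong)
    fix \<xi> assume "\<xi> \<in> space \<m>"
    then have \<xi>: "\<xi> \<in> unit_circle" by simp
    show "(\<integral>\<^sup>+\<zeta>. diff_quot2 f \<xi> \<zeta> \<partial>\<m>)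
      = (\<integral>\<^sup>+\<eta>. ennreal ((norm (boundary_value f (\<xi> * \<eta>) - boundary_value f \<xi>))\<^sup>2) * ennreal (1 / (norm (\<eta> - 1))\<^sup>2) \<partial>\<m>)"
      unfolding rot[OF \<xi>] q[OF \<xi>] ..
  qed
  also have "\<dots> = (\<integral>\<^sup>+\<eta>. \<integral>\<^sup>+\<xi>. ennreal ((norm (boundary_value f (\<xi> * \<eta>) - boundary_value f \<xi>))\<^sup>2) * ennreal (1 / (norm (\<eta> - 1))\<^sup>2)
           \<partial>\<m> \<partial>\<m>)"
  proof (rule P.Fubini'[symmetric])
    show "(\<lambda>(\<xi>, \<eta>). ennreal ((norm (boundary_value f (\<xi> * \<eta>) - boundary_value f \<xi>))\<^sup>2) * ennreal (1 / (norm (\<eta> - 1))\<^sup>2))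
      \<in> borel_measurable (\<m> \<Otimes>\<^sub>M \<m>)"
      unfolding case_prod_beta' by measurable
  qed
  also have "\<dots> = (\<integral>\<^sup>+\<eta>. (\<Sum>n. ennreal ((norm (taylor_coeff f n))\<^sup>2) * ennreal ((norm (\<eta> ^ n - 1))\<^sup>2 / (norm (\<eta> - 1))\<^sup>2)) \<partial>\<m>)"
  proof (rule nn_integral_cong)
    fix \<eta> assume "\<eta> \<in> space \<m>"
    then have \<eta>: "norm \<eta> = 1" by simp
    have [measurable]: "(\<lambda>\<xi>. boundary_value f (\<xi> * \<eta>)) \<in> borel_measurable \<m>"
      using measurable_compose[OF mult_measurable_circle[OF \<eta>], of "boundary_value f"] by (simp add: mult.commute)
    have "(\<integral>\<^sup>+\<xi>. ennreal ((norm (boundary_value f (\<xi> * \<eta>) - boundary_value f \<xi>))\<^sup>2) * ennreal (1 / (norm (\<eta> - 1))\<^sup>2) \<partial>\<m>)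
       = (\<Sum>n. ennreal ((norm (taylor_coeff f n))\<^sup>2 * (norm (\<eta> ^ n - 1))\<^sup>2)) * ennreal (1 / (norm (\<eta> - 1))\<^sup>2)"
      by (subst nn_integral_multc) (auto simp: nn_integral_boundary_rotate_diff[OF f \<eta>])
    also have "\<dots> = (\<Sum>n. ennreal ((norm (taylor_coeff f n))\<^sup>2) * ennreal ((norm (\<eta> ^ n - 1))\<^sup>2 / (norm (\<eta> - 1))\<^sup>2))"
      by (subst ennreal_suminf_multc[symmetric]) (simp add: ennreal_mult[symmetric])
    finally show "(\<integral>\<^sup>+\<xi>. ennreal ((norm (boundary_value f (\<xi> * \<eta>) - boundary_value f \<xi>))\<^sup>2) * ennreal (1 / (norm (\<eta> - 1))\<^sup>2) \<partial>\<m>)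
       = (\<Sum>n. ennreal ((norm (taylor_coeff f n))\<^sup>2) * ennreal ((norm (\<eta> ^ n - 1))\<^sup>2 / (norm (\<eta> - 1))\<^sup>2))" .
  qed
  also have "\<dots> = (\<Sum>n. ennreal ((norm (taylor_coeff f n))\<^sup>2) * (\<integral>\<^sup>+\<eta>. ennreal ((norm (\<eta> ^ n - 1))\<^sup>2 / (norm (\<eta> - 1))\<^sup>2) \<partial>\<m>))"
    by (subst nn_integral_suminf, measurable) (simp add: nn_integral_cmult)
  also have "\<dots> = (\<Sum>n. ennreal (real n * (norm (taylor_coeff f n))\<^sup>2))"
    unfolding nn_integral_fejer by (simp add: ennreal_mult[symmetric] mult.commute)
  finally show ?thesis .
qed

text \<open>The inner integral of the definition runs over arc length that is not normalized; its
  factor 2 pi cancels the leading 1 / (2 pi).\<close>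

lemma dirichlet_integral_density:
  assumes f: "f \<in> hardy2" and [measurable]: "\<rho> \<in> borel_measurable \<m>"
  shows "dirichlet_integral (density \<m> \<rho>) f
     = (\<integral>\<^sup>+\<xi>. \<rho> \<xi> * (\<integral>\<^sup>+\<zeta>. diff_quot2 f \<xi> \<zeta> \<partial>\<m>) \<partial>\<m>)"
proof -
  note m = inner_diff_quot2_measurable[OF f]
  have "dirichlet_integral (density \<m> \<rho>) f
      = ennreal (1 / (2 * pi)) * (\<integral>\<^sup>+\<xi>. ennreal (2 * pi) * (\<integral>\<^sup>+\<zeta>. diff_quot2 f \<xi> \<zeta> \<partial>\<m>) \<partial>density \<m> \<rho>)"
    unfolding dirichlet_integral_def diff_quot2_def[symmetric]
    by (intro arg_cong2[where f = "(*)"] refl nn_integral_cong nn_integral_arc_length diff_quot2_measurable f)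
       (simp add: space_density)
  also have "\<dots> = ennreal (1 / (2 * pi)) * (ennreal (2 * pi) *
       (\<integral>\<^sup>+\<xi>. \<rho> \<xi> * (\<integral>\<^sup>+\<zeta>. diff_quot2 f \<xi> \<zeta> \<partial>\<m>) \<partial>\<m>))"
  proof -
    have "(\<integral>\<^sup>+\<xi>. ennreal (2 * pi) * (\<integral>\<^sup>+\<zeta>. diff_quot2 f \<xi> \<zeta> \<partial>\<m>) \<partial>density \<m> \<rho>)
      = (\<integral>\<^sup>+\<xi>. \<rho> \<xi> * (ennreal (2 * pi) * (\<integral>\<^sup>+\<zeta>. diff_quot2 f \<xi> \<zeta> \<partial>\<m>)) \<partial>\<m>)"
      by (intro nn_integral_density assms borel_measurable_times_ennreal m borel_measurable_const)
    also have "\<dots> = (\<integral>\<^sup>+\<xi>. ennreal (2 * pi) * (\<rho> \<xi> * (\<integral>\<^sup>+\<zeta>. diff_quot2 f \<xi> \<zeta> \<partial>\<m>)) \<partial>\<m>)"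
      by (simp only: mult.left_commute)
    also have "\<dots> = ennreal (2 * pi) * (\<integral>\<^sup>+\<xi>. \<rho> \<xi> * (\<integral>\<^sup>+\<zeta>. diff_quot2 f \<xi> \<zeta> \<partial>\<m>) \<partial>\<m>)"
      by (intro nn_integral_cmult assms borel_measurable_times_ennreal m)
    finally show ?thesis by simp
  qed
  also have "\<dots> = (\<integral>\<^sup>+\<xi>. \<rho> \<xi> * (\<integral>\<^sup>+\<zeta>. diff_quot2 f \<xi> \<zeta> \<partial>\<m>) \<partial>\<m>)"
    unfolding mult.assoc[symmetric] by (subst ennreal_mult[symmetric]) auto
  finally show ?thesis .
qed

lemma dirichlet_integral_arc:
  assumes f: "f \<in> hardy2"
  shows "dirichlet_integral \<m> f = (\<integral>\<^sup>+\<xi>. \<integral>\<^sup>+\<zeta>. diff_quot2 f \<xi> \<zeta> \<partial>\<m> \<partial>\<m>)"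
  using dirichlet_integral_density[OF f, of "\<lambda>_. 1"] by (simp add: density_1)

lemma dirichlet_space_eq_dir_space: "dirichlet_space \<m> = dir_space"
proof -
  have "dirichlet_integral \<m> f < \<infinity> \<longleftrightarrow> summable (\<lambda>n. real n * (norm (taylor_coeff f n))\<^sup>2)" if "f \<in> hardy2" for f
  proof
    assume "dirichlet_integral \<m> f < \<infinity>"
    then show "summable (\<lambda>n. real n * (norm (taylor_coeff f n))\<^sup>2)"
      unfolding dirichlet_integral_arc[OF that] douglas_formula[OF that]
      by (intro summable_suminf_not_top) auto
  next
    assume s: "summable (\<lambda>n. real n * (norm (taylor_coeff f n))\<^sup>2)"
    show "dirichlet_integral \<m> f < \<infinity>"
      unfolding dirichlet_integral_arc[OF that] douglas_formula[OF that]
      by (subst suminf_ennreal2) (use s in auto)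
  qed
  then show ?thesis by (auto simp: dirichlet_space_def dir_space_iff)
qed

lemma dirichlet_integral_dir_space:
  assumes f: "f \<in> dir_space"
  shows "dirichlet_integral \<m> f = ennreal (\<Sum>n. real n * (norm (taylor_coeff f n))\<^sup>2)"
  using f dir_space_iff[of f]
  by (simp add: dirichlet_integral_arc douglas_formula suminf_ennreal2)

lemma dirichlet_norm_dir_space:
  assumes f: "f \<in> dir_space"
  shows "dirichlet_norm \<m> f = sqrt (dir_norm2 f)"
proof -
  have "0 \<le> (\<Sum>n. real n * (norm (taylor_coeff f n))\<^sup>2)" using f by (intro suminf_nonneg) (auto simp: dir_space_iff)
  then show ?thesis
    unfolding dirichlet_norm_def dirichlet_integral_dir_space[OF f] dir_norm2_eq[OF f] hardy_norm2_def by simp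
qed

text \<open>Product rule for increments: that of h f is h (\<zeta>) times the increment of f plus f
  (\<xi>) times the increment of h. Boundedness of h controls the first part; the Lipschitz
  condition makes the second cost only the Hardy norm of f. The relation q = h f is asked for near
  the circle because h = 1 / \<Phi>, the main application, has poles at the zeros of \<Phi>.\<close>

lemma dir_space_multiplier:
  assumes f: "f \<in> dir_space" and q: "q holomorphic_on unit_disk" and r0: "r0 < 1"
    and eq: "\<And>z. r0 < norm z \<Longrightarrow> norm z < 1 \<Longrightarrow> q z = h z * f z"
    and C: "\<And>z. r0 < norm z \<Longrightarrow> norm z \<le> 1 \<Longrightarrow> norm (h z) \<le> C"
    and L: "\<And>x y. norm x = 1 \<Longrightarrow> norm y = 1 \<Longrightarrow> norm (h x - h y) \<le> L * norm (x - y)"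
    and lim: "\<And>\<zeta>. norm \<zeta> = 1 \<Longrightarrow> ((\<lambda>r. h (of_real r * \<zeta>)) \<longlongrightarrow> h \<zeta>) (at_left (1::real))"
  shows "q \<in> dir_space" "dir_norm2 q \<le> 2 * (C\<^sup>2 + L\<^sup>2) * dir_norm2 f"
proof -
  have fh: "f \<in> hardy2" by (rule dir_space_imp_hardy2[OF f])
  have C0: "0 \<le> C" by (rule order_trans[OF norm_ge_zero[of "h 1"] C]) (use r0 in auto)
  have bdd: "(\<integral>\<^sup>+\<zeta>. ennreal ((norm (q (of_real r * \<zeta>)))\<^sup>2) \<partial>\<m>) \<le> ennreal (C\<^sup>2 * hardy_norm2 f)"
    if r: "r0 < r" "0 \<le> r" "r < 1" for r
  proof -
    have [measurable]: "(\<lambda>\<zeta>. f (of_real r * \<zeta>)) \<in> borel_measurable \<m>"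
      by (intro continuous_circle_measurable continuous_dilate hardy2_continuous fh r)
    have "(\<integral>\<^sup>+\<zeta>. ennreal ((norm (q (of_real r * \<zeta>)))\<^sup>2) \<partial>\<m>)
       \<le> (\<integral>\<^sup>+\<zeta>. ennreal (C\<^sup>2) * ennreal ((norm (f (of_real r * \<zeta>)))\<^sup>2) \<partial>\<m>)"
    proof (rule nn_integral_mono)
      fix \<zeta> assume "\<zeta> \<in> space \<m>"
      then have n: "norm (of_real r * \<zeta>) = r" using r by (simp add: norm_mult)
      then have "q (of_real r * \<zeta>) = h (of_real r * \<zeta>) * f (of_real r * \<zeta>)" using r by (intro eq) auto
      then have "(norm (q (of_real r * \<zeta>)))\<^sup>2 = (norm (h (of_real r * \<zeta>)))\<^sup>2 * (norm (f (of_real r * \<zeta>)))\<^sup>2"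
        by (simp only: norm_mult power_mult_distrib)
      also have "\<dots> \<le> C\<^sup>2 * (norm (f (of_real r * \<zeta>)))\<^sup>2"
        using C[of "of_real r * \<zeta>"] n r by (intro mult_right_mono power_mono) auto
      finally show "ennreal ((norm (q (of_real r * \<zeta>)))\<^sup>2) \<le> ennreal (C\<^sup>2) * ennreal ((norm (f (of_real r * \<zeta>)))\<^sup>2)"
        by (simp add: ennreal_mult[symmetric] ennreal_leI)
    qed
    also have "\<dots> = ennreal (C\<^sup>2) * (\<integral>\<^sup>+\<zeta>. ennreal ((norm (f (of_real r * \<zeta>)))\<^sup>2) \<partial>\<m>)"
      by (rule nn_integral_cmult) measurable
    also have "\<dots> \<le> ennreal (C\<^sup>2) * ennreal (hardy_norm2 f)"
      by (intro mult_left_mono nn_integral_norm2_dilate_le fh r) auto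
    finally show ?thesis using hardy_norm2_nonneg[OF fh] by (simp add: ennreal_mult)
  qed
  have K: "0 \<le> C\<^sup>2 * hardy_norm2 f" using hardy_norm2_nonneg[OF fh] by simp
  have qh: "q \<in> hardy2" and qn: "hardy_norm2 q \<le> C\<^sup>2 * hardy_norm2 f"
    using hardy2_bounded_means[OF q r0 K bdd] by auto
  have bv: "AE \<zeta> in \<m>. boundary_value q \<zeta> = h \<zeta> * boundary_value f \<zeta>"
    using fatou_radial_limits[OF fh] AE_space
  proof eventually_elim
    case (elim \<zeta>)
    then have n: "norm \<zeta> = 1" by simp
    have "((\<lambda>r. h (of_real r * \<zeta>) * f (of_real r * \<zeta>)) \<longlongrightarrow> h \<zeta> * boundary_value f \<zeta>) (at_left (1::real))"
      by (intro tendsto_mult lim n elim)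
    moreover have "eventually (\<lambda>r. h (of_real r * \<zeta>) * f (of_real r * \<zeta>) = q (of_real r * \<zeta>)) (at_left (1::real))"
      by (rule eventually_at_leftI[of "max 0 r0"]) (use eq r0 n in \<open>auto simp: norm_mult\<close>)
    ultimately show ?case by (intro boundary_value_eqI) (rule Lim_transform_eventually)
  qed
  note [measurable] = inner_diff_quot2_measurable[OF fh] hardy2_boundary_measurable[OF fh]
  have pt: "diff_quot2 q \<xi> \<zeta> \<le> ennreal (2 * C\<^sup>2) * diff_quot2 f \<xi> \<zeta> + ennreal (2 * L\<^sup>2 * (norm (boundary_value f \<xi>))\<^sup>2)"
    if "norm \<xi> = 1" "norm \<zeta> = 1" "boundary_value q \<zeta> = h \<zeta> * boundary_value f \<zeta>" "boundary_value q \<xi> = h \<xi> * boundary_value f \<xi>" for \<xi> \<zeta>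
  proof (cases "\<zeta> = \<xi>")
    case False
    then have p: "0 < (norm (\<zeta> - \<xi>))\<^sup>2" by simp
    have "boundary_value q \<zeta> - boundary_value q \<xi>
       = h \<zeta> * (boundary_value f \<zeta> - boundary_value f \<xi>) + (h \<zeta> - h \<xi>) * boundary_value f \<xi>"
      using that by (simp add: algebra_simps)
    then have "(norm (boundary_value q \<zeta> - boundary_value q \<xi>))\<^sup>2
       \<le> 2 * (norm (h \<zeta> * (boundary_value f \<zeta> - boundary_value f \<xi>)))\<^sup>2 + 2 * (norm ((h \<zeta> - h \<xi>) * boundary_value f \<xi>))\<^sup>2"
      by (simp only: power2_norm_add_le)
    also have "\<dots> = 2 * ((norm (h \<zeta>))\<^sup>2 * (norm (boundary_value f \<zeta> - boundary_value f \<xi>))\<^sup>2)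
        + 2 * ((norm (h \<zeta> - h \<xi>))\<^sup>2 * (norm (boundary_value f \<xi>))\<^sup>2)"
      by (simp add: norm_mult power_mult_distrib)
    also have "\<dots> \<le> 2 * (C\<^sup>2 * (norm (boundary_value f \<zeta> - boundary_value f \<xi>))\<^sup>2)
        + 2 * ((L * norm (\<zeta> - \<xi>))\<^sup>2 * (norm (boundary_value f \<xi>))\<^sup>2)"
      by (intro add_mono mult_left_mono mult_right_mono power_mono L C) (use that r0 in auto)
    finally have "(norm (boundary_value q \<zeta> - boundary_value q \<xi>))\<^sup>2 / (norm (\<zeta> - \<xi>))\<^sup>2
       \<le> (2 * (C\<^sup>2 * (norm (boundary_value f \<zeta> - boundary_value f \<xi>))\<^sup>2)
        + 2 * ((L * norm (\<zeta> - \<xi>))\<^sup>2 * (norm (boundary_value f \<xi>))\<^sup>2)) / (norm (\<zeta> - \<xi>))\<^sup>2"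
      by (intro divide_right_mono) auto
    also have "\<dots> = 2 * C\<^sup>2 * ((norm (boundary_value f \<zeta> - boundary_value f \<xi>))\<^sup>2 / (norm (\<zeta> - \<xi>))\<^sup>2)
        + 2 * L\<^sup>2 * (norm (boundary_value f \<xi>))\<^sup>2"
      using p by (simp add: add_divide_distrib power_mult_distrib)
    finally show ?thesis
      unfolding diff_quot2_def by (simp add: ennreal_mult[symmetric] ennreal_plus[symmetric] ennreal_leI del: ennreal_plus)
  qed (simp add: diff_quot2_def)
  have "dirichlet_integral \<m> q
      \<le> (\<integral>\<^sup>+\<xi>. ennreal (2 * C\<^sup>2) * (\<integral>\<^sup>+\<zeta>. diff_quot2 f \<xi> \<zeta> \<partial>\<m>)
            + ennreal (2 * L\<^sup>2) * ennreal ((norm (boundary_value f \<xi>))\<^sup>2) \<partial>\<m>)"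
    unfolding dirichlet_integral_arc[OF qh]
  proof (rule nn_integral_mono_AE)
    show "AE \<xi> in \<m>. (\<integral>\<^sup>+\<zeta>. diff_quot2 q \<xi> \<zeta> \<partial>\<m>)
      \<le> ennreal (2 * C\<^sup>2) * (\<integral>\<^sup>+\<zeta>. diff_quot2 f \<xi> \<zeta> \<partial>\<m>) + ennreal (2 * L\<^sup>2) * ennreal ((norm (boundary_value f \<xi>))\<^sup>2)"
      using bv AE_space
    proof eventually_elim
      case (elim \<xi>)
      note \<xi> = elim
      have "(\<integral>\<^sup>+\<zeta>. diff_quot2 q \<xi> \<zeta> \<partial>\<m>)
         \<le> (\<integral>\<^sup>+\<zeta>. ennreal (2 * C\<^sup>2) * diff_quot2 f \<xi> \<zeta> + ennreal (2 * L\<^sup>2 * (norm (boundary_value f \<xi>))\<^sup>2) \<partial>\<m>)"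
      proof (rule nn_integral_mono_AE)
        show "AE \<zeta> in \<m>. diff_quot2 q \<xi> \<zeta> \<le> ennreal (2 * C\<^sup>2) * diff_quot2 f \<xi> \<zeta> + ennreal (2 * L\<^sup>2 * (norm (boundary_value f \<xi>))\<^sup>2)"
          using bv AE_space by eventually_elim (rule pt, use \<xi> in auto)
      qed
      also have "\<dots> = ennreal (2 * C\<^sup>2) * (\<integral>\<^sup>+\<zeta>. diff_quot2 f \<xi> \<zeta> \<partial>\<m>) + ennreal (2 * L\<^sup>2 * (norm (boundary_value f \<xi>))\<^sup>2)"
        using \<xi> diff_quot2_measurable[OF fh, of \<xi>]
        by (subst nn_integral_add) (auto simp: nn_integral_cmult emeasure_norm_arc_length)
      finally show ?case by (simp add: ennreal_mult)
    qed
  qed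
  also have "\<dots> = ennreal (2 * C\<^sup>2) * dirichlet_integral \<m> f + ennreal (2 * L\<^sup>2) * ennreal (hardy_norm2 f)"
    by (subst nn_integral_add, measurable)
       (simp add: nn_integral_cmult dirichlet_integral_arc[OF fh] nn_integral_boundary_value[OF fh])
  also have "\<dots> = ennreal (2 * C\<^sup>2 * (\<Sum>n. real n * (norm (taylor_coeff f n))\<^sup>2) + 2 * L\<^sup>2 * hardy_norm2 f)" (is "_ = ennreal ?R")
    using hardy_norm2_nonneg[OF fh] f suminf_nonneg[of "\<lambda>n. real n * (norm (taylor_coeff f n))\<^sup>2"]
    unfolding dirichlet_integral_dir_space[OF f] by (subst ennreal_plus) (auto simp: ennreal_mult dir_space_iff)
  finally have DI: "dirichlet_integral \<m> q \<le> ennreal ?R" .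
  then show qw: "q \<in> dir_space"
    using qh le_less_trans[OF DI ennreal_less_top] by (simp add: dirichlet_space_eq_dir_space[symmetric] dirichlet_space_def)
  have S: "0 \<le> (\<Sum>n. real n * (norm (taylor_coeff f n))\<^sup>2)" using f by (intro suminf_nonneg) (auto simp: dir_space_iff)
  have R: "0 \<le> ?R" using S hardy_norm2_nonneg[OF fh] by simp
  have "(\<Sum>n. real n * (norm (taylor_coeff q n))\<^sup>2) \<le> ?R"
    using DI R by (simp add: dirichlet_integral_dir_space[OF qw] ennreal_le_iff)
  then have "dir_norm2 q \<le> C\<^sup>2 * hardy_norm2 f + ?R" using qn dir_norm2_eq[OF qw] by simp
  also have "\<dots> \<le> 2 * (C\<^sup>2 + L\<^sup>2) * (hardy_norm2 f + (\<Sum>n. real n * (norm (taylor_coeff f n))\<^sup>2))"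
    using mult_nonneg_nonneg[OF zero_le_power2[of C] hardy_norm2_nonneg[OF fh]]
      mult_nonneg_nonneg[OF zero_le_power2[of L] S] by (simp add: algebra_simps)
  finally show "dir_norm2 q \<le> 2 * (C\<^sup>2 + L\<^sup>2) * dir_norm2 f" by (simp add: dir_norm2_eq[OF f])
qed

subsection \<open>Weighted Dirichlet integrals\<close>

lemma holomorphic_bounded_lipschitz:
  assumes \<Phi>: "\<Phi> holomorphic_on ball 0 R" "R > 1"
  obtains C L where "0 \<le> C" "0 \<le> L" "\<And>z. norm z \<le> 1 \<Longrightarrow> norm (\<Phi> z) \<le> C"
    "\<And>x y. norm x \<le> 1 \<Longrightarrow> norm y \<le> 1 \<Longrightarrow> norm (\<Phi> x - \<Phi> y) \<le> L * norm (x - y)"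
proof -
  have sub: "cball 0 1 \<subseteq> ball (0::complex) R" using \<Phi> by auto
  have "continuous_on (cball 0 1) \<Phi>" "continuous_on (cball 0 1) (deriv \<Phi>)"
    using \<Phi>(1) sub by (meson holomorphic_on_imp_continuous_on holomorphic_deriv holomorphic_on_subset open_ball)+
  then have "bounded (\<Phi> ` cball 0 1)" "bounded (deriv \<Phi> ` cball 0 1)"
    by (auto intro!: compact_imp_bounded compact_continuous_image)
  then obtain C L where C: "\<forall>x\<in>\<Phi> ` cball 0 1. norm x \<le> C" and L: "\<forall>x\<in>deriv \<Phi> ` cball 0 1. norm x \<le> L"
    unfolding bounded_iff by blast
  have "norm (\<Phi> 0) \<le> C" "norm (deriv \<Phi> 0) \<le> L" using C L by auto
  then have "0 \<le> C" "0 \<le> L" by (auto intro: order_trans[OF norm_ge_zero])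
  moreover have "norm (\<Phi> x - \<Phi> y) \<le> L * norm (x - y)" if "norm x \<le> 1" "norm y \<le> 1" for x y
  proof (rule field_differentiable_bound[of "cball 0 1" \<Phi> "deriv \<Phi>"])
    show "(\<Phi> has_field_derivative deriv \<Phi> z) (at z within cball 0 1)" if "z \<in> cball 0 1" for z
      using holomorphic_derivI[OF \<Phi>(1) open_ball] that sub by (blast intro: has_field_derivative_at_within)
  qed (use that L in auto)
  ultimately show thesis using that C by simp
qed

text \<open>One \<open>K\<close> serves all f: multiplication by \<Phi> is a bounded operator, on
  which the density argument for the isometry relies.\<close>

lemma dir_space_mult_holomorphic:
  assumes \<Phi>: "\<Phi> holomorphic_on ball 0 R" "R > 1"
  obtains K where "K \<ge> 0" "\<And>f. f \<in> dir_space \<Longrightarrow> (\<lambda>z. \<Phi> z * f z) \<in> dir_space"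
    "\<And>f. f \<in> dir_space \<Longrightarrow> dir_norm2 (\<lambda>z. \<Phi> z * f z) \<le> K * dir_norm2 f"
proof -
  obtain C L where CL: "0 \<le> C" "0 \<le> L" "\<And>z. norm z \<le> 1 \<Longrightarrow> norm (\<Phi> z) \<le> C"
    "\<And>x y. norm x \<le> 1 \<Longrightarrow> norm y \<le> 1 \<Longrightarrow> norm (\<Phi> x - \<Phi> y) \<le> L * norm (x - y)"
    using holomorphic_bounded_lipschitz[OF \<Phi>] by blast
  have sub: "cball 0 1 \<subseteq> ball (0::complex) R" "unit_disk \<subseteq> ball (0::complex) R" using \<Phi> by auto
  have *: "(\<lambda>z. \<Phi> z * f z) \<in> dir_space \<and> dir_norm2 (\<lambda>z. \<Phi> z * f z) \<le> 2 * (C\<^sup>2 + L\<^sup>2) * dir_norm2 f" if f: "f \<in> dir_space" for f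
  proof -
    have q: "(\<lambda>z. \<Phi> z * f z) holomorphic_on unit_disk"
      by (intro holomorphic_intros dir_space_holo f holomorphic_on_subset[OF \<Phi>(1)] sub)
    have lim: "((\<lambda>r. \<Phi> (of_real r * \<zeta>)) \<longlongrightarrow> \<Phi> \<zeta>) (at_left (1::real))" if "norm \<zeta> = 1" for \<zeta>
      by (intro tendsto_dilate_at_left that holomorphic_on_imp_continuous_on holomorphic_on_subset[OF \<Phi>(1)] sub)
    show ?thesis
      using dir_space_multiplier[OF f q, of 0 \<Phi> C L] CL lim by auto
  qed
  show thesis by (rule that[of "2 * (C\<^sup>2 + L\<^sup>2)"]) (use * in auto)
qed

text \<open>The form vanishes on monomials, hence on polynomials, which are dense. Its continuity is
  given as a bound by the sum of squared norms; rescaling the arguments turns this into a family of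
  bounds with a parameter t.\<close>

lemma sesquilinear_eq_zero:
  fixes Q :: "(complex \<Rightarrow> complex) \<Rightarrow> (complex \<Rightarrow> complex) \<Rightarrow> complex"
  assumes add: "\<And>f g h. f \<in> dir_space \<Longrightarrow> g \<in> dir_space \<Longrightarrow> h \<in> dir_space \<Longrightarrow> Q (\<lambda>z. f z + g z) h = Q f h + Q g h"
    and cmult: "\<And>c f g. f \<in> dir_space \<Longrightarrow> g \<in> dir_space \<Longrightarrow> Q (\<lambda>z. c * f z) g = c * Q f g"
    and cnj: "\<And>f g. f \<in> dir_space \<Longrightarrow> g \<in> dir_space \<Longrightarrow> Q g f = cnj (Q f g)"
    and bound: "\<And>f g. f \<in> dir_space \<Longrightarrow> g \<in> dir_space \<Longrightarrow> norm (Q f g) \<le> K * (dir_norm2 f + dir_norm2 g)" and K: "K \<ge> 0"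
    and mono: "\<And>j k. Q (\<lambda>z. z ^ j) (\<lambda>z. z ^ k) = 0"
    and f: "f \<in> dir_space" and g: "g \<in> dir_space"
  shows "Q f g = 0"
proof -
  note T = dir_space_taylor_poly
  have addr: "Q h (\<lambda>z. f z + g z) = Q h f + Q h g" if "f \<in> dir_space" "g \<in> dir_space" "h \<in> dir_space" for f g h
    using cnj[OF dir_space_add[OF that(1,2)] that(3)] cnj[OF that(1,3)] cnj[OF that(2,3)] add[OF that] by simp
  have cmultr: "Q g (\<lambda>z. c * f z) = cnj c * Q g f" if "f \<in> dir_space" "g \<in> dir_space" for c f g
    using cnj[OF dir_space_cmult[OF that(1)] that(2)] cnj[OF that] cmult[OF that] by simp
  have z0: "Q (taylor_poly f N) h = 0" if h: "h \<in> dir_space" "\<And>j. Q (\<lambda>z. z ^ j) h = 0" for f h N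
  proof (induction N)
    case 0
    have "taylor_poly f 0 = (\<lambda>z. 0 * 1)" by (auto simp: taylor_poly_def)
    then show ?case using cmult[OF dir_space_power[of 0] h(1), of 0] by simp
  next
    case (Suc N)
    have "taylor_poly f (Suc N) = (\<lambda>z. taylor_poly f N z + taylor_coeff f N * z ^ N)" by (auto simp: taylor_poly_def)
    then show ?case using add[OF T dir_space_cmult[OF dir_space_power] h(1)] Suc cmult[OF dir_space_power h(1)] h(2) by simp
  qed
  have "Q (\<lambda>z. z ^ k) (taylor_poly f N) = 0" for k f N
    using cnj[OF dir_space_taylor_poly[of f N] dir_space_power[of k]] z0[OF dir_space_power mono, of f N k] by simp
  then have z: "Q (taylor_poly f N) (taylor_poly g N) = 0" for f g N
    by (intro z0 T)
  \<comment> \<open>Multiplying a by sqrt t and dividing b by it leaves \<open>Q a b\<close>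
    unchanged.\<close>
  have scale: "norm (Q a b) \<le> K * (t * dir_norm2 a + dir_norm2 b / t)" if a: "a \<in> dir_space" and b: "b \<in> dir_space" and t: "t > 0" for a b t
  proof -
    let ?s = "complex_of_real (sqrt t)"
    have s: "?s \<noteq> 0" "(norm ?s)\<^sup>2 = t" "(norm (inverse ?s))\<^sup>2 = 1 / t"
      using t by (auto simp: norm_divide power_divide inverse_eq_divide)
    have "Q (\<lambda>z. ?s * a z) (\<lambda>z. inverse ?s * b z) = Q a b"
      using cmult[OF a dir_space_cmult[OF b], of ?s "inverse ?s"] cmultr[OF b a, of "inverse ?s"] s t by simp
    then show ?thesis
      using bound[OF dir_space_cmult[OF a] dir_space_cmult[OF b], of ?s "inverse ?s"]
      by (simp only: dir_norm2_cmult a b s) simp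
  qed
  define r where "r = (\<lambda>f N z. f z - taylor_poly f N z)"
  have r: "r f N \<in> dir_space" if "f \<in> dir_space" for f N unfolding r_def by (intro dir_space_diff that T)
  have wT: "dir_norm2 (taylor_poly f N) \<le> dir_norm2 f" for N
    unfolding dir_norm2_def by (intro suminf_le dir_space_summable T f) (auto simp: taylor_coeff_taylor_poly)
  have est: "norm (Q f g) \<le> K * (t * dir_norm2 (r f N) + dir_norm2 g / t) + K * (t * dir_norm2 (r g N) + dir_norm2 f / t)" if t: "t > 0" for N t
  proof -
    have "Q f g = Q (\<lambda>z. taylor_poly f N z + r f N z) g" by (simp add: r_def)
    also have "\<dots> = Q (taylor_poly f N) g + Q (r f N) g" by (intro add T r f g)
    also have "Q (taylor_poly f N) g = Q (taylor_poly f N) (\<lambda>z. taylor_poly g N z + r g N z)" by (simp add: r_def)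
    also have "\<dots> = Q (taylor_poly f N) (r g N)" using addr[OF T r[OF g] T] z by simp
    also have "\<dots> = cnj (Q (r g N) (taylor_poly f N))" by (rule cnj[OF r[OF g] T])
    finally have "norm (Q f g) \<le> norm (Q (r g N) (taylor_poly f N)) + norm (Q (r f N) g)"
      using norm_triangle_ineq[of "cnj (Q (r g N) (taylor_poly f N))" "Q (r f N) g"] by simp
    also have "\<dots> \<le> K * (t * dir_norm2 (r g N) + dir_norm2 (taylor_poly f N) / t) + K * (t * dir_norm2 (r f N) + dir_norm2 g / t)"
      by (intro add_mono scale r f g T t)
    also have "\<dots> \<le> K * (t * dir_norm2 (r g N) + dir_norm2 f / t) + K * (t * dir_norm2 (r f N) + dir_norm2 g / t)"
      by (intro add_mono mult_left_mono divide_right_mono wT K order_refl) (use t in auto)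
    finally show ?thesis by simp
  qed
  \<comment> \<open>Letting N tend to infinity removes the remainders, which carry the factor t.
    What is left carries 1 / t, and t may then tend to infinity.\<close>
  have est2: "norm (Q f g) \<le> K * (dir_norm2 f + dir_norm2 g) / t" if t: "t > 0" for t
  proof -
    have "(\<lambda>N. K * (t * dir_norm2 (r f N) + dir_norm2 g / t) + K * (t * dir_norm2 (r g N) + dir_norm2 f / t))
       \<longlonglongrightarrow> K * (t * 0 + dir_norm2 g / t) + K * (t * 0 + dir_norm2 f / t)"
      unfolding r_def by (intro tendsto_intros dir_norm2_remainder_tendsto f g)
    then have "norm (Q f g) \<le> K * (t * 0 + dir_norm2 g / t) + K * (t * 0 + dir_norm2 f / t)"
      by (rule LIMSEQ_le_const) (use est[OF t] in auto)
    also have "\<dots> = K * (dir_norm2 f + dir_norm2 g) / t" by (simp add: add_divide_distrib distrib_left)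
    finally show ?thesis .
  qed
  have "((\<lambda>t. K * (dir_norm2 f + dir_norm2 g) / t) \<longlongrightarrow> 0) at_top"
    by (intro tendsto_divide_0[OF tendsto_const] filterlim_at_top_imp_at_infinity filterlim_ident)
  then have "norm (Q f g) \<le> 0"
    by (rule tendsto_lowerbound)
       (use est2 in \<open>auto intro!: eventually_mono[OF eventually_gt_at_top[of 0]]\<close>)
  then show ?thesis by simp
qed

section \<open>The weighted energy form\<close>

definition diff_quot_prod :: "(complex \<Rightarrow> complex) \<Rightarrow> (complex \<Rightarrow> complex) \<Rightarrow> complex \<Rightarrow> complex \<Rightarrow> complex" where
  "diff_quot_prod f g \<xi> \<zeta> = (boundary_value f \<zeta> - boundary_value f \<xi>)
     * cnj (boundary_value g \<zeta> - boundary_value g \<xi>) / of_real ((norm (\<zeta> - \<xi>))\<^sup>2)"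

lemma diff_quot_prod_measurable_pair:
  assumes f: "f \<in> hardy2" and g: "g \<in> hardy2"
  shows "(\<lambda>p. diff_quot_prod f g (fst p) (snd p)) \<in> borel_measurable (\<m> \<Otimes>\<^sub>M \<m>)"
proof -
  have [measurable]: "boundary_value f \<in> borel_measurable \<m>" "boundary_value g \<in> borel_measurable \<m>"
    by (intro hardy2_boundary_measurable f g)+
  have c: "cnj \<in> borel_measurable borel" by (intro borel_measurable_continuous_onI continuous_intros)
  have [measurable]: "(\<lambda>p. cnj (boundary_value g (snd p) - boundary_value g (fst p))) \<in> borel_measurable (\<m> \<Otimes>\<^sub>M \<m>)"
    by (rule measurable_compose[OF _ c]) measurable
  show ?thesis unfolding diff_quot_prod_def by measurable
qed

lemma diff_quot_prod_measurable:
  assumes f: "f \<in> hardy2" and g: "g \<in> hardy2" and \<xi>: "\<xi> \<in> unit_circle"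
  shows "diff_quot_prod f g \<xi> \<in> borel_measurable \<m>"
proof -
  have "(\<lambda>\<zeta>. diff_quot_prod f g (fst (\<xi>, \<zeta>)) (snd (\<xi>, \<zeta>))) \<in> borel_measurable \<m>"
    by (rule measurable_compose[OF _ diff_quot_prod_measurable_pair[OF f g]]) (use \<xi> in \<open>auto intro: measurable_Pair1'\<close>)
  then show ?thesis by simp
qed

lemma norm_diff_quot_prod_le:
  "ennreal (norm (diff_quot_prod f g \<xi> \<zeta>)) \<le> ennreal (1 / 2) * (diff_quot2 f \<xi> \<zeta> + diff_quot2 g \<xi> \<zeta>)"
proof -
  have "norm (diff_quot_prod f g \<xi> \<zeta>)
     = norm ((boundary_value f \<zeta> - boundary_value f \<xi>) * cnj (boundary_value g \<zeta> - boundary_value g \<xi>)) / (norm (\<zeta> - \<xi>))\<^sup>2"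
    by (simp add: diff_quot_prod_def norm_divide norm_mult norm_power)
  also have "\<dots> \<le> (((norm (boundary_value f \<zeta> - boundary_value f \<xi>))\<^sup>2 + (norm (boundary_value g \<zeta> - boundary_value g \<xi>))\<^sup>2) / 2) / (norm (\<zeta> - \<xi>))\<^sup>2"
    by (intro divide_right_mono norm_mult_cnj_le) auto
  also have "\<dots> = 1 / 2 * ((norm (boundary_value f \<zeta> - boundary_value f \<xi>))\<^sup>2 / (norm (\<zeta> - \<xi>))\<^sup>2
      + (norm (boundary_value g \<zeta> - boundary_value g \<xi>))\<^sup>2 / (norm (\<zeta> - \<xi>))\<^sup>2)"
    by (simp add: add_divide_distrib)
  finally show ?thesis
    unfolding diff_quot2_def
    by (subst ennreal_plus[symmetric], simp, simp, subst ennreal_mult[symmetric]) (auto intro!: ennreal_leI)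
qed

lemma AE_circle_pair:
  assumes "AE x in \<m>. P x"
  shows "AE p in \<m> \<Otimes>\<^sub>M \<m>. P (fst p) \<and> P (snd p)"
proof -
  obtain N where N: "{x \<in> space \<m>. \<not> P x} \<subseteq> N" "emeasure \<m> N = 0" "N \<in> sets \<m>"
    using assms by (rule AE_E)
  have s: "unit_circle \<in> sets \<m>" using sets.top[of \<m>] by simp
  show ?thesis
  proof (rule AE_I)
    show "{p \<in> space (\<m> \<Otimes>\<^sub>M \<m>). \<not> (P (fst p) \<and> P (snd p))} \<subseteq> N \<times> unit_circle \<union> unit_circle \<times> N"
      using N(1) by (auto simp: space_pair_measure)
    have "emeasure (\<m> \<Otimes>\<^sub>M \<m>) (N \<times> unit_circle \<union> unit_circle \<times> N)
      \<le> emeasure (\<m> \<Otimes>\<^sub>M \<m>) (N \<times> unit_circle) + emeasure (\<m> \<Otimes>\<^sub>M \<m>) (unit_circle \<times> N)"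
      using N(3) s by (intro emeasure_subadditive) auto
    also have "\<dots> = 0" using N s by (simp add: arc.emeasure_pair_measure_Times)
    finally show "emeasure (\<m> \<Otimes>\<^sub>M \<m>) (N \<times> unit_circle \<union> unit_circle \<times> N) = 0" by simp
    show "N \<times> unit_circle \<union> unit_circle \<times> N \<in> sets (\<m> \<Otimes>\<^sub>M \<m>)" using N s by auto
  qed
qed

text \<open>The bound \<open>C\<close> dominates the weighted energy by the unweighted Dirichlet
  integral, so the double integrand is integrable for all functions in
  \<open>dir_space\<close>.\<close>

locale bounded_density =
  fixes \<rho> :: "complex \<Rightarrow> real" and C :: real
  assumes \<rho>_meas: "\<rho> \<in> borel_measurable \<m>"
    and \<rho>_nonneg: "\<And>\<xi>. \<xi> \<in> unit_circle \<Longrightarrow> 0 \<le> \<rho> \<xi>" and \<rho>_le: "\<And>\<xi>. \<xi> \<in> unit_circle \<Longrightarrow> \<rho> \<xi> \<le> C"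
begin

text \<open>Taken over the product measure, where a single integrability statement yields linearity.
  Fubini identifies it with the iterated integral of \<open>dirichlet_inner\<close>.\<close>

definition energy :: "(complex \<Rightarrow> complex) \<Rightarrow> (complex \<Rightarrow> complex) \<Rightarrow> complex" where
  "energy f g = (\<integral>p. \<rho> (fst p) *\<^sub>R diff_quot_prod f g (fst p) (snd p) \<partial>(\<m> \<Otimes>\<^sub>M \<m>))"

lemma C_nonneg: "0 \<le> C" using \<rho>_nonneg[of 1] \<rho>_le[of 1] by simp

lemma energy_integrand_measurable:
  assumes f: "f \<in> hardy2" and g: "g \<in> hardy2"
  shows "(\<lambda>p. \<rho> (fst p) *\<^sub>R diff_quot_prod f g (fst p) (snd p)) \<in> borel_measurable (\<m> \<Otimes>\<^sub>M \<m>)"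
  by (intro borel_measurable_scaleR diff_quot_prod_measurable_pair f g measurable_compose[OF measurable_fst \<rho>_meas])

lemma nn_integral_energy_le:
  assumes f: "f \<in> dir_space" and g: "g \<in> dir_space"
  shows "(\<integral>\<^sup>+p. ennreal (norm (\<rho> (fst p) *\<^sub>R diff_quot_prod f g (fst p) (snd p))) \<partial>(\<m> \<Otimes>\<^sub>M \<m>))
      \<le> ennreal (C * (dir_norm2 f + dir_norm2 g))"
proof -
  have fh: "f \<in> hardy2" and gh: "g \<in> hardy2" using f g dir_space_imp_hardy2 by auto
  note m = diff_quot2_measurable_pair[OF fh] diff_quot2_measurable_pair[OF gh]
  have dq: "(\<integral>\<^sup>+p. diff_quot2 f (fst p) (snd p) \<partial>(\<m> \<Otimes>\<^sub>M \<m>)) \<le> ennreal (dir_norm2 f)"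
    if f: "f \<in> dir_space" for f
  proof -
    have fh: "f \<in> hardy2" by (rule dir_space_imp_hardy2[OF f])
    have "(\<integral>\<^sup>+p. diff_quot2 f (fst p) (snd p) \<partial>(\<m> \<Otimes>\<^sub>M \<m>)) = dirichlet_integral \<m> f"
      unfolding dirichlet_integral_arc[OF fh]
      using arc.nn_integral_fst[OF diff_quot2_measurable_pair[OF fh], symmetric] by simp
    also have "\<dots> \<le> ennreal (dir_norm2 f)"
      unfolding dirichlet_integral_dir_space[OF f] dir_norm2_eq[OF f] using hardy_norm2_nonneg[OF fh] by (intro ennreal_leI) simp
    finally show ?thesis .
  qed
  have "(\<integral>\<^sup>+p. ennreal (norm (\<rho> (fst p) *\<^sub>R diff_quot_prod f g (fst p) (snd p))) \<partial>(\<m> \<Otimes>\<^sub>M \<m>))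
     \<le> (\<integral>\<^sup>+p. ennreal (C / 2) * (diff_quot2 f (fst p) (snd p) + diff_quot2 g (fst p) (snd p)) \<partial>(\<m> \<Otimes>\<^sub>M \<m>))"
  proof (rule nn_integral_mono)
    fix p assume "p \<in> space (\<m> \<Otimes>\<^sub>M \<m>)"
    then have p: "fst p \<in> unit_circle" by (auto simp: space_pair_measure)
    have "ennreal (norm (\<rho> (fst p) *\<^sub>R diff_quot_prod f g (fst p) (snd p)))
       = ennreal (\<rho> (fst p)) * ennreal (norm (diff_quot_prod f g (fst p) (snd p)))"
      using \<rho>_nonneg[OF p] by (simp add: ennreal_mult)
    also have "\<dots> \<le> ennreal C * (ennreal (1 / 2) * (diff_quot2 f (fst p) (snd p) + diff_quot2 g (fst p) (snd p)))"
      by (intro mult_mono norm_diff_quot_prod_le ennreal_leI \<rho>_le p) auto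
    also have "\<dots> = ennreal (C / 2) * (diff_quot2 f (fst p) (snd p) + diff_quot2 g (fst p) (snd p))"
      using C_nonneg unfolding mult.assoc[symmetric] by (subst ennreal_mult[symmetric]) auto
    finally show "ennreal (norm (\<rho> (fst p) *\<^sub>R diff_quot_prod f g (fst p) (snd p)))
       \<le> ennreal (C / 2) * (diff_quot2 f (fst p) (snd p) + diff_quot2 g (fst p) (snd p))" .
  qed
  also have "\<dots> = ennreal (C / 2) * ((\<integral>\<^sup>+p. diff_quot2 f (fst p) (snd p) \<partial>(\<m> \<Otimes>\<^sub>M \<m>))
       + (\<integral>\<^sup>+p. diff_quot2 g (fst p) (snd p) \<partial>(\<m> \<Otimes>\<^sub>M \<m>)))"
    by (subst nn_integral_cmult, intro borel_measurable_add m) (simp add: nn_integral_add m)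
  also have "\<dots> \<le> ennreal (C / 2) * (ennreal (dir_norm2 f) + ennreal (dir_norm2 g))"
    by (intro mult_left_mono add_mono dq f g) auto
  also have "\<dots> = ennreal (C / 2 * (dir_norm2 f + dir_norm2 g))"
    using C_nonneg dir_norm2_nonneg[OF f] dir_norm2_nonneg[OF g] by (simp add: ennreal_mult[symmetric] ennreal_plus[symmetric] del: ennreal_plus)
  also have "\<dots> \<le> ennreal (C * (dir_norm2 f + dir_norm2 g))"
    using C_nonneg dir_norm2_nonneg[OF f] dir_norm2_nonneg[OF g] by (intro ennreal_leI mult_right_mono) auto
  finally show ?thesis .
qed

lemma energy_integrable:
  assumes f: "f \<in> dir_space" and g: "g \<in> dir_space"
  shows "integrable (\<m> \<Otimes>\<^sub>M \<m>) (\<lambda>p. \<rho> (fst p) *\<^sub>R diff_quot_prod f g (fst p) (snd p))"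
proof (rule integrableI_bounded)
  show "(\<lambda>p. \<rho> (fst p) *\<^sub>R diff_quot_prod f g (fst p) (snd p)) \<in> borel_measurable (\<m> \<Otimes>\<^sub>M \<m>)"
    by (intro energy_integrand_measurable dir_space_imp_hardy2 f g)
  show "(\<integral>\<^sup>+p. ennreal (norm (\<rho> (fst p) *\<^sub>R diff_quot_prod f g (fst p) (snd p))) \<partial>(\<m> \<Otimes>\<^sub>M \<m>)) < \<infinity>"
    using le_less_trans[OF nn_integral_energy_le[OF f g] ennreal_less_top] by simp
qed

lemma norm_energy_le:
  assumes f: "f \<in> dir_space" and g: "g \<in> dir_space"
  shows "norm (energy f g) \<le> C * (dir_norm2 f + dir_norm2 g)"
proof -
  have "ennreal (norm (energy f g)) \<le> (\<integral>\<^sup>+p. ennreal (norm (\<rho> (fst p) *\<^sub>R diff_quot_prod f g (fst p) (snd p))) \<partial>(\<m> \<Otimes>\<^sub>M \<m>))"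
    unfolding energy_def by (rule integral_norm_bound_ennreal[OF energy_integrable[OF f g]])
  also have "\<dots> \<le> ennreal (C * (dir_norm2 f + dir_norm2 g))" by (rule nn_integral_energy_le[OF f g])
  finally show ?thesis
    using C_nonneg dir_norm2_nonneg[OF f] dir_norm2_nonneg[OF g] by (simp add: ennreal_le_iff)
qed

lemma energy_add:
  assumes f: "f \<in> dir_space" and g: "g \<in> dir_space" and h: "h \<in> dir_space"
  shows "energy (\<lambda>z. f z + g z) h = energy f h + energy g h"
proof -
  note H = dir_space_imp_hardy2
  have "energy (\<lambda>z. f z + g z) h = (\<integral>p. \<rho> (fst p) *\<^sub>R diff_quot_prod f h (fst p) (snd p)
        + \<rho> (fst p) *\<^sub>R diff_quot_prod g h (fst p) (snd p) \<partial>(\<m> \<Otimes>\<^sub>M \<m>))"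
    unfolding energy_def
  proof (rule integral_cong_AE)
    show "AE p in \<m> \<Otimes>\<^sub>M \<m>. \<rho> (fst p) *\<^sub>R diff_quot_prod (\<lambda>z. f z + g z) h (fst p) (snd p) =
        \<rho> (fst p) *\<^sub>R diff_quot_prod f h (fst p) (snd p) + \<rho> (fst p) *\<^sub>R diff_quot_prod g h (fst p) (snd p)"
      using AE_circle_pair[OF AE_boundary_value_add[OF H[OF f] H[OF g]]]
      by eventually_elim (simp add: diff_quot_prod_def algebra_simps add_divide_distrib diff_divide_distrib)
  qed (intro borel_measurable_add energy_integrand_measurable dir_space_add H f g h)+
  also have "\<dots> = energy f h + energy g h"
    unfolding energy_def by (intro Bochner_Integration.integral_add energy_integrable f g h)
  finally show ?thesis .
qed

lemma energy_cmult:
  assumes f: "f \<in> dir_space" and h: "h \<in> dir_space"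
  shows "energy (\<lambda>z. c * f z) h = c * energy f h"
proof -
  note H = dir_space_imp_hardy2
  have "energy (\<lambda>z. c * f z) h = (\<integral>p. c * (\<rho> (fst p) *\<^sub>R diff_quot_prod f h (fst p) (snd p)) \<partial>(\<m> \<Otimes>\<^sub>M \<m>))"
    unfolding energy_def
  proof (rule integral_cong_AE)
    show "AE p in \<m> \<Otimes>\<^sub>M \<m>. \<rho> (fst p) *\<^sub>R diff_quot_prod (\<lambda>z. c * f z) h (fst p) (snd p) =
        c * (\<rho> (fst p) *\<^sub>R diff_quot_prod f h (fst p) (snd p))"
      using AE_circle_pair[OF AE_boundary_value_cmult[OF H[OF f], of c]]
      by eventually_elim (simp add: diff_quot_prod_def algebra_simps)
  qed (intro borel_measurable_times borel_measurable_const energy_integrand_measurable dir_space_cmult H f h)+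
  also have "\<dots> = c * energy f h" unfolding energy_def by (rule integral_mult_right_zero)
  finally show ?thesis .
qed

lemma energy_cnj: "energy g f = cnj (energy f g)"
proof -
  have "energy g f = (\<integral>p. cnj (\<rho> (fst p) *\<^sub>R diff_quot_prod f g (fst p) (snd p)) \<partial>(\<m> \<Otimes>\<^sub>M \<m>))"
    unfolding energy_def by (intro Bochner_Integration.integral_cong refl) (simp add: diff_quot_prod_def mult.commute)
  then show ?thesis unfolding energy_def by (simp only: Bochner_Integration.integral_cnj)
qed

text \<open>Moving constants and the density through Bochner integrals is a matter of measurability,
  so the identity holds on the whole Hardy space, with the default value 0 for divergent integrals
  on both sides.\<close>

lemma dirichlet_inner_density_iterated:
  assumes f: "f \<in> hardy2" and g: "g \<in> hardy2"
  shows "dirichlet_inner (density \<m> (\<lambda>\<xi>. ennreal (\<rho> \<xi>))) f g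
    = (\<Sum>n. taylor_coeff f n * cnj (taylor_coeff g n)) +
      (\<integral>\<xi>. \<rho> \<xi> *\<^sub>R (\<integral>\<zeta>. diff_quot_prod f g \<xi> \<zeta> \<partial>\<m>) \<partial>\<m>)"
proof -
  let ?D = "density \<m> (\<lambda>\<xi>. ennreal (\<rho> \<xi>))"
  have m: "(\<lambda>\<xi>. \<integral>\<zeta>. diff_quot_prod f g \<xi> \<zeta> \<partial>\<m>) \<in> borel_measurable \<m>"
    by (rule arc.borel_measurable_lebesgue_integral)
       (use diff_quot_prod_measurable_pair[OF f g] in \<open>simp add: case_prod_beta'\<close>)
  have "(\<integral>\<xi>. (\<integral>\<zeta>. diff_quot_prod f g \<xi> \<zeta> \<partial>arc_length) \<partial>?D)
     = (\<integral>\<xi>. of_real (2 * pi) * (\<integral>\<zeta>. diff_quot_prod f g \<xi> \<zeta> \<partial>\<m>) \<partial>?D)"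
    by (intro Bochner_Integration.integral_cong refl integral_arc_length diff_quot_prod_measurable f g) (simp add: space_density)
  also have "\<dots> = of_real (2 * pi) * (\<integral>\<xi>. (\<integral>\<zeta>. diff_quot_prod f g \<xi> \<zeta> \<partial>\<m>) \<partial>?D)"
    by (rule integral_mult_right_zero)
  also have "(\<integral>\<xi>. (\<integral>\<zeta>. diff_quot_prod f g \<xi> \<zeta> \<partial>\<m>) \<partial>?D)
     = (\<integral>\<xi>. \<rho> \<xi> *\<^sub>R (\<integral>\<zeta>. diff_quot_prod f g \<xi> \<zeta> \<partial>\<m>) \<partial>\<m>)"
    by (rule integral_density[OF m \<rho>_meas AE_I2]) (use \<rho>_nonneg in auto)
  finally show ?thesis unfolding dirichlet_inner_def diff_quot_prod_def[symmetric] by simp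
qed

lemma dirichlet_inner_density:
  assumes f: "f \<in> dir_space" and g: "g \<in> dir_space"
  shows "dirichlet_inner (density \<m> (\<lambda>\<xi>. ennreal (\<rho> \<xi>))) f g
    = (\<Sum>n. taylor_coeff f n * cnj (taylor_coeff g n)) + energy f g"
proof -
  interpret P: pair_sigma_finite \<m> \<m> ..
  have "(\<integral>\<xi>. \<rho> \<xi> *\<^sub>R (\<integral>\<zeta>. diff_quot_prod f g \<xi> \<zeta> \<partial>\<m>) \<partial>\<m>)
     = (\<integral>\<xi>. (\<integral>\<zeta>. \<rho> \<xi> *\<^sub>R diff_quot_prod f g \<xi> \<zeta> \<partial>\<m>) \<partial>\<m>)"
    by simp
  also have "\<dots> = energy f g"
    unfolding energy_def using P.integral_fst'[OF energy_integrable[OF f g]] by simp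
  finally show ?thesis using dirichlet_inner_density_iterated[OF f[THEN dir_space_imp_hardy2] g[THEN dir_space_imp_hardy2]] by simp
qed

text \<open>With \<zeta> = \<xi> \<eta> the two difference quotients become geometric sums with j
  and k terms, which share min j k monomials.\<close>

lemma inner_integral_monomials:
  assumes \<xi>: "norm \<xi> = 1"
  shows "(\<integral>\<zeta>. diff_quot_prod (\<lambda>z. z ^ j) (\<lambda>z. z ^ k) \<xi> \<zeta> \<partial>\<m>) = of_nat (min j k) * (\<xi> ^ j * cnj (\<xi> ^ k))"
proof -
  have bv: "boundary_value (\<lambda>z. z ^ i) \<zeta> = \<zeta> ^ i" if "norm \<zeta> = 1" for i \<zeta>
    by (intro boundary_value_continuous that continuous_intros)
  have h: "(\<lambda>z. z ^ i) \<in> hardy2" for i by (intro dir_space_imp_hardy2 dir_space_power)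
  have "(\<integral>\<zeta>. diff_quot_prod (\<lambda>z. z ^ j) (\<lambda>z. z ^ k) \<xi> \<zeta> \<partial>\<m>)
     = (\<integral>\<eta>. diff_quot_prod (\<lambda>z. z ^ j) (\<lambda>z. z ^ k) \<xi> (\<xi> * \<eta>) \<partial>\<m>)"
    by (rule integral_rotate[symmetric, OF diff_quot_prod_measurable \<xi>]) (use h \<xi> in auto)
  also have "\<dots> = (\<integral>\<eta>. (\<xi> ^ j * cnj (\<xi> ^ k)) * ((\<Sum>a<j. 1 * \<eta> ^ a) * cnj (\<Sum>a<k. 1 * \<eta> ^ a)) \<partial>\<m>)"
  proof (rule integral_cong_AE)
    show "AE \<eta> in \<m>. diff_quot_prod (\<lambda>z. z ^ j) (\<lambda>z. z ^ k) \<xi> (\<xi> * \<eta>)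
        = (\<xi> ^ j * cnj (\<xi> ^ k)) * ((\<Sum>a<j. 1 * \<eta> ^ a) * cnj (\<Sum>a<k. 1 * \<eta> ^ a))"
      using AE_circle_neq_one AE_space
    proof eventually_elim
      case (elim \<eta>)
      have "\<xi> * \<eta> - \<xi> = \<xi> * (\<eta> - 1)" by (simp add: algebra_simps)
      then have n: "complex_of_real ((norm (\<xi> * \<eta> - \<xi>))\<^sup>2) = (\<eta> - 1) * cnj (\<eta> - 1)"
      proof -
        have "norm (\<xi> * \<eta> - \<xi>) = norm (\<eta> - 1)" using \<open>\<xi> * \<eta> - \<xi> = \<xi> * (\<eta> - 1)\<close> \<xi> by (simp only: norm_mult mult_1)
        then show ?thesis by (simp only: complex_norm_square)
      qed
      have d: "(\<xi> * \<eta>) ^ i - \<xi> ^ i = \<xi> ^ i * ((\<eta> - 1) * (\<Sum>a<i. \<eta> ^ a))" for i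
        unfolding power_diff_1_eq[symmetric] by (simp add: power_mult_distrib algebra_simps)
      have nz: "\<eta> - 1 \<noteq> 0" "cnj (\<eta> - 1) \<noteq> 0" using elim by auto
      have "diff_quot_prod (\<lambda>z. z ^ j) (\<lambda>z. z ^ k) \<xi> (\<xi> * \<eta>)
         = (\<xi> ^ j * ((\<eta> - 1) * (\<Sum>a<j. \<eta> ^ a))) * cnj (\<xi> ^ k * ((\<eta> - 1) * (\<Sum>a<k. \<eta> ^ a))) / ((\<eta> - 1) * cnj (\<eta> - 1))"
        unfolding diff_quot_prod_def n using elim \<xi> by (simp only: bv norm_mult d mult_1 space_norm_arc_length sphere_def mem_Collect_eq) (simp add: bv norm_mult d)
      also have "\<dots> = (\<xi> ^ j * cnj (\<xi> ^ k)) * ((\<Sum>a<j. 1 * \<eta> ^ a) * cnj (\<Sum>a<k. 1 * \<eta> ^ a))"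
        using nz unfolding complex_cnj_mult by (simp only: mult_1) (simp add: field_simps del: complex_cnj_diff)
      finally show ?case .
    qed
    show "(\<lambda>\<eta>. diff_quot_prod (\<lambda>z. z ^ j) (\<lambda>z. z ^ k) \<xi> (\<xi> * \<eta>)) \<in> borel_measurable \<m>"
      by (rule measurable_compose[OF mult_measurable_circle[OF \<xi>] diff_quot_prod_measurable]) (use h \<xi> in auto)
  qed (intro continuous_circle_measurable continuous_intros)
  also have "\<dots> = (\<xi> ^ j * cnj (\<xi> ^ k)) * (\<integral>\<eta>. ((\<Sum>a<j. 1 * \<eta> ^ a) * cnj (\<Sum>a<k. 1 * \<eta> ^ a)) \<partial>\<m>)"
    by (rule integral_mult_right_zero)
  also have "\<dots> = of_nat (min j k) * (\<xi> ^ j * cnj (\<xi> ^ k))"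
    unfolding parseval_finite by simp
  finally show ?thesis .
qed

lemma dirichlet_inner_monomials:
  "dirichlet_inner (density \<m> (\<lambda>\<xi>. ennreal (\<rho> \<xi>))) (\<lambda>z. z ^ j) (\<lambda>z. z ^ k)
    = (if j = k then 1 else 0) + of_nat (min j k) * (\<integral>\<xi>. \<rho> \<xi> *\<^sub>R (\<xi> ^ j * cnj (\<xi> ^ k)) \<partial>\<m>)"
proof -
  have h: "(\<lambda>z. z ^ i) \<in> hardy2" for i by (intro dir_space_imp_hardy2 dir_space_power)
  have s: "(\<Sum>n. taylor_coeff (\<lambda>z. z ^ j) n * cnj (taylor_coeff (\<lambda>z. z ^ k) n)) = (if j = k then 1 else 0)"
    unfolding taylor_coeff_power by (subst suminf_finite[of "{j}"]) auto
  have "(\<integral>\<xi>. \<rho> \<xi> *\<^sub>R (\<integral>\<zeta>. diff_quot_prod (\<lambda>z. z ^ j) (\<lambda>z. z ^ k) \<xi> \<zeta> \<partial>\<m>) \<partial>\<m>)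
     = (\<integral>\<xi>. of_nat (min j k) * (\<rho> \<xi> *\<^sub>R (\<xi> ^ j * cnj (\<xi> ^ k))) \<partial>\<m>)"
    by (intro Bochner_Integration.integral_cong refl) (simp add: inner_integral_monomials)
  also have "\<dots> = of_nat (min j k) * (\<integral>\<xi>. \<rho> \<xi> *\<^sub>R (\<xi> ^ j * cnj (\<xi> ^ k)) \<partial>\<m>)"
    by (rule integral_mult_right_zero)
  finally show ?thesis unfolding dirichlet_inner_density_iterated[OF h h] s by simp
qed

text \<open>The Dirichlet part is an iterated Bochner integral of nonnegative functions, hence
  nonnegative, also where the default value 0 applies.\<close>

lemma dirichlet_inner_self_ge:
  assumes f: "f \<in> hardy2"
  shows "\<exists>x\<ge>0. dirichlet_inner (density \<m> (\<lambda>\<xi>. ennreal (\<rho> \<xi>))) f f = of_real (hardy_norm2 f + x)"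
proof -
  have sq: "a * cnj a / of_real (c::real) = of_real ((norm a)\<^sup>2 / c)" for a c
    by (simp add: complex_norm_square[symmetric])
  let ?x = "\<integral>\<xi>. \<rho> \<xi> * (\<integral>\<zeta>. (norm (boundary_value f \<zeta> - boundary_value f \<xi>))\<^sup>2 / (norm (\<zeta> - \<xi>))\<^sup>2 \<partial>\<m>) \<partial>\<m>"
  have "(\<integral>\<xi>. \<rho> \<xi> *\<^sub>R (\<integral>\<zeta>. diff_quot_prod f f \<xi> \<zeta> \<partial>\<m>) \<partial>\<m>) = of_real ?x"
    unfolding diff_quot_prod_def sq integral_complex_of_real scaleR_conv_of_real of_real_mult[symmetric] ..
  moreover have "0 \<le> ?x"
    by (intro integral_nonneg_AE AE_I2 mult_nonneg_nonneg) (use \<rho>_nonneg in auto)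
  moreover have "(\<Sum>n. taylor_coeff f n * cnj (taylor_coeff f n)) = of_real (hardy_norm2 f)"
    unfolding hardy_norm2_def complex_norm_square[symmetric]
    by (rule suminf_of_real[OF hardy2_summable[OF f], symmetric])
  ultimately show ?thesis unfolding dirichlet_inner_density_iterated[OF f f] by (intro exI[of _ ?x]) simp
qed

end

subsection \<open>Multiplication by a function orthogonal to its shifts\<close>

lemma taylor_abs_summable:
  assumes G: "G holomorphic_on ball 0 R" "R > 1"
  shows "summable (\<lambda>n. norm (taylor_coeff G n))"
    and "norm \<zeta> = 1 \<Longrightarrow> G \<zeta> = (\<Sum>n. taylor_coeff G n * \<zeta> ^ n)"
proof -
  have s: "(\<lambda>n. taylor_coeff G n * w ^ n) sums G w" if "norm w < R" for w
    using holomorphic_power_series[OF G(1), of w] that by (simp add: taylor_coeff_def)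
  obtain \<rho> where \<rho>: "1 < \<rho>" "\<rho> < R" using G(2) dense by blast
  have "summable (\<lambda>n. taylor_coeff G n * of_real \<rho> ^ n)"
    using s[of "of_real \<rho>"] \<rho> by (auto simp: sums_iff)
  from powser_insidea[OF this, of 1] \<rho> show "summable (\<lambda>n. norm (taylor_coeff G n))" by simp
  show "G \<zeta> = (\<Sum>n. taylor_coeff G n * \<zeta> ^ n)" if "norm \<zeta> = 1"
    using s[of \<zeta>] that G(2) by (simp add: sums_iff)
qed

definition hardy_inner :: "(complex \<Rightarrow> complex) \<Rightarrow> (complex \<Rightarrow> complex) \<Rightarrow> complex" where
  "hardy_inner f g = (\<Sum>n. taylor_coeff f n * cnj (taylor_coeff g n))"

lemma hardy_inner_add_left:
  "f \<in> dir_space \<Longrightarrow> g \<in> dir_space \<Longrightarrow> h \<in> dir_space \<Longrightarrow> hardy_inner (\<lambda>z. f z + g z) h = hardy_inner f h + hardy_inner g h"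
  unfolding hardy_inner_def using suminf_add[OF summable_hardy_inner summable_hardy_inner, of f h g h]
  by (simp add: taylor_coeff_add dir_space_holo dir_space_imp_hardy2 algebra_simps)

lemma hardy_inner_cmult_left: "f \<in> dir_space \<Longrightarrow> g \<in> dir_space \<Longrightarrow> hardy_inner (\<lambda>z. c * f z) g = c * hardy_inner f g"
  unfolding hardy_inner_def using suminf_mult[OF summable_hardy_inner, of f g c]
  by (simp add: taylor_coeff_cmult dir_space_holo dir_space_imp_hardy2 mult.assoc)

lemma hardy_inner_cnj: "f \<in> dir_space \<Longrightarrow> g \<in> dir_space \<Longrightarrow> hardy_inner g f = cnj (hardy_inner f g)"
  unfolding hardy_inner_def
  using bounded_linear.suminf[OF bounded_linear_cnj summable_hardy_inner[of f g]]
  by (simp add: mult.commute dir_space_imp_hardy2)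

lemma norm_hardy_inner_le:
  assumes "f \<in> dir_space" "g \<in> dir_space"
  shows "norm (hardy_inner f g) \<le> (dir_norm2 f + dir_norm2 g) / 2"
proof -
  have "norm (hardy_inner f g) \<le> (hardy_norm2 f + hardy_norm2 g) / 2"
    using norm_suminf_weighted_mult_cnj_le[of "\<lambda>_. 1" "taylor_coeff f" "taylor_coeff g"] assms[THEN dir_space_imp_hardy2]
    by (simp add: hardy_inner_def hardy_norm2_def hardy2_def)
  also have "\<dots> \<le> (dir_norm2 f + dir_norm2 g) / 2"
    using assms[THEN hardy_norm2_le_dir_norm2] by simp
  finally show ?thesis .
qed

text \<open>The orthogonality alone makes multiplication by \<open>\<Phi>\<close> isometric from the space with weight
  \<open>|\<Phi>|\<^sup>2\<close> into the Dirichlet space, since both inner products gain the same term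
  \<open>\<integral> f cnj g |\<Phi>|\<^sup>2 d\<m>\<close> when \<open>f\<close> and \<open>g\<close> are multiplied by \<open>z\<close>.\<close>

locale extremal_extension =
  fixes \<Phi> :: "complex \<Rightarrow> complex" and R :: real
  assumes holo: "\<Phi> holomorphic_on ball 0 R" and R: "R > 1"
    and norm_one: "dir_norm2 \<Phi> = 1"
    and orth: "\<And>k. dir_inner \<Phi> (\<lambda>z. z ^ Suc k * \<Phi> z) = 0"
begin

definition \<mu> :: "complex measure" where
  "\<mu> = density \<m> (\<lambda>\<zeta>. ennreal ((norm (\<Phi> \<zeta>))\<^sup>2))"

lemma cont_circle: "continuous_on unit_circle \<Phi>"
  by (rule holomorphic_on_imp_continuous_on, rule holomorphic_on_subset[OF holo]) (use R in auto)

lemma mult_dir_space: "f \<in> dir_space \<Longrightarrow> (\<lambda>z. \<Phi> z * f z) \<in> dir_space"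
  using dir_space_mult_holomorphic[OF holo R] by blast

lemma bounded_density_ex: "\<exists>C. bounded_density (\<lambda>\<zeta>. (norm (\<Phi> \<zeta>))\<^sup>2) C"
proof -
  have "\<exists>C\<ge>0. \<forall>z. norm z \<le> 1 \<longrightarrow> norm (\<Phi> z) \<le> C"
    by (rule holomorphic_bounded_lipschitz[OF holo R]) auto
  then obtain C where C: "0 \<le> C" "\<And>z. norm z \<le> 1 \<Longrightarrow> norm (\<Phi> z) \<le> C" by blast
  have "bounded_density (\<lambda>\<zeta>. (norm (\<Phi> \<zeta>))\<^sup>2) (C\<^sup>2)"
    by standard (auto intro!: continuous_circle_measurable continuous_intros cont_circle power_mono C)
  then show ?thesis ..
qed

lemma \<Phi>_dir_space: "\<Phi> \<in> dir_space"
  using mult_dir_space[OF dir_space_power[of 0]] by simp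

lemma power_\<Phi>_dir_space: "(\<lambda>z. z ^ j * \<Phi> z) \<in> dir_space"
  by (rule dir_space_power_mult[OF \<Phi>_dir_space])

lemma hardy_inner_power:
  "hardy_inner (\<lambda>z. z ^ j * \<Phi> z) (\<lambda>z. z ^ k * \<Phi> z)
     = (\<integral>\<zeta>. (norm (\<Phi> \<zeta>))\<^sup>2 *\<^sub>R (\<zeta> ^ j * cnj (\<zeta> ^ k)) \<partial>\<m>)"
proof -
  have h: "(\<lambda>z. z ^ i * \<Phi> z) holomorphic_on ball 0 R" for i by (intro holomorphic_intros holo)
  have "hardy_inner (\<lambda>z. z ^ j * \<Phi> z) (\<lambda>z. z ^ k * \<Phi> z)
     = (\<integral>\<zeta>. (\<zeta> ^ j * \<Phi> \<zeta>) * cnj (\<zeta> ^ k * \<Phi> \<zeta>) \<partial>\<m>)"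
    unfolding hardy_inner_def
    by (rule sums_unique[symmetric], rule parseval_abs_summable) (use taylor_abs_summable[OF h R] in auto)
  also have "\<dots> = (\<integral>\<zeta>. (norm (\<Phi> \<zeta>))\<^sup>2 *\<^sub>R (\<zeta> ^ j * cnj (\<zeta> ^ k)) \<partial>\<m>)"
    by (intro Bochner_Integration.integral_cong refl)
       (simp add: scaleR_conv_of_real complex_norm_square del: of_real_power)
  finally show ?thesis .
qed

text \<open>On the circle a simultaneous shift contributes only |\<zeta>|^2 = 1: the Hardy Gram
  matrix is a Toeplitz matrix.\<close>

lemma hardy_inner_power_Suc:
  "hardy_inner (\<lambda>z. z ^ Suc j * \<Phi> z) (\<lambda>z. z ^ Suc k * \<Phi> z) = hardy_inner (\<lambda>z. z ^ j * \<Phi> z) (\<lambda>z. z ^ k * \<Phi> z)"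
  unfolding hardy_inner_power
proof (intro Bochner_Integration.integral_cong refl)
  fix \<zeta> assume "\<zeta> \<in> space \<m>"
  then have "\<zeta> * cnj \<zeta> = 1" by (simp add: complex_norm_square[symmetric])
  then have "\<zeta> ^ Suc j * cnj (\<zeta> ^ Suc k) = \<zeta> ^ j * cnj (\<zeta> ^ k)"
    by (simp add: mult.commute mult.left_commute)
  then show "(norm (\<Phi> \<zeta>))\<^sup>2 *\<^sub>R (\<zeta> ^ Suc j * cnj (\<zeta> ^ Suc k)) = (norm (\<Phi> \<zeta>))\<^sup>2 *\<^sub>R (\<zeta> ^ j * cnj (\<zeta> ^ k))" by simp
qed

text \<open>Each simultaneous shift adds the Hardy inner product, which is itself invariant under
  it. Undoing min j k shifts makes one exponent 0, where normalization and orthogonality leave the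
  Kronecker delta.\<close>

lemma dir_inner_power:
  "dir_inner (\<lambda>z. z ^ j * \<Phi> z) (\<lambda>z. z ^ k * \<Phi> z)
     = (if j = k then 1 else 0) + of_nat (min j k) * hardy_inner (\<lambda>z. z ^ j * \<Phi> z) (\<lambda>z. z ^ k * \<Phi> z)"
proof (induction j arbitrary: k)
  case 0
  then show ?case using orth dir_inner_self[OF \<Phi>_dir_space] norm_one by (cases k) auto
next
  case (Suc j)
  show ?case
  proof (cases k)
    case 0
    then show ?thesis using dir_inner_cnj[OF \<Phi>_dir_space power_\<Phi>_dir_space[of "Suc j"]] orth by simp
  next
    case k: (Suc k')
    have "dir_inner (\<lambda>z. z ^ Suc j * \<Phi> z) (\<lambda>z. z ^ k * \<Phi> z)
       = dir_inner (\<lambda>z. z * (z ^ j * \<Phi> z)) (\<lambda>z. z * (z ^ k' * \<Phi> z))"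
      by (simp add: k mult.assoc)
    also have "\<dots> = dir_inner (\<lambda>z. z ^ j * \<Phi> z) (\<lambda>z. z ^ k' * \<Phi> z) + hardy_inner (\<lambda>z. z ^ j * \<Phi> z) (\<lambda>z. z ^ k' * \<Phi> z)"
      unfolding hardy_inner_def by (rule dir_inner_shift[OF power_\<Phi>_dir_space power_\<Phi>_dir_space])
    finally show ?thesis
      unfolding Suc.IH k hardy_inner_power_Suc by (simp add: algebra_simps del: power_Suc)
  qed
qed

text \<open>By \<open>dir_inner_power\<close> and \<open>dirichlet_inner_monomials\<close> both
  sides have the same Gram matrix on the monomials, built from the moments of |\<Phi>|^2. Both are
  bounded forms on \<open>dir_space\<close>, so they agree everywhere.\<close>

theorem isometry:
  assumes f: "f \<in> dir_space" and g: "g \<in> dir_space"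
  shows "dirichlet_inner \<mu> f g = dir_inner (\<lambda>z. \<Phi> z * f z) (\<lambda>z. \<Phi> z * g z)"
proof -
  obtain C where "bounded_density (\<lambda>\<zeta>. (norm (\<Phi> \<zeta>))\<^sup>2) C" using bounded_density_ex by blast
  then interpret d: bounded_density "\<lambda>\<zeta>. (norm (\<Phi> \<zeta>))\<^sup>2" C .
  have "\<exists>K\<ge>0. \<forall>f\<in>dir_space. dir_norm2 (\<lambda>z. \<Phi> z * f z) \<le> K * dir_norm2 f"
    by (rule dir_space_mult_holomorphic[OF holo R]) auto
  then obtain K where K: "K \<ge> 0" "\<And>f. f \<in> dir_space \<Longrightarrow> dir_norm2 (\<lambda>z. \<Phi> z * f z) \<le> K * dir_norm2 f" by blast
  define Q where "Q f g = hardy_inner f g + d.energy f g - dir_inner (\<lambda>z. \<Phi> z * f z) (\<lambda>z. \<Phi> z * g z)" for f g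
  have inner: "dirichlet_inner \<mu> f g = hardy_inner f g + d.energy f g" if "f \<in> dir_space" "g \<in> dir_space" for f g
    unfolding \<mu>_def hardy_inner_def by (rule d.dirichlet_inner_density[OF that])
  have "Q f g = 0"
  proof (rule sesquilinear_eq_zero[OF _ _ _ _ _ _ f g])
    fix f g h :: "complex \<Rightarrow> complex" assume fgh: "f \<in> dir_space" "g \<in> dir_space" "h \<in> dir_space"
    have "dir_inner (\<lambda>z. \<Phi> z * (f z + g z)) (\<lambda>z. \<Phi> z * h z) = dir_inner (\<lambda>z. \<Phi> z * f z) (\<lambda>z. \<Phi> z * h z) + dir_inner (\<lambda>z. \<Phi> z * g z) (\<lambda>z. \<Phi> z * h z)"
      unfolding distrib_left by (intro dir_inner_add_left mult_dir_space fgh)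
    then show "Q (\<lambda>z. f z + g z) h = Q f h + Q g h"
      unfolding Q_def by (simp add: hardy_inner_add_left d.energy_add fgh)
  next
    fix c :: complex and f g :: "complex \<Rightarrow> complex" assume fg: "f \<in> dir_space" "g \<in> dir_space"
    have "dir_inner (\<lambda>z. \<Phi> z * (c * f z)) (\<lambda>z. \<Phi> z * g z) = c * dir_inner (\<lambda>z. \<Phi> z * f z) (\<lambda>z. \<Phi> z * g z)"
      unfolding mult.left_commute[of _ c] by (intro dir_inner_cmult_left mult_dir_space fg)
    then show "Q (\<lambda>z. c * f z) g = c * Q f g"
      unfolding Q_def by (simp add: hardy_inner_cmult_left d.energy_cmult fg algebra_simps)
  next
    fix f g :: "complex \<Rightarrow> complex" assume fg: "f \<in> dir_space" "g \<in> dir_space"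
    show "Q g f = cnj (Q f g)"
      unfolding Q_def using hardy_inner_cnj[OF fg] d.energy_cnj[of g f] dir_inner_cnj[OF mult_dir_space[OF fg(1)] mult_dir_space[OF fg(2)]]
      by simp
    have "norm (Q f g) \<le> norm (hardy_inner f g) + norm (d.energy f g) + norm (dir_inner (\<lambda>z. \<Phi> z * f z) (\<lambda>z. \<Phi> z * g z))"
      unfolding Q_def by (intro order_trans[OF norm_triangle_ineq4] add_mono norm_triangle_ineq order_refl)
    also have "\<dots> \<le> (dir_norm2 f + dir_norm2 g) / 2 + C * (dir_norm2 f + dir_norm2 g) + (dir_norm2 (\<lambda>z. \<Phi> z * f z) + dir_norm2 (\<lambda>z. \<Phi> z * g z)) / 2"
      by (intro add_mono norm_hardy_inner_le d.norm_energy_le norm_dir_inner_le mult_dir_space fg)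
    also have "\<dots> \<le> (dir_norm2 f + dir_norm2 g) / 2 + C * (dir_norm2 f + dir_norm2 g) + (K * dir_norm2 f + K * dir_norm2 g) / 2"
      by (intro add_mono divide_right_mono K fg order_refl) auto
    also have "\<dots> = (1 / 2 + C + K / 2) * (dir_norm2 f + dir_norm2 g)" by (simp add: algebra_simps add_divide_distrib)
    finally show "norm (Q f g) \<le> (1 / 2 + C + K / 2) * (dir_norm2 f + dir_norm2 g)" .
  next
    show "0 \<le> 1 / 2 + C + K / 2" using d.C_nonneg K by simp
  next
    fix j k
    have "hardy_inner (\<lambda>z. z ^ j) (\<lambda>z. z ^ k) + d.energy (\<lambda>z. z ^ j) (\<lambda>z. z ^ k)
       = dirichlet_inner \<mu> (\<lambda>z. z ^ j) (\<lambda>z. z ^ k)"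
      by (rule inner[OF dir_space_power dir_space_power, symmetric])
    also have "\<dots> = dir_inner (\<lambda>z. z ^ j * \<Phi> z) (\<lambda>z. z ^ k * \<Phi> z)"
      unfolding \<mu>_def d.dirichlet_inner_monomials dir_inner_power hardy_inner_power ..
    finally show "Q (\<lambda>z. z ^ j) (\<lambda>z. z ^ k) = 0" unfolding Q_def by (simp add: mult.commute)
  qed
  then show ?thesis unfolding inner[OF f g] Q_def by simp
qed

text \<open>The squared norm with weight |\<Phi>|^2 is the Hardy part plus a nonnegative energy; the
  isometry rewrites it as the squared norm of the product.\<close>

lemma hardy_norm2_le_mult:
  assumes f: "f \<in> dir_space"
  shows "hardy_norm2 f \<le> dir_norm2 (\<lambda>z. \<Phi> z * f z)"
proof -
  obtain C where "bounded_density (\<lambda>\<zeta>. (norm (\<Phi> \<zeta>))\<^sup>2) C" using bounded_density_ex by blast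
  then interpret d: bounded_density "\<lambda>\<zeta>. (norm (\<Phi> \<zeta>))\<^sup>2" C .
  obtain x where x: "x \<ge> 0" "dirichlet_inner \<mu> f f = of_real (hardy_norm2 f + x)"
    unfolding \<mu>_def using d.dirichlet_inner_self_ge[OF dir_space_imp_hardy2[OF f]] by blast
  have "complex_of_real (hardy_norm2 f + x) = of_real (dir_norm2 (\<lambda>z. \<Phi> z * f z))"
    using isometry[OF f f] dir_inner_self[OF mult_dir_space[OF f]] x by simp
  then show ?thesis using x by (simp only: of_real_eq_iff)
qed

lemma norm_at_0_le_mult:
  assumes f: "f \<in> dir_space"
  shows "(norm (f 0))\<^sup>2 \<le> dir_norm2 (\<lambda>z. \<Phi> z * f z)"
proof -
  have "(norm (taylor_coeff f 0))\<^sup>2 \<le> hardy_norm2 f"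
    unfolding hardy_norm2_def
    using sum_le_suminf[OF hardy2_summable[OF dir_space_imp_hardy2[OF f]], of "{0}"] by simp
  then show ?thesis using hardy_norm2_le_mult[OF f] by (simp add: taylor_coeff_0)
qed

text \<open>Increments of a constant vanish, so only the zeroth coefficient is left: the constant 1
  is the kernel at 0, whatever the weight.\<close>

lemma dirichlet_inner_one_right:
  assumes f: "f \<in> dir_space"
  shows "dirichlet_inner \<mu> f (\<lambda>z. 1) = f 0"
proof -
  have b: "boundary_value (\<lambda>z. 1) \<zeta> = 1" for \<zeta> :: complex by (rule boundary_value_eqI) simp
  have "(\<Sum>n. taylor_coeff f n * cnj (taylor_coeff (\<lambda>z. 1) n)) = f 0"
    unfolding taylor_coeff_one by (subst suminf_finite[of "{0}"]) (auto simp: taylor_coeff_0)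
  then show ?thesis unfolding dirichlet_inner_def b by simp
qed

text \<open>On the compact circle the weight lies between two positive constants, so the weighted
  and the unweighted Dirichlet integral are finite together.\<close>

lemma dirichlet_space_eq:
  assumes nz: "\<And>\<zeta>. norm \<zeta> = 1 \<Longrightarrow> \<Phi> \<zeta> \<noteq> 0"
  shows "dirichlet_space \<mu> = dir_space"
proof -
  obtain C where "bounded_density (\<lambda>\<zeta>. (norm (\<Phi> \<zeta>))\<^sup>2) C" using bounded_density_ex by blast
  then interpret d: bounded_density "\<lambda>\<zeta>. (norm (\<Phi> \<zeta>))\<^sup>2" C .
  have "\<exists>x\<in>unit_circle. \<forall>y\<in>unit_circle. (norm (\<Phi> x))\<^sup>2 \<le> (norm (\<Phi> y))\<^sup>2"
    by (rule continuous_attains_inf) (auto intro!: continuous_intros cont_circle)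
  then obtain x where x: "norm x = 1" "\<And>y. norm y = 1 \<Longrightarrow> (norm (\<Phi> x))\<^sup>2 \<le> (norm (\<Phi> y))\<^sup>2" by auto
  define c where "c = (norm (\<Phi> x))\<^sup>2"
  have c: "c > 0" using nz[OF x(1)] by (simp add: c_def)
  have \<rho>m: "(\<lambda>\<zeta>. ennreal ((norm (\<Phi> \<zeta>))\<^sup>2)) \<in> borel_measurable \<m>"
    using d.\<rho>_meas by measurable
  have "dirichlet_integral \<mu> f < \<infinity> \<longleftrightarrow> dirichlet_integral \<m> f < \<infinity>" if f: "f \<in> hardy2" for f
  proof -
    let ?I = "\<lambda>\<xi>. \<integral>\<^sup>+\<zeta>. diff_quot2 f \<xi> \<zeta> \<partial>\<m>"
    note m = inner_diff_quot2_measurable[OF f]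
    have DI: "dirichlet_integral \<mu> f = (\<integral>\<^sup>+\<xi>. ennreal ((norm (\<Phi> \<xi>))\<^sup>2) * ?I \<xi> \<partial>\<m>)"
      unfolding \<mu>_def by (rule dirichlet_integral_density[OF f \<rho>m])
    have const: "(\<integral>\<^sup>+\<xi>. ennreal a * ?I \<xi> \<partial>\<m>) = ennreal a * dirichlet_integral \<m> f" for a
      unfolding dirichlet_integral_arc[OF f] by (rule nn_integral_cmult[OF m])
    have "dirichlet_integral \<mu> f \<le> (\<integral>\<^sup>+\<xi>. ennreal C * ?I \<xi> \<partial>\<m>)"
      unfolding DI using d.\<rho>_le by (intro nn_integral_mono mult_right_mono ennreal_leI) auto
    then have up: "dirichlet_integral \<mu> f \<le> ennreal C * dirichlet_integral \<m> f" unfolding const .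
    have "(\<integral>\<^sup>+\<xi>. ennreal c * ?I \<xi> \<partial>\<m>) \<le> dirichlet_integral \<mu> f"
      unfolding DI c_def using x(2) by (intro nn_integral_mono mult_right_mono ennreal_leI) auto
    then have lo: "ennreal c * dirichlet_integral \<m> f \<le> dirichlet_integral \<mu> f" unfolding const .
    show ?thesis
    proof
      assume "dirichlet_integral \<mu> f < \<infinity>"
      then have "ennreal c * dirichlet_integral \<m> f < \<infinity>" using lo by (rule le_less_trans[rotated])
      then show "dirichlet_integral \<m> f < \<infinity>" using c by (auto simp: ennreal_mult_less_top)
    next
      assume "dirichlet_integral \<m> f < \<infinity>"
      then have "ennreal C * dirichlet_integral \<m> f < \<infinity>" by (auto simp: ennreal_mult_less_top)
      then show "dirichlet_integral \<mu> f < \<infinity>" by (rule le_less_trans[OF up])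
    qed
  qed
  then show ?thesis
    unfolding dirichlet_space_eq_dir_space[symmetric] by (auto simp: dirichlet_space_def)
qed

end

text \<open>The case of the empty sequence, with extremal function 1 and measure
  \<open>\<m>\<close>. It starts the chain and makes the unweighted inner product a special case of
  the isometry.\<close>

lemma extremal_extension_one: "extremal_extension (\<lambda>z. 1) 2"
proof
  have "(\<Sum>n. real (n + 1) * (norm (taylor_coeff (\<lambda>z. 1) n))\<^sup>2) = 1"
    unfolding taylor_coeff_one by (subst suminf_finite[of "{0}"]) auto
  then show "dir_norm2 (\<lambda>z. 1) = 1" unfolding dir_norm2_def .
  show "dir_inner (\<lambda>z. 1) (\<lambda>z. z ^ Suc k * 1) = 0" for k
    using taylor_coeff_power[of "Suc k"] unfolding dir_inner_def mult_1_right taylor_coeff_one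
    by (subst suminf_finite[of "{}"]) auto
qed auto

text \<open>The polarized Douglas formula, obtained as the isometry for the multiplier 1.\<close>

lemma dirichlet_inner_arc:
  assumes "f \<in> dir_space" "g \<in> dir_space"
  shows "dirichlet_inner \<m> f g = dir_inner f g"
proof -
  interpret e: extremal_extension "\<lambda>z. 1" 2 by (rule extremal_extension_one)
  have "e.\<mu> = \<m>" by (simp add: e.\<mu>_def density_1)
  then show ?thesis using e.isometry[OF assms] by simp
qed

subsection \<open>Zeros and extremal functions of finite sequences\<close>

lemma holomorphic_ball_dir_space:
  assumes "G holomorphic_on ball 0 R" "R > 1"
  shows "G \<in> dir_space"
proof -
  have "\<forall>f\<in>dir_space. (\<lambda>z. G z * f z) \<in> dir_space"
    by (rule dir_space_mult_holomorphic[OF assms]) blast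
  from bspec[OF this dir_space_power[of 0]] show ?thesis by simp
qed

section \<open>Division by zeros with multiplicity\<close>

lemma holomorphic_divide_zero:
  assumes "open S" "f holomorphic_on S" "w \<in> S" "f w = 0"
  obtains g where "g holomorphic_on S" "\<And>x. x \<in> S \<Longrightarrow> f x = (x - w) * g x"
proof (rule that)
  show "(\<lambda>x. if x = w then deriv f w else (f x - f w) / (x - w)) holomorphic_on S"
    by (rule pole_lemma_open) (use assms in auto)
qed (use assms in auto)

context
  fixes S :: "complex set" and f g :: "complex \<Rightarrow> complex" and w :: complex
  assumes S: "open S" and g: "g holomorphic_on S" and fg: "\<And>x. x \<in> S \<Longrightarrow> f x = (x - w) * g x"
begin

text \<open>Leibniz' rule; the second derivative of the linear factor vanishes. For j = 0 the
  truncated \<open>j - 1\<close> is harmless because its coefficient is 0.\<close>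

lemma higher_deriv_linear_mult:
  "x \<in> S \<Longrightarrow> (deriv ^^ j) f x = (x - w) * (deriv ^^ j) g x + of_nat j * (deriv ^^ (j - 1)) g x"
proof (induction j arbitrary: x)
  case 0
  then show ?case by (simp add: fg)
next
  case (Suc j)
  have G: "((deriv ^^ i) g has_field_derivative (deriv ^^ Suc i) g x) (at x)" for i
    using holomorphic_derivI[OF holomorphic_higher_deriv[OF g S] S Suc.prems, of i] by simp
  have "(deriv ^^ Suc j) f x = deriv ((deriv ^^ j) f) x" by simp
  also have "\<dots> = deriv (\<lambda>x. (x - w) * (deriv ^^ j) g x + of_nat j * (deriv ^^ (j - 1)) g x) x"
    by (rule deriv_cong_ev) (use eventually_nhds_in_open[OF S Suc.prems] Suc.IH in \<open>auto elim!: eventually_mono\<close>)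
  also have "\<dots> = (x - w) * (deriv ^^ Suc j) g x + 1 * (deriv ^^ j) g x + of_nat j * (deriv ^^ Suc (j - 1)) g x"
    by (rule DERIV_imp_deriv) (rule derivative_eq_intros refl G | simp)+
  also have "\<dots> = (x - w) * (deriv ^^ Suc j) g x + of_nat (Suc j) * (deriv ^^ (Suc j - 1)) g x"
    by (cases j) (auto simp: algebra_simps)
  finally show ?case .
qed

text \<open>Away from \<open>w\<close> the linear factor is invertible, so Leibniz' rule determines
  the derivatives of g one after the other from those of f.\<close>

lemma zero_of_order_ge_linear_mult_other:
  assumes v: "v \<in> S" "v \<noteq> w"
  shows "zero_of_order_ge f v k \<longleftrightarrow> zero_of_order_ge g v k"
proof
  assume g0: "zero_of_order_ge g v k"
  show "zero_of_order_ge f v k"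
    unfolding zero_of_order_ge_def
  proof (intro allI impI)
    fix j assume "j < k"
    then show "(deriv ^^ j) f v = 0"
      using g0 unfolding higher_deriv_linear_mult[OF v(1)] zero_of_order_ge_def by simp
  qed
next
  assume f0: "zero_of_order_ge f v k"
  have "j < k \<Longrightarrow> (deriv ^^ j) g v = 0" for j
  proof (induction j rule: less_induct)
    case (less j)
    have "(deriv ^^ j) f v = 0" using f0 less.prems by (simp add: zero_of_order_ge_def)
    moreover have "of_nat j * (deriv ^^ (j - 1)) g v = 0" using less.IH[of "j - 1"] less.prems by (cases j) auto
    ultimately have "(v - w) * (deriv ^^ j) g v = 0"
      using higher_deriv_linear_mult[OF v(1), of j] by (metis add.right_neutral)
    then show ?case using v(2) by simp
  qed
  then show "zero_of_order_ge g v k" by (simp add: zero_of_order_ge_def)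
qed

text \<open>At \<open>w\<close> the first term of Leibniz' rule drops out, and the derivatives of f
  and g correspond with a shift of the order by one.\<close>

lemma zero_of_order_ge_linear_mult_same:
  assumes w: "w \<in> S"
  shows "zero_of_order_ge f w (Suc k) \<longleftrightarrow> zero_of_order_ge g w k"
proof
  assume f0: "zero_of_order_ge f w (Suc k)"
  show "zero_of_order_ge g w k"
    unfolding zero_of_order_ge_def
  proof (intro allI impI)
    fix j assume "j < k"
    then have "(deriv ^^ Suc j) f w = 0" using f0 unfolding zero_of_order_ge_def by blast
    then show "(deriv ^^ j) g w = 0" unfolding higher_deriv_linear_mult[OF w] by (simp del: of_nat_Suc)
  qed
next
  assume g0: "zero_of_order_ge g w k"
  show "zero_of_order_ge f w (Suc k)"
    unfolding zero_of_order_ge_def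
  proof (intro allI impI)
    fix j assume "j < Suc k"
    then show "(deriv ^^ j) f w = 0"
      using g0 unfolding higher_deriv_linear_mult[OF w] zero_of_order_ge_def by (cases j) auto
  qed
qed

end

lemma vanishes_on_finite_iff:
  assumes "finite I"
  shows "vanishes_on I z f \<longleftrightarrow> (\<forall>w. zero_of_order_ge f w (card {i \<in> I. z i = w}))"
proof
  assume "vanishes_on I z f"
  then show "\<forall>w. zero_of_order_ge f w (card {i \<in> I. z i = w})"
    using assms by (auto simp: vanishes_on_def)
next
  assume *: "\<forall>w. zero_of_order_ge f w (card {i \<in> I. z i = w})"
  have "zero_of_order_ge f w (card J)" if "J \<subseteq> {i \<in> I. z i = w}" for w J
    using *[rule_format, of w] card_mono[OF _ that] assms by (auto simp: zero_of_order_ge_def)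
  then show "vanishes_on I z f" by (auto simp: vanishes_on_def)
qed

lemma vanishes_on_insert:
  assumes I: "finite I" "i \<notin> I" and z: "\<And>k. k \<in> insert i I \<Longrightarrow> z k \<in> S"
    and S: "open S" and g: "g holomorphic_on S" and fg: "\<And>x. x \<in> S \<Longrightarrow> f x = (x - z i) * g x"
  shows "vanishes_on (insert i I) z f \<longleftrightarrow> vanishes_on I z g"
proof -
  have "zero_of_order_ge f w (card {k \<in> insert i I. z k = w}) \<longleftrightarrow> zero_of_order_ge g w (card {k \<in> I. z k = w})" for w
  proof (cases "w = z i")
    case True
    then have "{k \<in> insert i I. z k = w} = insert i {k \<in> I. z k = w}" by auto
    then have "card {k \<in> insert i I. z k = w} = Suc (card {k \<in> I. z k = w})" using I by simp
    then show ?thesis using zero_of_order_ge_linear_mult_same[OF S g fg] z True by simp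
  next
    case False
    then have e: "{k \<in> insert i I. z k = w} = {k \<in> I. z k = w}" by auto
    show ?thesis
    proof (cases "w \<in> S")
      case True
      then show ?thesis using zero_of_order_ge_linear_mult_other[OF S g fg] False e by simp
    next
      case False
      then have "{k \<in> I. z k = w} = {}" using z by auto
      then have c0: "card {k \<in> I. z k = w} = 0" by (simp only: card.empty)
      show ?thesis unfolding e c0 zero_of_order_ge_def by simp
    qed
  qed
  then show ?thesis using I by (simp add: vanishes_on_finite_iff)
qed

text \<open>A polynomial rather than a Blaschke product: orthogonality to its shifts is a recurrence
  of finite order for the coefficients.\<close>

definition zero_prod :: "nat set \<Rightarrow> (nat \<Rightarrow> complex) \<Rightarrow> complex \<Rightarrow> complex" where
  "zero_prod I z x = (\<Prod>i\<in>I. x - z i)"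

lemma zero_prod_holo: "zero_prod I z holomorphic_on S"
  unfolding zero_prod_def[abs_def] by (intro holomorphic_intros)

text \<open>Each index splits off one linear factor. The open set is general because the division is
  made both in the disk and in the larger ball where \<Phi> is holomorphic.\<close>

lemma vanishes_on_iff_factor:
  assumes I: "finite I" and z: "\<And>i. i \<in> I \<Longrightarrow> z i \<in> S" and S: "open S" and f: "f holomorphic_on S"
  shows "vanishes_on I z f \<longleftrightarrow> (\<exists>g. g holomorphic_on S \<and> (\<forall>x\<in>S. f x = zero_prod I z x * g x))"
  using I z f
proof (induction I arbitrary: f rule: finite_induct)
  case empty
  then show ?case by (auto simp: vanishes_on_def zero_of_order_ge_def zero_prod_def)
next
  case (insert i I)
  have zS: "\<And>k. k \<in> insert i I \<Longrightarrow> z k \<in> S" by (rule insert.prems)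
  show ?case
  proof
    assume v: "vanishes_on (insert i I) z f"
    have "{i} \<subseteq> {k \<in> insert i I. z k = z i}" by auto
    then have "zero_of_order_ge f (z i) (card {i})"
      using v unfolding vanishes_on_def by blast
    then have "f (z i) = 0" by (simp add: zero_of_order_ge_def)
    then obtain g where g: "g holomorphic_on S" "\<And>x. x \<in> S \<Longrightarrow> f x = (x - z i) * g x"
      using holomorphic_divide_zero[OF S insert.prems(2) zS[of i]] by auto
    have "vanishes_on I z g" using vanishes_on_insert[where z = z and i = i, OF insert.hyps zS S g] v by simp
    then obtain k where "k holomorphic_on S" "\<forall>x\<in>S. g x = zero_prod I z x * k x"
      using insert.IH[OF _ g(1)] zS by auto
    then show "\<exists>g. g holomorphic_on S \<and> (\<forall>x\<in>S. f x = zero_prod (insert i I) z x * g x)"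
      using g(2) insert.hyps by (intro exI[of _ k]) (auto simp: zero_prod_def mult.assoc)
  next
    assume "\<exists>g. g holomorphic_on S \<and> (\<forall>x\<in>S. f x = zero_prod (insert i I) z x * g x)"
    then obtain k where k: "k holomorphic_on S" "\<And>x. x \<in> S \<Longrightarrow> f x = zero_prod (insert i I) z x * k x" by blast
    let ?g = "\<lambda>x. zero_prod I z x * k x"
    have g: "?g holomorphic_on S" by (intro holomorphic_intros zero_prod_holo k)
    have "vanishes_on I z ?g" using insert.IH[OF _ g] zS k(1) by auto
    moreover have "f x = (x - z i) * ?g x" if "x \<in> S" for x
      using k(2)[OF that] insert.hyps by (simp add: zero_prod_def mult.assoc)
    ultimately show "vanishes_on (insert i I) z f" using vanishes_on_insert[where z = z and i = i, OF insert.hyps zS S g] by blast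
  qed
qed

lemma zero_of_order_ge_cong:
  assumes "open S" "w \<in> S" "\<And>x. x \<in> S \<Longrightarrow> f x = g x"
  shows "zero_of_order_ge f w k \<longleftrightarrow> zero_of_order_ge g w k"
proof -
  have "eventually (\<lambda>x. f x = g x) (nhds w)"
    using eventually_nhds_in_open[OF assms(1,2)] by eventually_elim (rule assms(3))
  then have "(deriv ^^ j) f w = (deriv ^^ j) g w" for j by (rule higher_deriv_cong_ev) simp
  then show ?thesis by (simp add: zero_of_order_ge_def)
qed

lemma vanishes_on_cong:
  assumes "open S" "\<And>i. i \<in> I \<Longrightarrow> z i \<in> S" "\<And>x. x \<in> S \<Longrightarrow> f x = g x"
  shows "vanishes_on I z f \<longleftrightarrow> vanishes_on I z g"
proof -
  have "zero_of_order_ge f w (card J) \<longleftrightarrow> zero_of_order_ge g w (card J)" if "J \<subseteq> {i \<in> I. z i = w}" for w J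
  proof (cases "J = {}")
    case True
    then show ?thesis by (simp add: zero_of_order_ge_def)
  next
    case False
    then have "w \<in> S" using that assms(2) by blast
    then show ?thesis using zero_of_order_ge_cong[of S w f g] assms by blast
  qed
  then show ?thesis unfolding vanishes_on_def by blast
qed

lemma dir_space_zero_prod_mult:
  assumes "finite I" "f \<in> dir_space"
  shows "(\<lambda>x. f x * zero_prod I z x) \<in> dir_space"
  using assms
proof (induction I rule: finite_induct)
  case empty
  then show ?case by (simp add: zero_prod_def)
next
  case (insert i I)
  then have h: "(\<lambda>x. f x * zero_prod I z x) \<in> dir_space" by simp
  have "(\<lambda>x. f x * zero_prod (insert i I) z x) = (\<lambda>x. x * (f x * zero_prod I z x) - z i * (f x * zero_prod I z x))"
    using insert.hyps by (auto simp: zero_prod_def algebra_simps)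
  then show ?case using dir_space_diff[OF dir_space_shift[OF h] dir_space_cmult[OF h]] by simp
qed

section \<open>Holomorphic extension of extremal functions\<close>

definition geom_decay :: "(nat \<Rightarrow> complex) \<Rightarrow> bool" where
  "geom_decay u \<longleftrightarrow> (\<exists>C r. 0 < r \<and> r < 1 \<and> (\<forall>j. norm (u j) \<le> C * r ^ j))"

text \<open>A first order recurrence with multiplier inside the disk and geometrically decaying
  inhomogeneity: its solutions decay at any rate r' < 1 above both |w| and the rate of
  \<open>v\<close>.\<close>

lemma geom_decay_recurrence:
  assumes v: "geom_decay v" and w: "norm w < 1" and u: "\<And>j. v j = u (Suc j) - w * u j"
  shows "geom_decay u"
proof -
  obtain C r where r: "0 < r" "r < 1" and C: "\<And>j. norm (v j) \<le> C * r ^ j"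
    using v unfolding geom_decay_def by blast
  obtain r' where r': "max (norm w) r < r'" "r' < 1" using w r dense[of "max (norm w) r" 1] by auto
  have C0: "0 \<le> C" using order_trans[OF norm_ge_zero C[of 0]] by simp
  \<comment> \<open>The second entry makes |w| C' + C <= r' C', which closes the induction.\<close>
  define C' where "C' = max (norm (u 0)) (C / (r' - norm w))"
  have C': "C \<le> C' * (r' - norm w)"
  proof -
    have "C = C / (r' - norm w) * (r' - norm w)" using r' by simp
    also have "\<dots> \<le> C' * (r' - norm w)" using r' by (intro mult_right_mono) (auto simp: C'_def)
    finally show ?thesis .
  qed
  have "norm (u j) \<le> C' * r' ^ j" for j
  proof (induction j)
    case 0
    then show ?case by (simp add: C'_def)
  next
    case (Suc j)
    have "u (Suc j) = w * u j + v j" using u[of j] by simp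
    then have "norm (u (Suc j)) \<le> norm w * norm (u j) + norm (v j)"
      by (metis norm_mult norm_triangle_ineq)
    also have "\<dots> \<le> norm w * (C' * r' ^ j) + C * r ^ j"
      by (intro add_mono mult_left_mono Suc C) auto
    also have "\<dots> \<le> norm w * (C' * r' ^ j) + C * r' ^ j"
      using C0 r r' by (intro add_left_mono mult_left_mono power_mono) auto
    also have "\<dots> \<le> norm w * (C' * r' ^ j) + (C' * (r' - norm w)) * r' ^ j"
      using C' r r' by (intro add_left_mono mult_right_mono) auto
    also have "\<dots> = C' * r' ^ Suc j" by (simp add: algebra_simps)
    finally show ?case .
  qed
  then show ?thesis using r r' unfolding geom_decay_def by (intro exI[of _ C'] exI[of _ r']) auto
qed

lemma geom_decay_taylor_extension:
  assumes f: "f holomorphic_on unit_disk" and d: "geom_decay (\<lambda>j. taylor_coeff f (Suc j))"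
  obtains R \<Phi> where "R > 1" "\<Phi> holomorphic_on ball 0 R" "\<And>x. norm x < 1 \<Longrightarrow> \<Phi> x = f x"
proof -
  obtain C r where r: "0 < r" "r < 1" and C: "\<And>j. norm (taylor_coeff f (Suc j)) \<le> C * r ^ j"
    using d unfolding geom_decay_def by blast
  define \<Phi> where "\<Phi> x = (\<Sum>n. taylor_coeff f n * x ^ n)" for x
  have s: "summable (\<lambda>n. taylor_coeff f n * x ^ n)" if x: "norm x < 1 / r" for x
  proof -
    have "summable (\<lambda>n. taylor_coeff f (Suc n) * x ^ Suc n)"
    proof (rule summable_comparison_test'[of _ 0])
      have "norm (r * norm x) < 1" using x r by (simp add: field_simps)
      then show "summable (\<lambda>n. C * norm x * (r * norm x) ^ n)"
        by (intro summable_mult summable_geometric)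
      show "norm (taylor_coeff f (Suc n) * x ^ Suc n) \<le> C * norm x * (r * norm x) ^ n" for n
        using mult_right_mono[OF C[of n], of "norm x ^ Suc n"]
        by (simp add: norm_mult norm_power power_mult_distrib mult_ac)
    qed
    then show ?thesis by (subst (asm) summable_Suc_iff)
  qed
  have "\<Phi> holomorphic_on ball 0 (1 / r)"
    by (rule power_series_holomorphic_ball) (use s in \<open>auto simp: \<Phi>_def intro: summable_sums\<close>)
  moreover have "\<Phi> x = f x" if "norm x < 1" for x
    unfolding \<Phi>_def using taylor_sums[OF f that] by (simp add: sums_iff)
  ultimately show thesis using that[of "1 / r" \<Phi>] r by simp
qed

text \<open>Removing a factor x - z i from the test functions gives a recurrence with multiplier
  conj(z i), the second argument being conjugate linear. Once no factor is left, the sequence is j +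
  2 times the Taylor coefficient of index j + 1.\<close>

lemma extremal_geom_decay:
  assumes \<phi>: "\<phi> \<in> dir_space" and I: "finite I" and z: "\<And>i. i \<in> I \<Longrightarrow> norm (z i) < 1"
    and orth: "\<And>j. dir_inner \<phi> (\<lambda>x. x ^ Suc j * zero_prod I z x) = 0"
  shows "geom_decay (\<lambda>j. taylor_coeff \<phi> (Suc j))"
proof -
  have "geom_decay (\<lambda>j. dir_inner \<phi> (\<lambda>x. x ^ Suc j * zero_prod I z x))"
    unfolding orth geom_decay_def by (intro exI[of _ 0] exI[of _ "1 / 2"]) auto
  with I z have "geom_decay (\<lambda>j. dir_inner \<phi> (\<lambda>x. x ^ Suc j))"
  proof (induction I rule: finite_induct)
    case empty
    then show ?case by (simp add: zero_prod_def)
  next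
    case (insert i I)
    have m: "(\<lambda>x. x ^ Suc j * zero_prod I z x) \<in> dir_space" for j
      by (rule dir_space_zero_prod_mult[OF insert.hyps(1) dir_space_power])
    have "dir_inner \<phi> (\<lambda>x. x ^ Suc j * zero_prod (insert i I) z x)
       = dir_inner \<phi> (\<lambda>x. x ^ Suc (Suc j) * zero_prod I z x) - cnj (z i) * dir_inner \<phi> (\<lambda>x. x ^ Suc j * zero_prod I z x)" for j
    proof -
      have "(\<lambda>x. x ^ Suc j * zero_prod (insert i I) z x)
         = (\<lambda>x. x ^ Suc (Suc j) * zero_prod I z x - z i * (x ^ Suc j * zero_prod I z x))"
        using insert.hyps by (auto simp: zero_prod_def algebra_simps)
      then show ?thesis
        using dir_inner_diff_right[OF m[of "Suc j"] dir_space_cmult[OF m[of j], of "z i"] \<phi>] dir_inner_cmult_right[OF m[of j] \<phi>, of "z i"] by simp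
    qed
    then have "geom_decay (\<lambda>j. dir_inner \<phi> (\<lambda>x. x ^ Suc j * zero_prod I z x))"
      by (intro geom_decay_recurrence[OF insert.prems(2), of "cnj (z i)"]) (use insert.prems in auto)
    then show ?case using insert by auto
  qed
  then obtain C r where r: "0 < r" "r < 1" and C: "\<And>j. norm (dir_inner \<phi> (\<lambda>x. x ^ Suc j)) \<le> C * r ^ j"
    unfolding geom_decay_def by blast
  have w: "dir_inner \<phi> (\<lambda>x. x ^ Suc j) = of_real (real (Suc j + 1)) * taylor_coeff \<phi> (Suc j)" for j
    unfolding dir_inner_def taylor_coeff_power by (subst suminf_finite[of "{Suc j}"]) auto
  have "norm (taylor_coeff \<phi> (Suc j)) \<le> C * r ^ j" for j
  proof -
    have "norm (taylor_coeff \<phi> (Suc j)) \<le> real (Suc j + 1) * norm (taylor_coeff \<phi> (Suc j))"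
      using mult_right_mono[of 1 "real (Suc j + 1)" "norm (taylor_coeff \<phi> (Suc j))"] by simp
    also have "\<dots> = norm (dir_inner \<phi> (\<lambda>x. x ^ Suc j))" unfolding w norm_mult norm_of_real by simp
    also have "\<dots> \<le> C * r ^ j" by (rule C)
    finally show ?thesis .
  qed
  then show ?thesis using r unfolding geom_decay_def by blast
qed

lemma dir_norm2_shift: "f \<in> dir_space \<Longrightarrow> dir_norm2 (\<lambda>x. x * f x) = dir_norm2 f + hardy_norm2 f"
proof -
  assume f: "f \<in> dir_space"
  have "complex_of_real (hardy_norm2 f) = (\<Sum>n. taylor_coeff f n * cnj (taylor_coeff f n))"
    unfolding hardy_norm2_def complex_norm_square[symmetric]
    by (rule suminf_of_real[OF hardy2_summable[OF dir_space_imp_hardy2[OF f]]])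
  then have "complex_of_real (dir_norm2 (\<lambda>x. x * f x)) = of_real (dir_norm2 f + hardy_norm2 f)"
    using dir_inner_shift[OF f f] dir_inner_self[OF f] dir_inner_self[OF dir_space_shift[OF f]] by simp
  then show ?thesis by (simp only: of_real_eq_iff)
qed

text \<open>If \<open>\<phi> = (z - a) \<psi>\<close> with \<open>|a| \<le> 1\<close>, then \<open>\<phi> \<bottom> z \<psi>\<close> forces
  \<open>1 = \<parallel>\<phi>\<parallel>\<^sup>2 = |a|\<^sup>2 \<parallel>\<psi>\<parallel>\<^sup>2 - \<parallel>z \<psi>\<parallel>\<^sup>2\<close>, but multiplication by \<open>z\<close> increases the norm.\<close>

lemma extremal_no_extra_zero:
  assumes \<psi>: "\<psi> \<in> dir_space" and eq: "\<And>x. norm x < 1 \<Longrightarrow> \<phi> x = (x - a) * \<psi> x" and a: "norm a \<le> 1"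
    and orth: "dir_inner \<phi> (\<lambda>x. x * \<psi> x) = 0" and one: "dir_norm2 \<phi> = 1"
  shows False
proof -
  let ?s = "\<lambda>x. x * \<psi> x" and ?a = "\<lambda>x. a * \<psi> x"
  have s: "?s \<in> dir_space" and aw: "?a \<in> dir_space" by (intro dir_space_shift dir_space_cmult \<psi>)+
  let ?d = "\<lambda>x. x * \<psi> x - a * \<psi> x"
  have d: "?d \<in> dir_space" by (intro dir_space_diff s aw)
  have ed: "\<phi> x = ?d x" if "norm x < 1" for x using eq[OF that] by (simp add: algebra_simps)
  have 0: "dir_inner ?d ?s = 0" using orth dir_inner_cong[of \<phi> ?d ?s ?s, OF ed] by simp
  have 1: "dir_inner ?d ?d = 1" using dir_inner_self[OF d] one dir_norm2_cong[OF ed] by simp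
  have "dir_inner ?d ?s = dir_inner ?s ?s - a * dir_inner \<psi> ?s"
    using dir_inner_diff_left[OF s aw s] dir_inner_cmult_left[OF \<psi> s] by simp
  then have as: "a * dir_inner \<psi> ?s = of_real (dir_norm2 ?s)" using 0 dir_inner_self[OF s] by simp
  have "dir_inner ?d ?d = dir_inner ?d ?s - cnj a * dir_inner ?d \<psi>"
    using dir_inner_diff_right[OF s aw d] dir_inner_cmult_right[OF \<psi> d] by simp
  also have "dir_inner ?d \<psi> = dir_inner ?s \<psi> - a * dir_inner \<psi> \<psi>"
    using dir_inner_diff_left[OF s aw \<psi>] dir_inner_cmult_left[OF \<psi> \<psi>] by simp
  also have "cnj a * (dir_inner ?s \<psi> - a * dir_inner \<psi> \<psi>) = cnj (a * dir_inner \<psi> ?s) - (a * cnj a) * dir_inner \<psi> \<psi>"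
    using dir_inner_cnj[OF \<psi> s] by (simp add: algebra_simps)
  also have "\<dots> = of_real (dir_norm2 ?s - (norm a)\<^sup>2 * dir_norm2 \<psi>)"
    unfolding as dir_inner_self[OF \<psi>] complex_norm_square[symmetric] by simp
  finally have "complex_of_real 1 = of_real ((norm a)\<^sup>2 * dir_norm2 \<psi> - dir_norm2 ?s)" using 0 1 by simp
  then have "1 = (norm a)\<^sup>2 * dir_norm2 \<psi> - dir_norm2 ?s" by (simp only: of_real_eq_iff)
  also have "\<dots> \<le> 1 * dir_norm2 \<psi> - dir_norm2 ?s"
    using a by (intro diff_right_mono mult_right_mono dir_norm2_nonneg \<psi>) (simp add: power_le_one)
  also have "\<dots> = - hardy_norm2 \<psi>" unfolding dir_norm2_shift[OF \<psi>] by simp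
  also have "\<dots> \<le> 0" using hardy_norm2_nonneg[OF dir_space_imp_hardy2[OF \<psi>]] by simp
  finally show False by simp
qed

section \<open>Factorization through extremal functions\<close>

lemma vanishing_subspace_arc_iff:
  assumes I: "finite I" and z: "\<And>i. i \<in> I \<Longrightarrow> norm (z i) < 1"
  shows "f \<in> vanishing_subspace \<m> I z \<longleftrightarrow>
     f \<in> dir_space \<and> (\<exists>g. g holomorphic_on unit_disk \<and> (\<forall>x\<in>unit_disk. f x = zero_prod I z x * g x))"
proof (cases "f \<in> dir_space")
  case True
  then show ?thesis
    using vanishes_on_iff_factor[OF I, of z unit_disk f] z dir_space_holo
    by (auto simp: vanishing_subspace_def dirichlet_space_eq_dir_space)
qed (simp add: vanishing_subspace_def dirichlet_space_eq_dir_space)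

text \<open>An extremal function is determined on the open disk alone, so \<phi> is kept apart from
  its extension \<Phi>. The cofactor \<open>h\<close> carries the statement that \<Phi> has no zeros
  in the closed disk other than the prescribed ones, with their multiplicities.\<close>

definition extremal_structure :: "nat set \<Rightarrow> (nat \<Rightarrow> complex) \<Rightarrow> (complex \<Rightarrow> complex) \<Rightarrow> (complex \<Rightarrow> complex) \<Rightarrow> (complex \<Rightarrow> complex) \<Rightarrow> real \<Rightarrow> bool" where
  "extremal_structure I z \<phi> \<Phi> h R \<longleftrightarrow> extremal_extension \<Phi> R \<and> h holomorphic_on ball 0 R
     \<and> (\<forall>x\<in>ball 0 R. \<Phi> x = zero_prod I z x * h x) \<and> (\<forall>x\<in>cball 0 1. h x \<noteq> 0) \<and> (\<forall>x\<in>unit_disk. \<phi> x = \<Phi> x)"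

text \<open>Orthogonality to the shifts of the polynomial with the prescribed zeros gives the
  extension, and a further zero of the cofactor in the closed disk is excluded by
  \<open>extremal_no_extra_zero\<close>. The circle is included, where division by \<Phi> has to be
  controlled.\<close>

theorem extremal_structure_exists:
  assumes I: "finite I" and z: "\<And>i. i \<in> I \<Longrightarrow> norm (z i) < 1"
    and ext: "extremal_function \<m> (vanishing_subspace \<m> I z) \<phi>"
  shows "\<exists>\<Phi> h R. extremal_structure I z \<phi> \<Phi> h R"
proof -
  let ?M = "vanishing_subspace \<m> I z"
  have M: "f \<in> ?M \<longleftrightarrow> f \<in> dir_space \<and>
      (\<exists>g. g holomorphic_on unit_disk \<and> (\<forall>x\<in>unit_disk. f x = zero_prod I z x * g x))" for f
    by (rule vanishing_subspace_arc_iff[OF I z])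
  have \<phi>M: "\<phi> \<in> ?M" using ext by (simp add: extremal_function_def)
  then have \<phi>: "\<phi> \<in> dir_space" using M by blast
  have sub: "f \<in> dir_space" if "f \<in> ?M" for f using that M by blast
  have orth: "dir_inner \<phi> (\<lambda>x. x * f x) = 0" if "f \<in> ?M" for f
    using ext that dirichlet_inner_arc[OF \<phi> dir_space_shift[OF sub[OF that]]] by (simp add: extremal_function_def)
  have one: "dir_norm2 \<phi> = 1"
    using ext dirichlet_norm_dir_space[OF \<phi>] by (simp add: extremal_function_def)
  have pM: "(\<lambda>x. x ^ j * zero_prod I z x) \<in> ?M" for j
    unfolding M using dir_space_zero_prod_mult[OF I dir_space_power[of j], of z]
    by (auto intro!: exI[of _ "\<lambda>x. x ^ j"] holomorphic_intros)
  have "dir_inner \<phi> (\<lambda>x. x ^ Suc j * zero_prod I z x) = 0" for j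
    using orth[OF pM, of j] by (simp add: mult.assoc)
  from extremal_geom_decay[OF \<phi> I z this]
  obtain R \<Phi> where R: "R > 1" and \<Phi>: "\<Phi> holomorphic_on ball 0 R" "\<And>x. norm x < 1 \<Longrightarrow> \<Phi> x = \<phi> x"
    using geom_decay_taylor_extension[OF dir_space_holo[OF \<phi>]] by blast
  have sym: "\<phi> x = \<Phi> x" if "norm x < 1" for x using \<Phi>(2)[OF that] by simp
  have zR: "z i \<in> ball 0 R" if "i \<in> I" for i using z[OF that] R by simp
  have "vanishes_on I z \<phi>" using \<phi>M by (simp add: vanishing_subspace_def)
  then have "vanishes_on I z \<Phi>"
    using vanishes_on_cong[of unit_disk I z \<phi> \<Phi>] z sym by auto
  moreover have "vanishes_on I z \<Phi> \<longleftrightarrow>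
      (\<exists>h. h holomorphic_on ball 0 R \<and> (\<forall>x\<in>ball 0 R. \<Phi> x = zero_prod I z x * h x))"
    by (rule vanishes_on_iff_factor[OF I zR open_ball \<Phi>(1)])
  ultimately obtain h where h: "h holomorphic_on ball 0 R" "\<And>x. x \<in> ball 0 R \<Longrightarrow> \<Phi> x = zero_prod I z x * h x"
    by blast
  have \<Phi>one: "dir_norm2 \<Phi> = 1" using dir_norm2_cong[OF sym] one by simp
  have nz: "h a \<noteq> 0" if a: "norm a \<le> 1" for a
  proof
    assume "h a = 0"
    then obtain k where k: "k holomorphic_on ball 0 R" "\<And>x. x \<in> ball 0 R \<Longrightarrow> h x = (x - a) * k x"
      using holomorphic_divide_zero[OF open_ball h(1), of a] a R by auto
    \<comment> \<open>Only the extra zero is removed, so the function stays in the subspace. If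
      \<open>a\<close> lies on the circle, it is the extension past the circle that makes the
      division harmless.\<close>
    let ?\<psi> = "\<lambda>x. zero_prod I z x * k x"
    have h\<psi>: "?\<psi> holomorphic_on ball 0 R" by (intro holomorphic_intros zero_prod_holo k)
    have \<psi>: "?\<psi> \<in> dir_space" by (rule holomorphic_ball_dir_space[OF h\<psi> R])
    have "unit_disk \<subseteq> ball (0::complex) R" using R by auto
    then have "k holomorphic_on unit_disk" by (rule holomorphic_on_subset[OF k(1)])
    then have "?\<psi> \<in> ?M" unfolding M using \<psi> by blast
    from orth[OF this] have "dir_inner \<phi> (\<lambda>x. x * ?\<psi> x) = 0" .
    moreover have "\<phi> x = (x - a) * ?\<psi> x" if "norm x < 1" for x
      using sym[OF that] h(2)[of x] k(2)[of x] that R by simp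
    ultimately show False using extremal_no_extra_zero[OF \<psi> _ a _ one] by blast
  qed
  have "extremal_extension \<Phi> R"
  proof
    fix k
    have "(\<lambda>x. x ^ k * \<phi> x) \<in> ?M"
    proof -
      obtain g where g: "g holomorphic_on unit_disk" "\<And>x. x \<in> unit_disk \<Longrightarrow> \<phi> x = zero_prod I z x * g x"
        using \<phi>M M by blast
      then show ?thesis unfolding M using dir_space_power_mult[OF \<phi>, of k]
        by (auto intro!: exI[of _ "\<lambda>x. x ^ k * g x"] holomorphic_intros)
    qed
    from orth[OF this] have "dir_inner \<phi> (\<lambda>x. x ^ Suc k * \<phi> x) = 0" by (simp add: mult.assoc)
    then show "dir_inner \<Phi> (\<lambda>x. x ^ Suc k * \<Phi> x) = 0"
      using dir_inner_cong[of \<phi> \<Phi> "\<lambda>x. x ^ Suc k * \<phi> x" "\<lambda>x. x ^ Suc k * \<Phi> x"] sym by simp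
  qed (use \<Phi> R \<Phi>one in auto)
  then show ?thesis using h nz sym unfolding extremal_structure_def
    by (intro exI[of _ \<Phi>] exI[of _ h] exI[of _ R]) auto
qed

text \<open>The quotient is g / h throughout the disk, where h has no zeros, and f / \<Phi> near the
  circle, where 1 / \<Phi> is bounded and, on the circle itself, Lipschitz. Hence a function with
  the prescribed zeros is \<Phi> times an element of \<open>dir_space\<close>.\<close>

lemma extremal_structure_divide:
  assumes st: "extremal_structure I z \<phi> \<Phi> h R" and I: "finite I" and z: "\<And>i. i \<in> I \<Longrightarrow> norm (z i) < 1"
    and f: "f \<in> dir_space" and g: "g holomorphic_on unit_disk" "\<And>x. norm x < 1 \<Longrightarrow> f x = zero_prod I z x * g x"
  shows "(\<lambda>x. g x / h x) \<in> dir_space" "\<And>x. norm x < 1 \<Longrightarrow> f x = \<Phi> x * (g x / h x)"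
proof -
  have e: "extremal_extension \<Phi> R" and h: "h holomorphic_on ball 0 R"
    and \<Phi>h: "\<And>x. x \<in> ball 0 R \<Longrightarrow> \<Phi> x = zero_prod I z x * h x" and hn: "\<And>x. norm x \<le> 1 \<Longrightarrow> h x \<noteq> 0"
    using st unfolding extremal_structure_def by auto
  interpret extremal_extension \<Phi> R by (rule e)
  have sub: "unit_disk \<subseteq> ball (0::complex) R" "cball 0 1 \<subseteq> ball (0::complex) R" using R by auto
  show eq: "f x = \<Phi> x * (g x / h x)" if "norm x < 1" for x
    using g(2)[OF that] \<Phi>h[of x] hn[of x] that R by simp
  have q: "(\<lambda>x. g x / h x) holomorphic_on unit_disk"
    by (intro holomorphic_intros g holomorphic_on_subset[OF h] sub) (use hn in auto)
  \<comment> \<open>No zero has larger modulus; the case distinction avoids \<open>Max\<close> of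
    the empty set.\<close>
  define r0 where "r0 = (if I = {} then 0 else Max ((\<lambda>i. norm (z i)) ` I))"
  have r0: "r0 < 1" "\<And>i. i \<in> I \<Longrightarrow> norm (z i) \<le> r0"
    using I z by (auto simp: r0_def)
  \<comment> \<open>Strictly larger than \<open>r0\<close>, so that \<Phi> has no zeros in the
    compact ring r1 <= |x| <= 1.\<close>
  obtain r1 where r1: "r0 < r1" "r1 < 1" using dense[OF r0(1)] by blast
  have \<Phi>n: "\<Phi> x \<noteq> 0" if "r1 \<le> norm x" "norm x \<le> 1" for x
  proof -
    have "zero_prod I z x \<noteq> 0"
      using I r0(2) r1(1) that(1) by (fastforce simp: zero_prod_def)
    then show ?thesis using \<Phi>h[of x] hn[of x] that R by simp
  qed
  let ?A = "cball 0 1 - ball 0 r1 :: complex set"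
  have cA: "continuous_on (cball 0 1) \<Phi>"
    using holo sub holomorphic_on_imp_continuous_on holomorphic_on_subset by blast
  have "compact ?A" by (intro compact_diff) auto
  moreover have "1 \<in> ?A" using r1 by simp
  then have "?A \<noteq> {}" by blast
  ultimately have "\<exists>x\<in>?A. \<forall>y\<in>?A. norm (\<Phi> x) \<le> norm (\<Phi> y)"
    by (intro continuous_attains_inf continuous_on_norm continuous_on_subset[OF cA]) auto
  then obtain x0 where x0: "x0 \<in> ?A" "\<And>y. y \<in> ?A \<Longrightarrow> norm (\<Phi> x0) \<le> norm (\<Phi> y)" by blast
  define c where "c = norm (\<Phi> x0)"
  have c: "c > 0" using \<Phi>n[of x0] x0(1) by (simp add: c_def)
  have c_le: "c \<le> norm (\<Phi> y)" if "r1 \<le> norm y" "norm y \<le> 1" for y using x0(2)[of y] that by (simp add: c_def)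
  have "\<exists>L\<ge>0. \<forall>x y. norm x \<le> 1 \<longrightarrow> norm y \<le> 1 \<longrightarrow> norm (\<Phi> x - \<Phi> y) \<le> L * norm (x - y)"
    by (rule holomorphic_bounded_lipschitz[OF holo R]) blast
  then obtain L where L: "L \<ge> 0" "\<And>x y. norm x \<le> 1 \<Longrightarrow> norm y \<le> 1 \<Longrightarrow> norm (\<Phi> x - \<Phi> y) \<le> L * norm (x - y)" by blast
  show "(\<lambda>x. g x / h x) \<in> dir_space"
  proof (rule dir_space_multiplier(1)[OF f q r1(2), where h = "\<lambda>x. 1 / \<Phi> x" and C = "1 / c" and L = "L / c\<^sup>2"])
    fix x :: complex assume x: "r1 < norm x" "norm x < 1"
    then show "g x / h x = 1 / \<Phi> x * f x" using eq[of x] \<Phi>n[of x] by simp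
  next
    fix x :: complex assume x: "r1 < norm x" "norm x \<le> 1"
    then show "norm (1 / \<Phi> x) \<le> 1 / c" using c c_le[of x] by (simp add: norm_divide frac_le)
  next
    fix x y :: complex assume x: "norm x = 1" and y: "norm y = 1"
    have n: "\<Phi> x \<noteq> 0" "\<Phi> y \<noteq> 0" using \<Phi>n x y r1 by auto
    have "1 / \<Phi> x - 1 / \<Phi> y = (\<Phi> y - \<Phi> x) / (\<Phi> x * \<Phi> y)" using n by (simp add: field_simps)
    then have "norm (1 / \<Phi> x - 1 / \<Phi> y) = norm (\<Phi> y - \<Phi> x) / (norm (\<Phi> x) * norm (\<Phi> y))"
      by (simp add: norm_divide norm_mult)
    also have "\<dots> \<le> (L * norm (y - x)) / (c * c)"
      using c c_le[of x] c_le[of y] L(1) L(2)[of y x] x y r1 by (intro frac_le mult_mono mult_nonneg_nonneg) auto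
    finally show "norm (1 / \<Phi> x - 1 / \<Phi> y) \<le> L / c\<^sup>2 * norm (x - y)"
      by (simp add: power2_eq_square norm_minus_commute)
  next
    fix \<zeta> :: complex assume \<zeta>: "norm \<zeta> = 1"
    show "((\<lambda>r. 1 / \<Phi> (of_real r * \<zeta>)) \<longlongrightarrow> 1 / \<Phi> \<zeta>) (at_left (1::real))"
      by (intro tendsto_divide tendsto_const tendsto_dilate_at_left cA \<zeta>) (use \<Phi>n \<zeta> r1 in auto)
  qed
qed

subsection \<open>Kernels along a chain of extremal functions\<close>

lemma dir_space_unshift:
  assumes g: "g holomorphic_on unit_disk" and w: "(\<lambda>x. x * g x) \<in> dir_space"
  shows "g \<in> dir_space"
proof -
  have "summable (\<lambda>n. real (Suc n + 1) * (norm (taylor_coeff (\<lambda>x. x * g x) (Suc n)))\<^sup>2)"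
    using dir_space_summable[OF w] by (subst summable_Suc_iff)
  then have "summable (\<lambda>n. real (n + 1) * (norm (taylor_coeff g n))\<^sup>2)"
    by (rule summable_comparison_test'[of _ 0]) (auto simp: taylor_coeff_shift_Suc[OF g] mult_right_mono)
  then show ?thesis using g by (simp add: dir_space_def)
qed

lemma dir_space_power_unshift:
  "g holomorphic_on unit_disk \<Longrightarrow> (\<lambda>x. x ^ s * g x) \<in> dir_space \<Longrightarrow> g \<in> dir_space"
proof (induction s)
  case (Suc s)
  have "(\<lambda>x. x ^ s * g x) \<in> dir_space"
  proof (rule dir_space_unshift)
    show "(\<lambda>x. x ^ s * g x) holomorphic_on unit_disk" by (intro holomorphic_intros Suc.prems)
  qed (use Suc.prems in \<open>simp add: mult.assoc\<close>)
  then show ?case using Suc by blast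
qed simp

text \<open>In the space with weight \<open>|\<Phi>|\<^sup>2\<close> the function \<open>\<psi>\<close> spans the orthogonal complement of \<open>z N\<close> in
  \<open>N = {f. f w = 0}\<close> with \<open>w = z i\<close>. The constant function \<open>1\<close>, which is the kernel at \<open>0\<close>, has the projection
  \<open>cnj (\<psi> 0) \<psi>\<close> onto \<open>N\<close>; what is left over is a multiple of the kernel at \<open>w\<close>.\<close>

lemma kernel_step:
  assumes st: "extremal_structure I z \<phi> \<Phi> h R" and st': "extremal_structure (insert i I) z \<phi>' \<Phi>' h' R'"
    and I: "finite I" "i \<notin> I" and z: "\<And>k. k \<in> insert i I \<Longrightarrow> norm (z k) < 1"
  defines "\<psi> \<equiv> \<lambda>x. (x - z i) * h' x / h x"
  shows "\<psi> \<in> dir_space" "\<And>x. norm x < 1 \<Longrightarrow> \<Phi>' x = \<Phi> x * \<psi> x" "norm (\<psi> 0) < 1"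
    "reproducing_kernel (extremal_extension.\<mu> \<Phi>) (z i) (z i) = of_real (1 / (1 - (norm (\<psi> 0))\<^sup>2))"
proof -
  interpret E: extremal_extension \<Phi> R using st by (simp add: extremal_structure_def)
  interpret E': extremal_extension \<Phi>' R' using st' by (simp add: extremal_structure_def)
  define w where "w = z i"
  have w1: "norm w < 1" unfolding w_def by (rule z) simp
  have zI: "\<And>k. k \<in> I \<Longrightarrow> norm (z k) < 1" using z by simp
  have hh: "h holomorphic_on ball 0 R" and \<Phi>h: "\<And>x. norm x < R \<Longrightarrow> \<Phi> x = zero_prod I z x * h x"
    and hn: "\<And>x. norm x \<le> 1 \<Longrightarrow> h x \<noteq> 0"
    using st by (auto simp: extremal_structure_def)
  have hh': "h' holomorphic_on ball 0 R'" and \<Phi>h': "\<And>x. norm x < R' \<Longrightarrow> \<Phi>' x = zero_prod (insert i I) z x * h' x"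
    using st' by (auto simp: extremal_structure_def)
  have hd: "h holomorphic_on unit_disk" "h' holomorphic_on unit_disk"
    by (rule holomorphic_on_subset[OF hh], use E.R in force) (rule holomorphic_on_subset[OF hh'], use E'.R in force)
  have zp: "zero_prod (insert i I) z x = zero_prod I z x * (x - w)" for x
    using I by (simp add: zero_prod_def w_def)
  have g: "(\<lambda>x. (x - w) * h' x) holomorphic_on unit_disk" by (intro holomorphic_intros hd)
  have \<Phi>'e: "\<Phi>' x = zero_prod I z x * ((x - w) * h' x)" if "norm x < 1" for x
    using \<Phi>h'[of x] that E'.R zp by simp
  note dv = extremal_structure_divide[where z = z, OF st I(1) zI E'.\<Phi>_dir_space g \<Phi>'e]
  have \<psi>e: "\<psi> = (\<lambda>x. (x - w) * h' x / h x)" unfolding \<psi>_def w_def ..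
  show \<psi>: "\<psi> \<in> dir_space" unfolding \<psi>e by (rule dv(1))
  show fac: "\<Phi>' x = \<Phi> x * \<psi> x" if "norm x < 1" for x unfolding \<psi>e by (rule dv(2)) (use that in auto)
  have \<psi>w: "\<psi> w = 0" by (simp add: \<psi>e)
  define ip where "ip = dirichlet_inner E.\<mu>"
  have ip: "ip f g = dir_inner (\<lambda>x. \<Phi> x * f x) (\<lambda>x. \<Phi> x * g x)" if "f \<in> dir_space" "g \<in> dir_space" for f g
    unfolding ip_def by (rule E.isometry[OF that])
  have one: "(\<lambda>x. 1) \<in> dir_space" using dir_space_power[of 0] by simp
  have ip_add: "ip (\<lambda>x. f x + g x) k = ip f k + ip g k" if "f \<in> dir_space" "g \<in> dir_space" "k \<in> dir_space" for f g k
    using dir_inner_add_left[OF E.mult_dir_space E.mult_dir_space E.mult_dir_space, OF that] that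
    by (simp add: ip dir_space_add distrib_left)
  have ip_cmult: "ip (\<lambda>x. c * f x) k = c * ip f k" if "f \<in> dir_space" "k \<in> dir_space" for c f k
    using dir_inner_cmult_left[OF E.mult_dir_space E.mult_dir_space, OF that, of c] that
    by (simp add: ip dir_space_cmult mult.left_commute)
  have ip_cnj: "ip k f = cnj (ip f k)" if "f \<in> dir_space" "k \<in> dir_space" for f k
    using dir_inner_cnj[OF E.mult_dir_space E.mult_dir_space, OF that] that by (simp add: ip)
  have ip_one: "ip f (\<lambda>x. 1) = f 0" if "f \<in> dir_space" for f
    unfolding ip_def by (rule E.dirichlet_inner_one_right[OF that])
  have \<psi>\<psi>: "ip \<psi> \<psi> = 1"
    using dir_inner_cong[of \<Phi>' "\<lambda>x. \<Phi> x * \<psi> x" \<Phi>' "\<lambda>x. \<Phi> x * \<psi> x"] fac dir_inner_self[OF E'.\<Phi>_dir_space] E'.norm_one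
    by (simp add: ip \<psi>)
  \<comment> \<open>\<Phi> f has all the zeros of \<Phi>', so it is \<Phi>' q. The isometry for
    \<Phi>' turns the inner product into that of x q with the constant 1, which is the value of x q
    at 0.\<close>
  have orth: "ip (\<lambda>x. x * f x) \<psi> = 0" if f: "f \<in> dir_space" "f w = 0" for f
  proof -
    obtain f1 where f1: "f1 holomorphic_on unit_disk" "\<And>x. x \<in> unit_disk \<Longrightarrow> f x = (x - w) * f1 x"
      using holomorphic_divide_zero[OF open_ball dir_space_holo[OF f(1)] _ f(2)] w1 by auto
    have g1: "(\<lambda>x. h x * f1 x) holomorphic_on unit_disk" by (intro holomorphic_intros hd f1)
    have e1: "\<Phi> x * f x = zero_prod (insert i I) z x * (h x * f1 x)" if "norm x < 1" for x
      using \<Phi>h[of x] f1(2)[of x] that E.R zp[of x] by simp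
    have fin: "finite (insert i I)" using I by simp
    note dq = extremal_structure_divide[where z = z, OF st' fin z E.mult_dir_space[OF f(1)] g1 e1]
    define q where "q x = h x * f1 x / h' x" for x
    have q: "q \<in> dir_space" unfolding q_def[abs_def] by (rule dq(1))
    have qe: "\<Phi> x * f x = \<Phi>' x * q x" if "norm x < 1" for x unfolding q_def by (rule dq(2)) (use that in auto)
    have "ip (\<lambda>x. x * f x) \<psi> = dir_inner (\<lambda>x. \<Phi> x * (x * f x)) (\<lambda>x. \<Phi> x * \<psi> x)"
      by (intro ip dir_space_shift f \<psi>)
    also have "\<dots> = dir_inner (\<lambda>x. \<Phi>' x * (x * q x)) (\<lambda>x. \<Phi>' x * 1)"
      by (rule dir_inner_cong) (use qe fac in \<open>auto simp: mult.left_commute\<close>)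
    also have "\<dots> = dirichlet_inner E'.\<mu> (\<lambda>x. x * q x) (\<lambda>x. 1)"
      by (rule E'.isometry[OF dir_space_shift[OF q] one, symmetric])
    also have "\<dots> = 0" using E'.dirichlet_inner_one_right[OF dir_space_shift[OF q]] by simp
    finally show ?thesis .
  qed
  have hn1: "hardy_norm2 \<psi> \<le> 1"
    using E.hardy_norm2_le_mult[OF \<psi>] dir_norm2_cong[of \<Phi>' "\<lambda>x. \<Phi> x * \<psi> x"] fac E'.norm_one by simp
  define a where "a = \<psi> 0"
  have part: "(\<Sum>n\<in>A. (norm (taylor_coeff \<psi> n))\<^sup>2) \<le> 1" if "finite A" for A
    using sum_le_suminf[OF hardy2_summable[OF dir_space_imp_hardy2[OF \<psi>]] that] hn1 by (simp add: hardy_norm2_def)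
  \<comment> \<open>The squared Hardy norm of \<psi> is at most 1. If the value at 0 exhausted it,
    \<psi> would be constant, against \<psi> w = 0.\<close>
  show a1: "norm (\<psi> 0) < 1"
  proof (rule ccontr)
    assume "\<not> norm (\<psi> 0) < 1"
    then have ge: "1 \<le> (norm (taylor_coeff \<psi> 0))\<^sup>2" by (simp add: taylor_coeff_0)
    have z0: "taylor_coeff \<psi> n = 0" if "n \<noteq> 0" for n
    proof -
      have "(norm (taylor_coeff \<psi> 0))\<^sup>2 + (norm (taylor_coeff \<psi> n))\<^sup>2 \<le> 1" using part[of "{0, n}"] that by simp
      with ge have "(norm (taylor_coeff \<psi> n))\<^sup>2 \<le> 0" by linarith
      then show ?thesis by simp
    qed
    have "(\<lambda>n. taylor_coeff \<psi> n * w ^ n) = (\<lambda>n. if n = 0 then taylor_coeff \<psi> n else 0)"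
      using z0 by auto
    then have "(\<lambda>n. if n = 0 then taylor_coeff \<psi> n else 0) sums \<psi> w"
      using taylor_sums[OF dir_space_holo[OF \<psi>] w1] by simp
    then have "\<psi> w = taylor_coeff \<psi> 0" by (rule sums_unique2[OF _ sums_single])
    with ge \<psi>w show False by simp
  qed
  have den: "1 - (norm a)\<^sup>2 > 0" using a1 by (simp add: a_def abs_square_less_1)
  define d where "d = 1 - a * cnj a"
  have d: "d = of_real (1 - (norm a)\<^sup>2)" unfolding d_def complex_norm_square[symmetric] by simp
  have dn: "d \<noteq> 0" unfolding d using den by (metis less_irrefl of_real_eq_0_iff)
  \<comment> \<open>The remainder 1 - conj(a) \<psi> has value 1 at w and squared norm
    \<open>d\<close>. A multiple c k_w of the kernel with these two properties must have c = d,
    hence the division by \<open>d\<close>.\<close>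
  define K where "K x = (1 / d) * (1 + (- cnj a) * \<psi> x)" for x
  have K: "K \<in> dir_space" unfolding K_def[abs_def] by (intro dir_space_cmult dir_space_add one \<psi>)
  have dc: "cnj d = d" unfolding d by simp
  have ipK: "ip f K = (1 / d) * (f 0 - a * ip f \<psi>)" if f: "f \<in> dir_space" for f
  proof -
    have "ip K f = (1 / d) * (ip (\<lambda>x. 1) f + (- cnj a) * ip \<psi> f)"
      unfolding K_def[abs_def] by (simp only: ip_cmult ip_add dir_space_add dir_space_cmult one \<psi> f)
    moreover have "ip f K = cnj (ip K f)" by (rule ip_cnj[OF K f])
    ultimately show ?thesis
      using ip_cnj[OF one f] ip_cnj[OF \<psi> f] ip_one[OF f] dc by simp
  qed
  have repK: "f w = ip f K" if f: "f \<in> dir_space" for f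
  proof (cases "w = 0")
    case True
    then have "a = 0" using \<psi>w by (simp add: a_def)
    then show ?thesis using ipK[OF f] True by (simp add: d_def)
  next
    case False
    \<comment> \<open>The linear function with value 1 at 0 and 0 at w. Subtracting f w + (f 0 - f
      w) l from f leaves a function that vanishes at both points; it is x g with g w = 0 and
      therefore orthogonal to \<psi>.\<close>
    define l where "l x = 1 + (- 1 / w) * x" for x
    have idw: "(\<lambda>x. x) \<in> dir_space" using dir_space_power[of 1] by simp
    have l: "l \<in> dir_space" unfolding l_def[abs_def] by (intro dir_space_add dir_space_cmult one idw)
    have dec: "ip f \<psi> = f w * cnj a + (f 0 - f w) * ip l \<psi>" if f: "f \<in> dir_space" for f
    proof -
      define c where "c x = f w * 1 + (f 0 - f w) * l x" for x
      have c: "c \<in> dir_space" unfolding c_def[abs_def] by (intro dir_space_add dir_space_cmult one l)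
      have r: "(\<lambda>x. f x - c x) \<in> dir_space" by (intro dir_space_diff f c)
      have "f 0 - c 0 = 0" by (simp add: c_def l_def)
      then obtain g where g: "g holomorphic_on unit_disk" "\<And>x. x \<in> unit_disk \<Longrightarrow> f x - c x = (x - 0) * g x"
        using holomorphic_divide_zero[OF open_ball dir_space_holo[OF r], of 0] by auto
      have gw: "g \<in> dir_space"
        by (rule dir_space_unshift[OF g(1)]) (use dir_space_cong[of "\<lambda>x. f x - c x" "\<lambda>x. x * g x"] r g(2) in auto)
      have "f w - c w = 0" using False by (simp add: c_def l_def)
      then have "g w = 0" using g(2)[of w] w1 False by simp
      have xg: "(\<lambda>x. x * g x) \<in> dir_space" by (rule dir_space_shift[OF gw])
      have fe: "f x = c x + x * g x" if "norm x < 1" for x using g(2)[of x] that by (simp add: algebra_simps)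
      have "ip f \<psi> = ip (\<lambda>x. c x + x * g x) \<psi>"
        unfolding ip[OF f \<psi>] ip[OF dir_space_add[OF c xg] \<psi>] by (rule dir_inner_cong) (use fe in auto)
      also have "\<dots> = ip c \<psi> + ip (\<lambda>x. x * g x) \<psi>" by (rule ip_add[OF c xg \<psi>])
      also have "ip (\<lambda>x. x * g x) \<psi> = 0" by (rule orth[OF gw \<open>g w = 0\<close>])
      also have "ip c \<psi> = f w * ip (\<lambda>x. 1) \<psi> + (f 0 - f w) * ip l \<psi>"
        unfolding c_def[abs_def] by (simp only: ip_cmult ip_add dir_space_add dir_space_cmult one l \<psi>)
      also have "ip (\<lambda>x. 1) \<psi> = cnj a" using ip_cnj[OF \<psi> one] ip_one[OF \<psi>] by (simp add: a_def)
      finally show ?thesis by simp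
    qed
    \<comment> \<open>The decomposition for f = \<psi> evaluates the unknown inner product of l and
      \<psi>.\<close>
    have "a * ip l \<psi> = 1" using dec[OF \<psi>] \<psi>\<psi> \<psi>w by (simp add: a_def)
    then have "a * ip f \<psi> = f w * (a * cnj a) + (f 0 - f w)"
      unfolding dec[OF f] distrib_left by (metis mult.assoc mult.commute mult_1)
    then show ?thesis unfolding ipK[OF f] using dn by (simp add: d_def field_simps)
  qed
  have nz: "\<Phi> \<zeta> \<noteq> 0" if "norm \<zeta> = 1" for \<zeta>
  proof -
    have "zero_prod I z \<zeta> \<noteq> 0" using I(1) zI that by (fastforce simp: zero_prod_def)
    then show ?thesis using \<Phi>h[of \<zeta>] hn[of \<zeta>] that E.R by simp
  qed
  define k where "k = reproducing_kernel E.\<mu> w"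
  have "k \<in> dirichlet_space E.\<mu> \<and> (\<forall>f\<in>dirichlet_space E.\<mu>. f w = dirichlet_inner E.\<mu> f k)"
    unfolding k_def reproducing_kernel_def
    by (rule someI[of _ K]) (use K repK in \<open>simp add: E.dirichlet_space_eq[OF nz] ip_def\<close>)
  then have k: "k \<in> dir_space" "\<And>f. f \<in> dir_space \<Longrightarrow> f w = ip f k"
    by (auto simp: E.dirichlet_space_eq[OF nz] ip_def)
  \<comment> \<open>The kernel is obtained by choice; pairing it with \<open>K\<close> in both
    orders fixes its value at w.\<close>
  have "k w = cnj (K w)" using repK[OF k(1)] k(2)[OF K] ip_cnj[OF k(1) K] by simp
  also have "\<dots> = 1 / d" using dc by (simp add: K_def \<psi>w)
  finally show "reproducing_kernel (extremal_extension.\<mu> \<Phi>) (z i) (z i) = of_real (1 / (1 - (norm (\<psi> 0))\<^sup>2))"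
    unfolding k_def w_def d a_def by simp
qed

text \<open>The arithmetic-geometric mean inequality in each term of the power series. Its use is
  the local uniform bound in Montel's theorem.\<close>

lemma norm_le_dir_norm2:
  assumes f: "f \<in> dir_space" and x: "norm x < 1"
  shows "norm (f x) \<le> (dir_norm2 f + 1 / (1 - (norm x)\<^sup>2)) / 2"
proof -
  have x2: "(norm x)\<^sup>2 < 1" using x by (simp add: abs_square_less_1)
  have s: "summable (\<lambda>n. ((norm (taylor_coeff f n))\<^sup>2 + ((norm x)\<^sup>2) ^ n) / 2)"
    using x2 by (intro summable_divide summable_add hardy2_summable dir_space_imp_hardy2 f summable_geometric) simp
  have t: "norm (taylor_coeff f n * x ^ n) \<le> ((norm (taylor_coeff f n))\<^sup>2 + ((norm x)\<^sup>2) ^ n) / 2" for n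
    using sum_squares_bound[of "norm (taylor_coeff f n)" "norm x ^ n"]
    by (simp add: norm_mult norm_power power_mult[symmetric] mult.commute)
  have "norm (f x) = norm (\<Sum>n. taylor_coeff f n * x ^ n)" using taylor_sums[OF dir_space_holo[OF f] x] by (simp add: sums_iff)
  also have "\<dots> \<le> (\<Sum>n. ((norm (taylor_coeff f n))\<^sup>2 + ((norm x)\<^sup>2) ^ n) / 2)"
    by (rule norm_suminf_le[OF t s])
  also have "\<dots> = (hardy_norm2 f + 1 / (1 - (norm x)\<^sup>2)) / 2"
    unfolding hardy_norm2_def using x2 hardy2_summable[OF dir_space_imp_hardy2[OF f]]
    by (subst suminf_divide, intro summable_add, simp_all add: summable_geometric suminf_add[symmetric] suminf_geometric)
  also have "\<dots> \<le> (dir_norm2 f + 1 / (1 - (norm x)\<^sup>2)) / 2" using hardy_norm2_le_dir_norm2[OF f] by simp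
  finally show ?thesis .
qed

lemma higher_deriv_uniform_limit:
  assumes hol: "\<And>n. F n holomorphic_on unit_disk" and g: "g holomorphic_on unit_disk"
    and lim: "\<And>K. compact K \<Longrightarrow> K \<subseteq> unit_disk \<Longrightarrow> uniform_limit K F g sequentially"
    and w: "norm w < 1"
  shows "(\<lambda>n. (deriv ^^ j) (F n) w) \<longlonglongrightarrow> (deriv ^^ j) g w"
proof (cases "j = 0")
  case True
  have "(\<lambda>n. F n w) \<longlonglongrightarrow> g w" by (rule tendsto_uniform_limitI[OF lim[of "{w}"]]) (use w in auto)
  then show ?thesis using True by simp
next
  case False
  define r where "r = (1 - norm w) / 2"
  have r: "r > 0" "cball w r \<subseteq> unit_disk"
  proof -
    show "r > 0" using w by (simp add: r_def)
    show "cball w r \<subseteq> unit_disk"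
    proof
      fix x assume "x \<in> cball w r"
      then have "norm (x - w) \<le> r" by (simp add: dist_norm norm_minus_commute)
      then show "x \<in> unit_disk" using norm_triangle_ineq[of "x - w" w] w by (simp add: r_def field_simps)
    qed
  qed
  show ?thesis
  proof (rule tendstoI)
    fix e :: real assume e: "e > 0"
    \<comment> \<open>Chosen so that Cauchy's estimate on the disk of radius r gives e / 2.\<close>
    define B where "B = e * r ^ j / (2 * fact j)"
    have B: "B > 0" using e r by (simp add: B_def)
    have "eventually (\<lambda>n. \<forall>x\<in>cball w r. dist (F n x) (g x) < B) sequentially"
      by (rule uniform_limitD[OF lim[OF compact_cball r(2)] B])
    then show "eventually (\<lambda>n. dist ((deriv ^^ j) (F n) w) ((deriv ^^ j) g w) < e) sequentially"
    proof eventually_elim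
      case (elim n)
      have h: "(\<lambda>x. F n x - g x) holomorphic_on cball w r"
        by (intro holomorphic_intros holomorphic_on_subset[OF hol r(2)] holomorphic_on_subset[OF g r(2)])
      have "norm ((deriv ^^ j) (\<lambda>x. F n x - g x) w) \<le> fact j * B / r ^ j"
      proof (rule Cauchy_higher_deriv_bound[where y = 0])
        show "F n x - g x \<in> ball 0 B" if "x \<in> ball w r" for x
          using elim[rule_format, of x] that by (simp add: dist_norm norm_minus_commute)
      qed (use h r(1) False in \<open>auto intro: holomorphic_on_imp_continuous_on holomorphic_on_subset\<close>)
      also have "\<dots> = e / 2" using r(1) by (simp add: B_def)
      also have "\<dots> < e" using e by simp
      also have "(deriv ^^ j) (\<lambda>x. F n x - g x) w = (deriv ^^ j) (F n) w - (deriv ^^ j) g w"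
        by (rule higher_deriv_diff[OF hol g open_ball]) (use w in simp)
      finally show ?case by (simp add: dist_norm)
    qed
  qed
qed

section \<open>Lowest Taylor coefficients and tail products\<close>

lemma taylor_coeff_mult_lowest:
  assumes f: "f holomorphic_on unit_disk" and g: "g holomorphic_on unit_disk"
    and z: "\<And>j. j < k \<Longrightarrow> taylor_coeff f j = 0"
  shows "taylor_coeff (\<lambda>x. f x * g x) k = taylor_coeff f k * g 0"
proof -
  have "taylor_coeff (\<lambda>x. f x * g x) k = (\<Sum>i\<le>k. taylor_coeff f i * taylor_coeff g (k - i))"
    by (rule taylor_coeff_mult[OF f g])
  also have "\<dots> = (\<Sum>i\<in>{k}. taylor_coeff f i * taylor_coeff g (k - i))"
    by (rule sum.mono_neutral_right) (use z in auto)
  finally show ?thesis by (simp add: taylor_coeff_0)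
qed

lemma zero_of_order_ge_taylor: "zero_of_order_ge f 0 k \<longleftrightarrow> (\<forall>j<k. taylor_coeff f j = 0)"
  by (simp add: zero_of_order_ge_def taylor_coeff_def)

text \<open>Division by zeros for the sequence that is constantly 0, with s indices.\<close>

lemma factor_power_at_0:
  assumes f: "f holomorphic_on unit_disk" and z: "\<And>j. j < s \<Longrightarrow> taylor_coeff f j = 0"
  obtains g where "g holomorphic_on unit_disk" "\<And>x. norm x < 1 \<Longrightarrow> f x = x ^ s * g x"
proof -
  have "zero_of_order_ge f 0 (card J)" if "J \<subseteq> {..<s}" for J
    unfolding zero_of_order_ge_taylor using z card_mono[OF _ that] by auto
  then have "vanishes_on {..<s} (\<lambda>_. 0) f"
    unfolding vanishes_on_def by (metis (mono_tags, lifting) card.empty empty_Collect_eq less_nat_zero_code mem_Collect_eq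
        subset_empty subset_iff zero_of_order_ge_def)
  then obtain g where "g holomorphic_on unit_disk" "\<And>x. x \<in> unit_disk \<Longrightarrow> f x = zero_prod {..<s} (\<lambda>_. 0) x * g x"
    using vanishes_on_iff_factor[of "{..<s}" "\<lambda>_. 0" unit_disk f] f by auto
  then show thesis using that[of g] by (simp add: zero_prod_def)
qed

lemma zero_of_order_ge_power_mult:
  assumes g: "g holomorphic_on unit_disk" and w: "norm w < 1" "w \<noteq> 0"
  shows "zero_of_order_ge (\<lambda>x. x ^ s * g x) w c \<longleftrightarrow> zero_of_order_ge g w c"
proof (induction s)
  case (Suc s)
  have "(\<lambda>x. x ^ s * g x) holomorphic_on unit_disk" by (intro holomorphic_intros g)
  then have "zero_of_order_ge (\<lambda>x. x ^ Suc s * g x) w c \<longleftrightarrow> zero_of_order_ge (\<lambda>x. x ^ s * g x) w c"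
    by (rule zero_of_order_ge_linear_mult_other[where S = unit_disk and w = 0, OF open_ball]) (use w in auto)
  then show ?case using Suc by simp
qed simp

text \<open>Weierstrass' product inequality. The bounds 0 and 1 belong to the induction because its
  step multiplies by the previous product.\<close>

lemma prod_ge_one_minus_sum:
  fixes t :: "nat \<Rightarrow> real"
  assumes "finite A" "\<And>i. i \<in> A \<Longrightarrow> 0 \<le> t i \<and> t i \<le> 1"
  shows "1 - sum t A \<le> (\<Prod>i\<in>A. 1 - t i) \<and> 0 \<le> (\<Prod>i\<in>A. 1 - t i) \<and> (\<Prod>i\<in>A. 1 - t i) \<le> 1"
  using assms
proof (induction A rule: finite_induct)
  case (insert i A)
  let ?P = "\<Prod>i\<in>A. 1 - t i"
  have IH: "1 - sum t A \<le> ?P" "0 \<le> ?P" "?P \<le> 1" and ti: "0 \<le> t i" "t i \<le> 1" using insert by auto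
  have "t i * ?P \<le> t i" using IH ti by (simp add: mult_left_le)
  then have "1 - sum t (insert i A) \<le> (1 - t i) * ?P" using IH insert.hyps by (simp add: algebra_simps)
  moreover have "0 \<le> (1 - t i) * ?P" "(1 - t i) * ?P \<le> 1" using IH ti by (auto intro: mult_le_one)
  ultimately show ?case using insert.hyps by simp
qed simp

lemma boundary_value_disk_cong:
  assumes "\<And>x. norm x < 1 \<Longrightarrow> f x = g x" "norm \<zeta> = 1"
  shows "boundary_value f \<zeta> = boundary_value g \<zeta>"
  unfolding boundary_value_def
proof (rule Lim_cong)
  show "eventually (\<lambda>r. f (of_real r * \<zeta>) = g (of_real r * \<zeta>)) (at_left (1::real))"
    by (rule eventually_at_leftI[of 0]) (use assms in \<open>auto simp: norm_mult\<close>)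
qed simp

text \<open>What \<open>kernel_step\<close> provides for all n together. The function
  \<open>\<psi> n\<close> belongs to the step from n to n + 1 points, so it accounts for the point z
  (n + 1).\<close>

locale extremal_chain =
  fixes z :: "nat \<Rightarrow> complex" and \<Phi> h \<psi> :: "nat \<Rightarrow> complex \<Rightarrow> complex" and \<phi> :: "nat \<Rightarrow> complex \<Rightarrow> complex" and R :: "nat \<Rightarrow> real"
  assumes z: "\<And>n. n \<ge> 1 \<Longrightarrow> norm (z n) < 1"
    and st: "\<And>n. extremal_structure {1..n} z (\<phi> n) (\<Phi> n) (h n) (R n)"
    and \<psi>_dir_space: "\<And>n. \<psi> n \<in> dir_space"
    and \<Phi>_Suc: "\<And>n x. norm x < 1 \<Longrightarrow> \<Phi> (Suc n) x = \<Phi> n x * \<psi> n x"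
    and \<psi>_0: "\<And>n. norm (\<psi> n 0) < 1"
begin

text \<open>the reciprocal of the kernel, by \<open>kernel_step\<close>\<close>

definition t :: "nat \<Rightarrow> real" where "t n = 1 - (norm (\<psi> n 0))\<^sup>2"

lemma t_bounds: "0 \<le> t n" "t n \<le> 1"
  using \<psi>_0[of n] by (auto simp: t_def abs_square_le_1)

lemma ext: "extremal_extension (\<Phi> n) (R n)"
  using st[of n] by (simp add: extremal_structure_def)

lemma \<Phi>_dir_space: "\<Phi> n \<in> dir_space"
  by (rule extremal_extension.\<Phi>_dir_space[OF ext])

lemma dir_norm2_\<Phi>: "dir_norm2 (\<Phi> n) = 1"
  by (rule extremal_extension.norm_one[OF ext])

lemma z': "i \<in> {1..n} \<Longrightarrow> norm (z i) < 1"
  using z by simp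

lemma vanishes_\<Phi>: "vanishes_on {1..n} z (\<Phi> n)"
proof -
  have h: "h n holomorphic_on unit_disk" "\<forall>x\<in>unit_disk. \<Phi> n x = zero_prod {1..n} z x * h n x"
    using st[of n] extremal_extension.R[OF ext, of n] holomorphic_on_subset[of "h n" "ball 0 (R n)" unit_disk]
    by (auto simp: extremal_structure_def)
  show ?thesis
    using vanishes_on_iff_factor[of "{1..n}" z unit_disk "\<Phi> n"] z' h dir_space_holo[OF \<Phi>_dir_space] by auto
qed

text \<open>The quotient of \<Phi> n by \<Phi> N, written as a product so that it is defined at
  common zeros as well. The free starting index N makes it possible to skip the points of the
  sequence that lie at 0.\<close>

definition G :: "nat \<Rightarrow> nat \<Rightarrow> complex \<Rightarrow> complex" where
  "G N n x = (\<Prod>j\<in>{N..<n}. \<psi> j x)"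

lemma G_holo: "G N n holomorphic_on unit_disk"
  unfolding G_def[abs_def] by (intro holomorphic_intros dir_space_holo \<psi>_dir_space)

lemma \<Phi>_eq: "N \<le> n \<Longrightarrow> norm x < 1 \<Longrightarrow> \<Phi> n x = \<Phi> N x * G N n x"
  by (induction n rule: dec_induct) (auto simp: G_def \<Phi>_Suc prod.atLeastLessThan_Suc)

lemma norm_G_0: "(norm (G N n 0))\<^sup>2 = (\<Prod>j\<in>{N..<n}. 1 - t j)"
  by (simp add: G_def t_def prod_norm[symmetric] prod_power_distrib)

lemma taylor_\<Phi>_lowest:
  assumes "N \<le> n" "\<And>j. j < k \<Longrightarrow> taylor_coeff (\<Phi> N) j = 0"
  shows "taylor_coeff (\<Phi> n) k = taylor_coeff (\<Phi> N) k * G N n 0"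
proof -
  have "taylor_coeff (\<Phi> n) k = taylor_coeff (\<lambda>x. \<Phi> N x * G N n x) k"
    by (rule taylor_coeff_cong) (use \<Phi>_eq[OF assms(1)] in auto)
  also have "\<dots> = taylor_coeff (\<Phi> N) k * G N n 0"
    by (rule taylor_coeff_mult_lowest[OF dir_space_holo[OF \<Phi>_dir_space] G_holo assms(2)])
  finally show ?thesis .
qed

text \<open>The unit ball is a normal family and closed under locally uniform limits; the task is to
  keep the limit from being 0. The lowest coefficient of one fixed \<Phi> N is inherited by every
  later \<Phi> n up to the factor G N n 0, which stays away from 0.\<close>

theorem zero_set_if_summable:
  assumes s: "summable t"
  shows "is_zero_set \<m> {1..} z"
proof -
  \<comment> \<open>Tail sums below 1/2 keep the tail products above 1/2, by Weierstrass'
    inequality.\<close>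
  obtain N where N: "\<And>n. norm (sum t {N..<n}) < 1 / 2"
    using s[unfolded summable_Cauchy, rule_format, of "1 / 2"] by auto
  have Gge: "1 / 2 \<le> (norm (G N n 0))\<^sup>2" for n
    using prod_ge_one_minus_sum[of "{N..<n}" t] t_bounds N[of n] unfolding norm_G_0 by fastforce
  have "\<exists>k. taylor_coeff (\<Phi> N) k \<noteq> 0"
  proof (rule ccontr)
    assume "\<not> ?thesis"
    then have "dir_norm2 (\<Phi> N) = 0" by (simp add: dir_norm2_def)
    then show False by (simp add: dir_norm2_\<Phi>)
  qed
  define k where "k = (LEAST k. taylor_coeff (\<Phi> N) k \<noteq> 0)"
  have k: "taylor_coeff (\<Phi> N) k \<noteq> 0" unfolding k_def by (rule LeastI_ex) fact
  have k0: "taylor_coeff (\<Phi> N) j = 0" if "j < k" for j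
    using not_less_Least[of j "\<lambda>k. taylor_coeff (\<Phi> N) k \<noteq> 0"] that by (simp add: k_def)
  define c where "c = (norm (taylor_coeff (\<Phi> N) k))\<^sup>2 / 2"
  have c: "c > 0" using k by (simp add: c_def)
  have cle: "c \<le> (norm (taylor_coeff (\<Phi> n) k))\<^sup>2" if "N \<le> n" for n
    using mult_left_mono[OF Gge[of n], of "(norm (taylor_coeff (\<Phi> N) k))\<^sup>2"]
    by (simp add: taylor_\<Phi>_lowest[OF that k0] c_def norm_mult power_mult_distrib)
  have bd: "\<exists>B. \<forall>f\<in>{f \<in> dir_space. dir_norm2 f \<le> 1}. \<forall>x\<in>K. norm (f x) \<le> B" if K: "compact K" "K \<subseteq> unit_disk" for K
  proof (cases "K = {}")
    case False
    have "\<exists>x\<in>K. \<forall>y\<in>K. norm y \<le> norm x"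
      by (rule continuous_attains_sup[OF K(1) False]) (intro continuous_intros)
    then obtain x where x: "x \<in> K" "\<And>y. y \<in> K \<Longrightarrow> norm y \<le> norm x" by blast
    have "norm (f y) \<le> (1 + 1 / (1 - (norm x)\<^sup>2)) / 2" if f: "f \<in> dir_space" "dir_norm2 f \<le> 1" and y: "y \<in> K" for f y
    proof -
      have "norm x < 1" "norm y \<le> norm x" using x y K(2) by auto
      then have "(norm x)\<^sup>2 < 1" "(norm y)\<^sup>2 \<le> (norm x)\<^sup>2" by (auto simp: abs_square_less_1 power_mono)
      then have "1 / (1 - (norm y)\<^sup>2) \<le> 1 / (1 - (norm x)\<^sup>2)" by (intro divide_left_mono mult_pos_pos) linarith+
      then show ?thesis using norm_le_dir_norm2[OF f(1), of y] f(2) \<open>norm x < 1\<close> \<open>norm y \<le> norm x\<close> by simp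
    qed
    then show ?thesis by blast
  qed simp
  obtain g r where g: "g holomorphic_on unit_disk" and r: "strict_mono (r :: nat \<Rightarrow> nat)"
    and lim: "\<And>K. compact K \<Longrightarrow> K \<subseteq> unit_disk \<Longrightarrow> uniform_limit K (\<Phi> \<circ> r) g sequentially"
  proof (rule Montel[of unit_disk "{f \<in> dir_space. dir_norm2 f \<le> 1}" \<Phi>])
    show "range \<Phi> \<subseteq> {f \<in> dir_space. dir_norm2 f \<le> 1}" using \<Phi>_dir_space dir_norm2_\<Phi> by auto
  qed (use bd dir_space_holo in auto)
  have dl: "(\<lambda>n. (deriv ^^ j) (\<Phi> (r n)) w) \<longlonglongrightarrow> (deriv ^^ j) g w" if "norm w < 1" for j w
    using higher_deriv_uniform_limit[OF _ g lim that, of j] dir_space_holo[OF \<Phi>_dir_space] by simp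
  have tl: "(\<lambda>n. taylor_coeff (\<Phi> (r n)) j) \<longlonglongrightarrow> taylor_coeff g j" for j
    unfolding taylor_coeff_def by (intro tendsto_divide dl tendsto_const) auto
  \<comment> \<open>The norm is lower semicontinuous: each partial sum converges along the
    subsequence and is at most 1.\<close>
  have "summable (\<lambda>n. real (n + 1) * (norm (taylor_coeff g n))\<^sup>2)"
  proof (rule summableI_nonneg_bounded)
    fix J
    show "(\<Sum>n<J. real (n + 1) * (norm (taylor_coeff g n))\<^sup>2) \<le> 1"
    proof (rule LIMSEQ_le_const2)
      show "(\<lambda>i. \<Sum>n<J. real (n + 1) * (norm (taylor_coeff (\<Phi> (r i)) n))\<^sup>2) \<longlonglongrightarrow> (\<Sum>n<J. real (n + 1) * (norm (taylor_coeff g n))\<^sup>2)"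
        by (intro tendsto_intros tl)
      have "(\<Sum>n<J. real (n + 1) * (norm (taylor_coeff (\<Phi> i) n))\<^sup>2) \<le> 1" for i
        using sum_le_suminf[OF dir_space_summable[OF \<Phi>_dir_space[of i]], of "{..<J}"] dir_norm2_\<Phi>[of i] by (simp add: dir_norm2_def)
      then show "\<exists>M. \<forall>i\<ge>M. (\<Sum>n<J. real (n + 1) * (norm (taylor_coeff (\<Phi> (r i)) n))\<^sup>2) \<le> 1" by blast
    qed
  qed simp
  then have gw: "g \<in> dir_space" using g by (simp add: dir_space_def)
  have "c \<le> (norm (taylor_coeff g k))\<^sup>2"
  proof (rule LIMSEQ_le_const)
    show "(\<lambda>n. (norm (taylor_coeff (\<Phi> (r n)) k))\<^sup>2) \<longlonglongrightarrow> (norm (taylor_coeff g k))\<^sup>2" by (intro tendsto_intros tl)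
    show "\<exists>M. \<forall>n\<ge>M. c \<le> (norm (taylor_coeff (\<Phi> (r n)) k))\<^sup>2"
      using cle seq_suble[OF r] by (intro exI[of _ N]) (meson order_trans)
  qed
  then have gk: "taylor_coeff g k \<noteq> 0" using c by auto
  have "\<exists>w\<in>unit_disk. g w \<noteq> 0"
  proof (rule ccontr)
    assume "\<not> ?thesis"
    then have "taylor_coeff g k = taylor_coeff (\<lambda>x. 0 * 1) k" by (intro taylor_coeff_cong) auto
    also have "\<dots> = 0 * taylor_coeff (\<lambda>x. 1) k" by (rule taylor_coeff_cmult) simp
    finally show False using gk by simp
  qed
  moreover have "vanishes_on {1..} z g"
    unfolding vanishes_on_def
  proof (intro allI impI)
    fix w J assume J: "J \<subseteq> {i \<in> {1..}. z i = w}" "finite J"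
    show "zero_of_order_ge g w (card J)"
    proof (cases "J = {}")
      case False
      then have w: "norm w < 1" using J z by auto
      \<comment> \<open>From n = M on all indices of \<open>J\<close> belong to {1..n}, so \<Phi> n
        has the full multiplicity at w.\<close>
      define M where "M = Max J"
      have M: "J \<subseteq> {i \<in> {1..n}. z i = w}" if "M \<le> n" for n
        using J that by (auto simp: M_def intro: order_trans[OF Max_ge])
      have "(deriv ^^ j) g w = 0" if j: "j < card J" for j
      proof -
        have "(deriv ^^ j) (\<Phi> (r n)) w = 0" if "M \<le> n" for n
        proof -
          have "M \<le> r n" using that seq_suble[OF r, of n] by simp
          then have "J \<subseteq> {i \<in> {1..r n}. z i = w}" by (rule M)
          then have "zero_of_order_ge (\<Phi> (r n)) w (card J)"
            using vanishes_\<Phi>[of "r n", unfolded vanishes_on_def, rule_format, of J w] J(2) by simp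
          then show ?thesis using j by (simp add: zero_of_order_ge_def)
        qed
        then have "(\<lambda>n. (deriv ^^ j) (\<Phi> (r n)) w) \<longlonglongrightarrow> 0"
          by (intro tendsto_eventually) (auto simp: eventually_sequentially)
        then show ?thesis using dl[OF w, of j] LIMSEQ_unique by blast
      qed
      then show ?thesis by (simp add: zero_of_order_ge_def)
    qed (simp add: zero_of_order_ge_def)
  qed
  ultimately show ?thesis
    unfolding is_zero_set_def vanishing_subspace_def using gw by (auto simp: dirichlet_space_eq_dir_space)
qed

text \<open>Dividing a non-zero function H with the prescribed zeros by \<Phi> n gives u with |u
  0|^2 <= \<open>dir_norm2 H\<close>. Comparing the lowest coefficients at 0, this bounds the tail
  products of 1 - t j from below, and 1 - x <= exp (- x) turns the bound into one for the
  sums.\<close>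

theorem summable_if_zero_set:
  assumes "is_zero_set \<m> {1..} z"
  shows "summable t"
proof -
  obtain F x0 where F: "F \<in> dir_space" and v: "vanishes_on {1..} z F" and x0: "norm x0 < 1" "F x0 \<noteq> 0"
    using assms by (auto simp: is_zero_set_def vanishing_subspace_def dirichlet_space_eq_dir_space)
  note Fh = dir_space_holo[OF F]
  have "\<exists>s. taylor_coeff F s \<noteq> 0"
  proof (rule ccontr)
    assume "\<not> ?thesis"
    then have "(\<lambda>n. 0) sums F x0" using taylor_sums[OF Fh x0(1)] by simp
    then show False using x0(2) by (simp add: sums_iff)
  qed
  define s where "s = (LEAST s. taylor_coeff F s \<noteq> 0)"
  have s: "taylor_coeff F s \<noteq> 0" unfolding s_def by (rule LeastI_ex) fact
  have s0: "taylor_coeff F j = 0" if "j < s" for j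
    using not_less_Least[of j "\<lambda>k. taylor_coeff F k \<noteq> 0"] that by (simp add: s_def)
  obtain g where g: "g holomorphic_on unit_disk" and Fg: "\<And>x. norm x < 1 \<Longrightarrow> F x = x ^ s * g x"
    using factor_power_at_0[OF Fh s0] by blast
  have pc: "taylor_coeff (\<lambda>x. x ^ k * g x) j = (if j < k then 0 else g 0)" if "j \<le> k" for k j
  proof -
    have hp: "(\<lambda>x::complex. x ^ k) holomorphic_on unit_disk" by (intro holomorphic_intros)
    have "taylor_coeff (\<lambda>x. x ^ k * g x) j = taylor_coeff (\<lambda>x. x ^ k) j * g 0"
      by (rule taylor_coeff_mult_lowest[OF hp g]) (use that in \<open>simp add: taylor_coeff_power\<close>)
    then show ?thesis using that by (auto simp: taylor_coeff_power)
  qed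
  have g0: "g 0 \<noteq> 0"
    using s taylor_coeff_cong[of F "\<lambda>x. x ^ s * g x" s] Fg pc[of s s] by simp
  have gw: "g \<in> dir_space"
    by (rule dir_space_power_unshift[OF g]) (use dir_space_cong[of F "\<lambda>x. x ^ s * g x"] Fg F in simp)
  \<comment> \<open>Infinite multiplicity at 0 would make F vanish there to every order.\<close>
  have fin: "finite {i \<in> {1..}. z i = 0}"
  proof (rule ccontr)
    assume "infinite {i \<in> {1..}. z i = 0}"
    then obtain J where J: "J \<subseteq> {i \<in> {1..}. z i = 0}" "finite J" "card J = Suc s"
      using infinite_arbitrarily_large by blast
    then have "zero_of_order_ge F 0 (Suc s)" using v unfolding vanishes_on_def by metis
    then show False using s by (simp add: zero_of_order_ge_taylor)
  qed
  then obtain N where N: "\<And>i. i \<ge> 1 \<Longrightarrow> z i = 0 \<Longrightarrow> i \<le> N"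
    unfolding finite_nat_set_iff_bounded_le by blast
  define k where "k = card {i \<in> {1..N}. z i = 0}"
  have kn: "card {i \<in> {1..n}. z i = 0} = k" if "N \<le> n" for n
  proof -
    have "i \<le> n" if "i \<ge> 1" "z i = 0" for i using N[OF that] \<open>N \<le> n\<close> by simp
    then have "{i \<in> {1..n}. z i = 0} = {i \<in> {1..N}. z i = 0}" using N by auto
    then show ?thesis by (simp add: k_def)
  qed
  \<comment> \<open>F may vanish at 0 to a higher order than prescribed. The power of x is adjusted
    so that H has order exactly k there, the number of points at 0; otherwise the k-th coefficients
    would give no information.\<close>
  define H where "H x = x ^ k * g x" for x
  have H: "H \<in> dir_space" unfolding H_def[abs_def] by (rule dir_space_power_mult[OF gw])
  have vH: "vanishes_on {1..n} z H" if n: "N \<le> n" for n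
    unfolding vanishes_on_finite_iff[OF finite_atLeastAtMost]
  proof
    fix w
    let ?c = "card {i \<in> {1..n}. z i = w}"
    consider "w = 0" | "w \<noteq> 0" "norm w < 1" | "{i \<in> {1..n}. z i = w} = {}" using z by fastforce
    then show "zero_of_order_ge H w ?c"
    proof cases
      case 1
      have "zero_of_order_ge H 0 k" unfolding zero_of_order_ge_taylor H_def[abs_def] using pc[of _ k] by simp
      then show ?thesis using kn[OF n] 1 by simp
    next
      case 2
      have "{i \<in> {1..n}. z i = w} \<subseteq> {i \<in> {1..}. z i = w}" by auto
      then have "zero_of_order_ge F w ?c" using v unfolding vanishes_on_def by auto
      then have "zero_of_order_ge (\<lambda>x. x ^ s * g x) w ?c"
        using zero_of_order_ge_cong[of unit_disk w F "\<lambda>x. x ^ s * g x"] Fg 2 by simp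
      then show ?thesis unfolding H_def[abs_def] using zero_of_order_ge_power_mult[OF g 2(2,1)] by simp
    next
      case 3
      then have c0: "?c = 0" by (simp only: card.empty)
      show ?thesis unfolding c0 zero_of_order_ge_def by simp
    qed
  qed
  define b where "b = (norm (g 0))\<^sup>2"
  define A where "A = (norm (taylor_coeff (\<Phi> N) k))\<^sup>2 * dir_norm2 H"
  have b: "b > 0" using g0 by (simp add: b_def)
  have low: "taylor_coeff (\<Phi> N) j = 0" if "j < k" for j
  proof -
    have "zero_of_order_ge (\<Phi> N) 0 k" using vanishes_\<Phi>[of N] unfolding vanishes_on_finite_iff[OF finite_atLeastAtMost] k_def by blast
    then show ?thesis using that by (simp add: zero_of_order_ge_taylor)
  qed
  have main: "b \<le> A * (\<Prod>j\<in>{N..<n}. 1 - t j)" if n: "N \<le> n" for n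
  proof -
    interpret E: extremal_extension "\<Phi> n" "R n" by (rule ext)
    have "vanishes_on {1..n} z H \<longleftrightarrow> (\<exists>q. q holomorphic_on unit_disk \<and> (\<forall>x\<in>unit_disk. H x = zero_prod {1..n} z x * q x))"
      by (rule vanishes_on_iff_factor[OF finite_atLeastAtMost _ open_ball dir_space_holo[OF H]]) (use z' in simp)
    then obtain q where q: "q holomorphic_on unit_disk" "\<And>x. norm x < 1 \<Longrightarrow> H x = zero_prod {1..n} z x * q x"
      using vH[OF n] by auto
    define u where "u x = q x / h n x" for x
    note dv = extremal_structure_divide[where z = z, OF st[of n] finite_atLeastAtMost z' H q]
    have u: "u \<in> dir_space" unfolding u_def[abs_def] by (rule dv(1))
    have Hu: "H x = \<Phi> n x * u x" if "norm x < 1" for x unfolding u_def by (rule dv(2)) (use that in auto)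
    have low': "taylor_coeff (\<Phi> n) j = 0" if j: "j < k" for j
      using taylor_\<Phi>_lowest[OF n, of j] low j by simp
    have "g 0 = taylor_coeff H k" unfolding H_def[abs_def] using pc[of k k] by simp
    also have "\<dots> = taylor_coeff (\<lambda>x. \<Phi> n x * u x) k" by (rule taylor_coeff_cong[OF Hu])
    also have "\<dots> = taylor_coeff (\<Phi> n) k * u 0"
      by (rule taylor_coeff_mult_lowest[OF dir_space_holo[OF \<Phi>_dir_space] dir_space_holo[OF u] low'])
    also have "taylor_coeff (\<Phi> n) k = taylor_coeff (\<Phi> N) k * G N n 0" by (rule taylor_\<Phi>_lowest[OF n low])
    finally have "b = (norm (taylor_coeff (\<Phi> N) k))\<^sup>2 * (norm (G N n 0))\<^sup>2 * (norm (u 0))\<^sup>2"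
      by (simp add: b_def norm_mult power_mult_distrib)
    also have "\<dots> \<le> (norm (taylor_coeff (\<Phi> N) k))\<^sup>2 * (norm (G N n 0))\<^sup>2 * dir_norm2 H"
      using E.norm_at_0_le_mult[OF u] dir_norm2_cong[OF Hu] by (intro mult_left_mono) auto
    finally show ?thesis unfolding norm_G_0 A_def by (simp add: mult_ac)
  qed
  \<comment> \<open>For n = N the product is empty, which gives b <= A.\<close>
  have A: "A > 0" using main[of N] b by simp
  have sum_le: "sum t {N..<n} \<le> ln (A / b)" for n
  proof (cases "N \<le> n")
    case True
    have "b \<le> A * (\<Prod>j\<in>{N..<n}. 1 - t j)" by (rule main[OF True])
    also have "\<dots> \<le> A * (\<Prod>j\<in>{N..<n}. exp (- t j))"
      using A t_bounds exp_ge_add_one_self[of "- t _"] by (intro mult_left_mono prod_mono) (auto simp: algebra_simps)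
    also have "(\<Prod>j\<in>{N..<n}. exp (- t j)) = exp (- sum t {N..<n})"
      by (simp add: exp_sum[symmetric] sum_negf)
    finally have "exp (sum t {N..<n}) \<le> A / b" using b by (simp add: exp_minus field_simps)
    then show ?thesis using A b by (simp add: ln_ge_iff)
  next
    case False
    have "b \<le> A" using main[of N] by simp
    then show ?thesis using False b by simp
  qed
  have "summable (\<lambda>j. t (j + N))"
  proof (rule summableI_nonneg_bounded)
    show "(\<Sum>j<n. t (j + N)) \<le> ln (A / b)" for n
      using sum_le[of "n + N"] sum.shift_bounds_nat_ivl[of t 0 N n] by (simp add: lessThan_atLeast0)
  qed (rule t_bounds)
  then show ?thesis by (simp add: summable_iff_shift)
qed

end

theorem theorem3p1:
  fixes z :: "nat \<Rightarrow> complex"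
    and \<phi> :: "nat \<Rightarrow> complex \<Rightarrow> complex"
    and \<mu> :: "nat \<Rightarrow> complex measure"
  assumes "\<And>n. n \<ge> 1 \<Longrightarrow> z n \<in> unit_disk"
    and "\<And>n. n \<ge> 1 \<Longrightarrow>
           extremal_function norm_arc_length (vanishing_subspace norm_arc_length {1..n} z) (\<phi> n)"
    and "\<mu> 0 = norm_arc_length"
    and "\<And>n. n \<ge> 1 \<Longrightarrow>
           \<mu> n = density norm_arc_length (\<lambda>\<zeta>. ennreal ((norm (boundary_value (\<phi> n) \<zeta>))\<^sup>2))"
  shows "is_zero_set norm_arc_length {1..} z \<longleftrightarrow>
           summable (\<lambda>n. 1 / reproducing_kernel (\<mu> n) (z (n + 1)) (z (n + 1)))"
proof -
  have z: "norm (z n) < 1" if "n \<ge> 1" for n using assms(1)[OF that] by simp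
  \<comment> \<open>The chain starts with the constant 1, the extremal function of the empty
    sequence, whose boundary values give \<open>\<m>\<close> the density 1 and so match
    \<open>\<mu> 0\<close>.\<close>
  define \<phi>' where "\<phi>' n = (if n = 0 then (\<lambda>_. 1) else \<phi> n)" for n
  have "\<exists>\<Phi> h R. extremal_structure {1..n} z (\<phi>' n) \<Phi> h R" for n
  proof (cases "n = 0")
    case True
    have "extremal_structure {1..n} z (\<phi>' n) (\<lambda>_. 1) (\<lambda>_. 1) 2"
      using extremal_extension_one True by (simp add: extremal_structure_def \<phi>'_def zero_prod_def)
    then show ?thesis by blast
  next
    case False
    then show ?thesis using extremal_structure_exists[OF finite_atLeastAtMost _ assms(2), of n] z by (simp add: \<phi>'_def)
  qed
  then obtain \<Phi> h R where st: "\<And>n. extremal_structure {1..n} z (\<phi>' n) (\<Phi> n) (h n) (R n)" by metis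
  have st': "extremal_structure (insert (Suc n) {1..n}) z (\<phi>' (Suc n)) (\<Phi> (Suc n)) (h (Suc n)) (R (Suc n))" for n
    using st[of "Suc n"] by (simp add: atLeastAtMostSuc_conv)
  define \<psi> where "\<psi> n x = (x - z (Suc n)) * h (Suc n) x / h n x" for n x
  have ni: "Suc n \<notin> {1..n}" for n by simp
  have zi: "norm (z k) < 1" if "k \<in> insert (Suc n) {1..n}" for n k using that z by auto
  note ks = kernel_step[where z = z, OF st st' finite_atLeastAtMost ni zi, folded \<psi>_def]
  interpret extremal_chain z \<Phi> h \<psi> \<phi>' R
    by standard (use z st ks in \<open>auto simp: \<psi>_def[abs_def]\<close>)
  have \<mu>: "\<mu> n = extremal_extension.\<mu> (\<Phi> n)" for n
  proof -
    interpret E: extremal_extension "\<Phi> n" "R n" by (rule ext)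
    have bv: "boundary_value (\<phi>' n) \<zeta> = \<Phi> n \<zeta>" if "norm \<zeta> = 1" for \<zeta>
    proof -
      have "boundary_value (\<phi>' n) \<zeta> = boundary_value (\<Phi> n) \<zeta>"
        by (rule boundary_value_disk_cong) (use st[of n] that in \<open>auto simp: extremal_structure_def\<close>)
      also have "\<dots> = \<Phi> n \<zeta>"
        by (rule boundary_value_continuous[OF _ that], rule holomorphic_on_imp_continuous_on,
            rule holomorphic_on_subset[OF E.holo]) (use E.R in auto)
      finally show ?thesis .
    qed
    have "\<phi>' n \<in> dir_space"
      using dir_space_cong[of "\<phi>' n" "\<Phi> n"] \<Phi>_dir_space st[of n] by (auto simp: extremal_structure_def)
    then have [measurable]: "boundary_value (\<phi>' n) \<in> borel_measurable \<m>"
      by (intro hardy2_boundary_measurable dir_space_imp_hardy2)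
    have [measurable]: "\<Phi> n \<in> borel_measurable \<m>"
      by (intro continuous_circle_measurable E.cont_circle)
    have "density \<m> (\<lambda>\<zeta>. ennreal ((norm (boundary_value (\<phi>' n) \<zeta>))\<^sup>2)) = E.\<mu>"
      unfolding E.\<mu>_def by (rule density_cong) (use bv in \<open>auto intro!: AE_I2\<close>)
    moreover have "\<mu> n = density \<m> (\<lambda>\<zeta>. ennreal ((norm (boundary_value (\<phi>' n) \<zeta>))\<^sup>2))"
    proof (cases "n = 0")
      case True
      have "boundary_value (\<lambda>_. 1) \<zeta> = 1" for \<zeta> by (rule boundary_value_eqI) simp
      then show ?thesis using True assms(3) by (simp add: \<phi>'_def density_1)
    qed (use assms(4) in \<open>simp add: \<phi>'_def\<close>)
    ultimately show ?thesis by simp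
  qed
  \<comment> \<open>The reciprocals are real, so the complex series is that of \<open>t\<close>; its
    term n belongs to the step that adds the point z (n + 1).\<close>
  have "1 / reproducing_kernel (\<mu> n) (z (n + 1)) (z (n + 1)) = of_real (t n)" for n
    using ks(4)[of n] by (simp add: \<mu> t_def \<psi>_def)
  then have "summable (\<lambda>n. 1 / reproducing_kernel (\<mu> n) (z (n + 1)) (z (n + 1))) \<longleftrightarrow> summable t"
    by (simp only: summable_complex_of_real)
  then show ?thesis using zero_set_if_summable summable_if_zero_set by blast
qed

end
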